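(* Let $k,N$ be integers with $2\le k<N$, and let $g$ be a bistable nonlinearity with parameters $0<\beta<\alpha$. Then for any $\xi\in\mathbb R$ there is a unique radial solution $(R,u)$ to $\mathcal P_k^+U+g(U)=0$ starting from $u(0)=\xi$. Moreover, there are positive numbers $\underline\xi,\xi^{**},\overline\xi$ (independent of $\xi$) satisfying $\beta<\underline\xi\le\xi^{**}\le\overline\xi<\alpha$ such that, depending on $\xi$, this solution has the following properties. (i) If $\xi\in\{-\alpha,0,\alpha\}$ then $u$ is constant (and $R=+\infty$). (ii) If $\xi<-\alpha$ then $u'<0$ on $(0,R)$ and $u(r)\to-\infty$ as $r\nearrow R$. (iii) If $\xi>\alpha$ then $u'>0$ on $(0,R)$ and $u(r)\to+\infty$ as $r\nearrow R$. (iv) If $-\alpha<\xi<0$ then $R=+\infty$, $u'>0$ on $(0,+\infty)$, and $u(r)\to0$ as $r\to+\infty$. (v) If $0<\xi<\alpha$ then the following three outcomes are possible. (a) If $\overline\xi<\xi<\alpha$ then $u'<0$ on $(0,R)$ and $u(r)\to-\infty$ as $r\nearrow R$. (b) If $\xi=\xi^{**}$ then $R=+\infty$, $u'<0$ on $(0,+\infty)$, and $u(r)\to-\alpha$ as $r\to+\infty$. (c) If $0<\xi<\underline\xi$ then $R=+\infty$ and there is $b>0$ such that $u'<0$ on $(0,b)$, $u(b)<0$, $u'>0$ on $(b,+\infty)$, and $u(r)\to0$ as $r\to+\infty$.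
   Context: Bistable nonlinearity with parameters $0<\beta<\alpha$: an odd function $g:\mathbb R\to\mathbb R$ of class $C^1$ such that (1) $g>0$ on $(0,\alpha)$ and $g<0$ on $(\alpha,+\infty)$; (2) $g'>0$ on $[0,\beta)$ and $g'<0$ on $(\beta,+\infty)$; (3) $g$ is twice differentiable at $\pm\beta$ and $g''(\beta)<0$. Truncated Laplacian: for $1\le k<N$ and a function $U$ on (a subset of) $\mathbb R^N$ that is $C^2$ near $x$, let $\lambda_1(D^2U(x))\le\dots\le\lambda_N(D^2U(x))$ be the eigenvalues of the Hessian matrix; then $\mathcal P_k^+U(x):=\sum_{i=N-k+1}^N\lambda_i(D^2U(x))$. Radial solution to $\mathcal P_k^+U+g(U)=0$: a pair $(R,u)$ with $0<R\le+\infty$ and $u:[0,R)\to\mathbb R$ piecewise $C^2$ with $u'(0)=0$, such that $U(x):=u(|x|)$ solves $\mathcal P_k^+U+g(U)=0$ on the ball $B(0,R)\subset\mathbb R^N$; moreover, if $R<+\infty$, it is required that $|u(r)|+|u'(r)|\to+\infty$ as $r\nearrow R$ (maximality). Here piecewise $C^2$ means: $u$ is $C^1$ on $[0,R)$ and $C^2$ off a set of points of $(0,R)$ having finitely many elements in each $[0,\rho]$, $\rho<R$, at which $u''$ has finite one-sided limits; the equation is required at all $x$ with $|x|$ outside this exceptional set. *)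

theory Defs
  imports "HOL-Analysis.Analysis" "HOL-Computational_Algebra.Computational_Algebra"
begin

definition bistable :: "real \<Rightarrow> real \<Rightarrow> (real \<Rightarrow> real) \<Rightarrow> bool" where
  "bistable \<alpha> \<beta> g \<longleftrightarrow>
     0 < \<beta> \<and> \<beta> < \<alpha> \<and>
     (\<forall>s. g (- s) = - g s) \<and>
     g C1_differentiable_on UNIV \<and>
     (\<forall>s\<in>{0<..<\<alpha>}. 0 < g s) \<and> (\<forall>s\<in>{\<alpha><..}. g s < 0) \<and>
     (\<forall>s\<in>{0..<\<beta>}. 0 < deriv g s) \<and> (\<forall>s\<in>{\<beta><..}. deriv g s < 0) \<and>
     deriv g differentiable at \<beta> \<and> deriv g differentiable at (- \<beta>) \<and>
     deriv (deriv g) \<beta> < 0"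

definition partial_deriv :: "'n::finite \<Rightarrow> (real ^ 'n \<Rightarrow> real) \<Rightarrow> real ^ 'n \<Rightarrow> real" where
  "partial_deriv i U x = frechet_derivative U (at x) (axis i 1)"

text \<open>Only meaningful at points near which \<open>U\<close> is twice continuously differentiable.\<close>

definition hessian :: "(real ^ 'n::finite \<Rightarrow> real) \<Rightarrow> real ^ 'n \<Rightarrow> real ^ 'n ^ 'n" where
  "hessian U x = (\<chi> i j. partial_deriv i (partial_deriv j U) x)"

definition charpoly :: "real ^ 'n ^ 'n::finite \<Rightarrow> real poly" where
  "charpoly A = det (\<chi> i j. (if i = j then [:0, 1:] else 0) - [:A $ i $ j:])"

text \<open>Eigenvalues in increasing order, repeated according to multiplicity. For a symmetric
  matrix the list has length \<open>CARD('n)\<close>.\<close>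

definition eigenvalue_list :: "real ^ 'n ^ 'n::finite \<Rightarrow> real list" where
  "eigenvalue_list A = sorted_list_of_multiset (proots (charpoly A))"

text \<open>The list is indexed from \<open>0\<close>, so \<open>\<lambda>\<^sub>i\<close> is entry \<open>i - 1\<close>.\<close>

definition truncated_laplacian ::
    "nat \<Rightarrow> (real ^ 'n::finite \<Rightarrow> real) \<Rightarrow> real ^ 'n \<Rightarrow> real" where
  "truncated_laplacian k U x =
     (\<Sum>i = CARD('n) - k + 1..CARD('n). eigenvalue_list (hessian U x) ! (i - 1))"

definition radii :: "ereal \<Rightarrow> real set" where
  "radii R = {r. 0 \<le> r \<and> ereal r < R}"

text \<open>\<open>u\<close> is piecewise twice continuously differentiable on \<open>[0,R)\<close> with exceptional set \<open>E\<close>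
  and derivatives \<open>u'\<close>, \<open>u''\<close>; these are one-sided at \<open>0\<close>, and the values of \<open>u''\<close> on \<open>E\<close>
  are irrelevant.\<close>

definition piecewise_C2 ::
    "ereal \<Rightarrow> real set \<Rightarrow> (real \<Rightarrow> real) \<Rightarrow> (real \<Rightarrow> real) \<Rightarrow> (real \<Rightarrow> real) \<Rightarrow> bool" where
  "piecewise_C2 R E u u' u'' \<longleftrightarrow>
     E \<subseteq> radii R - {0} \<and> (\<forall>\<rho>. ereal \<rho> < R \<longrightarrow> finite (E \<inter> {0..\<rho>})) \<and>
     (\<forall>r\<in>radii R. (u has_real_derivative u' r) (at r within radii R)) \<and>
     continuous_on (radii R) u' \<and>
     (\<forall>r\<in>radii R - E. (u' has_real_derivative u'' r) (at r within radii R)) \<and>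
     continuous_on (radii R - E) u'' \<and>
     (\<forall>e\<in>E. (\<exists>l. (u'' \<longlongrightarrow> l) (at_left e)) \<and> (\<exists>l. (u'' \<longlongrightarrow> l) (at_right e)))"

text \<open>Off the exceptional set, \<open>u\<close> being piecewise \<open>C\<^sup>2\<close> with \<open>u' 0 = 0\<close> makes
  \<open>\<lambda>y. u (norm y)\<close> a \<open>C\<^sup>2\<close> function near \<open>x\<close> (also for \<open>x = 0\<close>), so the Hessian is the genuine
  one. Values of \<open>u\<close> outside \<open>[0,R)\<close> play no role. The first argument fixes the dimension.\<close>

definition radial_solution ::
    "'n::finite itself \<Rightarrow> nat \<Rightarrow> (real \<Rightarrow> real) \<Rightarrow> ereal \<Rightarrow> (real \<Rightarrow> real) \<Rightarrow> bool" where
  "radial_solution _ k g R u \<longleftrightarrow>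
     0 < R \<and>
     (\<exists>E u' u''. piecewise_C2 R E u u' u'' \<and> u' 0 = 0 \<and>
        (\<forall>x :: real ^ 'n. ereal (norm x) < R \<and> norm x \<notin> E \<longrightarrow>
           truncated_laplacian k (\<lambda>y. u (norm y)) x + g (u (norm x)) = 0) \<and>
        (R \<noteq> \<infinity> \<longrightarrow>
           filterlim (\<lambda>r. \<bar>u r\<bar> + \<bar>u' r\<bar>) at_top (at_left (real_of_ereal R))))"

end

theory Submission
  imports Defs
begin

text \<open>For a radial function the Hessian has the eigenvalue \<open>u''\<close> once and \<open>u'/r\<close> with multiplicity
  \<open>N - 1\<close>, so the equation reads \<open>max u'' (u'/r) + (k - 1) u'/r + g(u) = 0\<close>. It is an obstacle
  problem for \<open>p = r ^ (k - 1) u'\<close>: one has \<open>p' \<le> - r ^ (k - 1) g(u)\<close> and \<open>p \<le> - r ^ k g(u) / k\<close>,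
  with equality in the first wherever the second is strict. Solving it by a running infimum,
  \<open>p(r) = inf {- s ^ k g(u(s)) / k - \<integral> t ^ (k - 1) g(u(t)) dt over [s,r] | 0 \<le> s \<le> r}\<close>, expresses
  \<open>u'\<close> as a Lipschitz function of the path \<open>u\<close>. The contraction principle then gives existence,
  uniqueness and continuous dependence at once, without distinguishing the two regimes of the
  maximum and in spite of the singularity at \<open>r = 0\<close>.

  The sign of \<open>g'(u) u'\<close> governs the passage between the regimes, and every solution of the bistable
  problem switches at most twice. Starting from \<open>0 < \<xi> < \<alpha>\<close>, \<open>u\<close> decreases to negative values; then
  it turns before \<open>- \<alpha>\<close>, or passes \<open>- \<alpha>\<close>, or converges to it. The first two alternatives are open in
  \<open>\<xi>\<close> and exclude each other. Dissipation of energy gives the first for \<open>\<xi> \<le> \<beta>\<close>, and near \<open>\<alpha>\<close> the second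
  holds since \<open>u\<close> crosses \<open>\<beta>\<close> late and therefore fast. Connectedness yields a starting
  value of the third kind.\<close>

section \<open>Radial functions and the truncated Laplacian\<close>

text \<open>The equation has the form \<open>max X Y = 0\<close> with
  \<open>X = u'' + (k - 1) u'/r + g(u)\<close> and \<open>Y = k u'/r + g(u)\<close>, so
  \<open>p + flux\<close> can decrease only while it touches the obstacle. This is a Skorokhod
  reflection, and an infimum is 1-Lipschitz in the supremum norm: a fully nonlinear equation becomes
  a first-order equation with memory. The price is regularity. A reflected path is only
  \<open>C^1\<close> a priori and might touch its obstacle on a complicated closed set, whereas a
  radial solution must be \<open>C^2\<close> off a locally finite set. Uniqueness needs no
  qualitative information, but existence does: the profile has to be understood far enough to bound
  the number of regime changes before the path is known to be a radial solution. The maximum also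
  breaks the symmetry of \<open>u\<close> and \<open>-u\<close> although \<open>g\<close> is odd.
  Bounds from above follow pointwise from \<open>Y <= 0\<close>; bounds from below have to go
  through the momentum \<open>p\<close> and the last contact with the obstacle, so that the
  arguments for rising and for falling solutions are not mirror images.\<close>

lemma det_scalar_minus_rank_one:
  fixes x :: "real ^ 'n::finite"
  assumes "norm x = 1"
  shows "det (\<chi> i j. (if i = j then c else 0) - d * (x $ i * x $ j))
    = c ^ (CARD('n) - 1) * (c - d)"
proof -
  \<comment> \<open>Any coordinate will do; only one basis vector is needed.\<close>
  define k :: 'n where "k = undefined"
  obtain Q :: "real^'n^'n" where Q: "orthogonal_matrix Q" "Q *v axis k 1 = x"
    using orthogonal_matrix_exists_basis[OF assms] by metis
  \<comment> \<open>An orthogonal \<open>Q\<close> taking a basis vector to \<open>x\<close>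
    conjugates the matrix to this diagonal form: the line through \<open>x\<close> carries
    \<open>c - d\<close>, its orthogonal complement carries \<open>c\<close>.\<close>
  define D :: "real^'n^'n" where "D = (\<chi> i j. if i = j then (if i = k then c - d else c) else 0)"
  have Qk: "Q $ i $ k = x $ i" for i
    using Q(2) by (auto simp: matrix_vector_mul_component inner_axis row_def
        matrix_vector_mult_def axis_def if_distrib cong: if_cong)
  have QQ: "(\<Sum>l\<in>UNIV. Q $ i $ l * Q $ j $ l) = (if i = j then 1 else 0)" for i j
  proof -
    have "Q ** transpose Q = mat 1" using Q(1) by (simp add: orthogonal_matrix_def)
    then have "(Q ** transpose Q) $ i $ j = mat 1 $ i $ j" by simp
    then show ?thesis by (simp add: matrix_matrix_mult_def transpose_def mat_def)
  qed
  have "(Q ** D ** transpose Q) $ i $ j = (if i = j then c else 0) - d * (x $ i * x $ j)" for i j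
  proof -
    have "(Q ** D ** transpose Q) $ i $ j
      = (\<Sum>l\<in>UNIV. Q $ i $ l * (if l = k then c - d else c) * Q $ j $ l)"
    proof -
      have "(\<Sum>m\<in>UNIV. Q $ i $ m * D $ m $ l) = Q $ i $ l * (if l = k then c - d else c)" for l
      proof -
        have "(\<Sum>m\<in>UNIV. Q $ i $ m * D $ m $ l)
          = (\<Sum>m\<in>UNIV. if m = l then Q $ i $ l * (if l = k then c - d else c) else 0)"
          by (rule sum.cong) (auto simp: D_def)
        then show ?thesis by simp
      qed
      then show ?thesis by (simp add: matrix_matrix_mult_def transpose_def)
    qed
    also have "\<dots> = (\<Sum>l\<in>UNIV. c * (Q $ i $ l * Q $ j $ l)
        - (if l = k then d * (Q $ i $ l * Q $ j $ l) else 0))"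
      by (intro sum.cong) (auto simp: algebra_simps)
    also have "\<dots> = c * (if i = j then 1 else 0) - d * (Q $ i $ k * Q $ j $ k)"
      by (simp add: sum_subtractf sum_distrib_left[symmetric] QQ)
    finally show ?thesis by (simp add: Qk)
  qed
  then have "(\<chi> i j. (if i = j then c else 0) - d * (x $ i * x $ j)) = Q ** D ** transpose Q"
    by (simp add: vec_eq_iff)
  moreover have "det (Q ** D ** transpose Q) = (det Q * det (transpose Q)) * det D"
    by (simp add: det_mul)
  moreover have "det Q * det (transpose Q) = 1"
    using Q(1) det_mul[of Q "transpose Q"] by (simp add: orthogonal_matrix_def)
  moreover have "det D = c ^ (CARD('n) - 1) * (c - d)"
  proof -
    have "det D = (\<Prod>i\<in>UNIV. if i = k then c - d else c)"
      by (subst det_diagonal) (auto simp: D_def)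
    also have "\<dots> = (c - d) * (\<Prod>i\<in>UNIV - {k}. c)"
      by (subst prod.remove[of _ k]) (auto intro: prod.cong)
    finally show ?thesis by simp
  qed
  ultimately show ?thesis by simp
qed

text \<open>Evaluation at a real \<open>t\<close> commutes with the Leibniz expansion and turns the
  determinant over polynomials into the real one just computed; real polynomials with equal values
  everywhere are equal.\<close>

lemma charpoly_diagonal_plus_rank_one:
  fixes x :: "real ^ 'n::finite"
  assumes "norm x = 1"
  shows "charpoly (\<chi> i j. (if i = j then \<mu> else 0) + (\<kappa> - \<mu>) * (x $ i * x $ j))
    = [:-\<mu>, 1:] ^ (CARD('n) - 1) * [:-\<kappa>, 1:]"
proof -
  let ?A = "\<chi> i j. (if i = j then \<mu> else 0) + (\<kappa> - \<mu>) * (x $ i * x $ j)"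
  have "poly (charpoly ?A) t = poly ([:-\<mu>, 1:] ^ (CARD('n) - 1) * [:-\<kappa>, 1:]) t" for t
  proof -
    have "poly (charpoly ?A) t
      = det (\<chi> i j. (if i = j then t - \<mu> else 0) - (\<kappa> - \<mu>) * (x $ i * x $ j))"
      unfolding charpoly_def det_def poly_sum
    proof (rule sum.cong[OF refl], goal_cases)
      case (1 p)
      have "poly (\<Prod>i\<in>UNIV. (\<chi> i j. (if i = j then [:0, 1:] else 0) - [:?A $ i $ j:]) $ i $ p i) t
        = (\<Prod>i\<in>UNIV. (\<chi> i j. (if i = j then t - \<mu> else 0) - (\<kappa> - \<mu>) * (x $ i * x $ j)) $ i $ p i)"
        unfolding poly_prod by (rule prod.cong) auto
      moreover have "poly (of_int (sign p)) t = of_int (sign p)"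
        by (simp add: sign_def)
      ultimately show ?case by simp
    qed
    then show ?thesis
      by (simp only: det_scalar_minus_rank_one[OF assms]) (simp add: poly_power algebra_simps)
  qed
  then show ?thesis
    using poly_eq_poly_eq_iff by blast
qed

text \<open>After sorting, the simple eigenvalue \<kappa> stands last or first. In the second case
  \<open>k < CARD('n)\<close> keeps it out of the top \<open>k\<close> entries, which then all equal
  \<mu>.\<close>

lemma truncated_laplacian_diagonal_plus_rank_one:
  fixes y :: "real ^ 'n::finite"
  assumes "norm y = 1" and "1 \<le> k" and "k < CARD('n)"
    and "hessian U x = (\<chi> i j. (if i = j then \<mu> else 0) + (\<kappa> - \<mu>) * (y $ i * y $ j))"
  shows "truncated_laplacian k U x = (real k - 1) * \<mu> + max \<kappa> \<mu>"
proof -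
  let ?N = "CARD('n)"
  let ?L = "eigenvalue_list (hessian U x)"
  have "proots (charpoly (hessian U x)) = mset (\<kappa> # replicate (?N - 1) \<mu>)"
    unfolding assms(4) charpoly_diagonal_plus_rank_one[OF assms(1)]
    by (subst proots_mult) (auto simp: proots_power)
  then have L: "?L = sort (\<kappa> # replicate (?N - 1) \<mu>)"
    by (simp only: eigenvalue_list_def sorted_list_of_multiset_mset)
  have split: "{?N - k + 1..?N} = insert ?N {?N - k + 1..?N - 1}"
    using assms by auto
  show ?thesis
  proof (cases "\<mu> < \<kappa>")
    case True
    have "?L = replicate (?N - 1) \<mu> @ [\<kappa>]"
      unfolding L by (rule properties_for_sort) (use True in \<open>auto simp: sorted_append\<close>)
    then have eq: "?L ! (?N - 1) = \<kappa>" "\<And>i. i < ?N - 1 \<Longrightarrow> ?L ! i = \<mu>"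
      by (auto simp: nth_append)
    have "truncated_laplacian k U x
      = ?L ! (?N - 1) + (\<Sum>i = ?N - k + 1..?N - 1. ?L ! (i - 1))"
      unfolding truncated_laplacian_def split by (rule sum.insert) (use assms(2,3) in auto)
    also have "\<dots> = \<kappa> + (\<Sum>i = ?N - k + 1..?N - 1. \<mu>)"
      unfolding eq(1) by (rule arg_cong[OF sum.cong[OF refl eq(2)]]) (use assms(2,3) in auto)
    finally have "truncated_laplacian k U x = \<kappa> + (\<Sum>i = ?N - k + 1..?N - 1. \<mu>)" .
    then show ?thesis using True assms by (simp add: of_nat_diff algebra_simps max_def)
  next
    case False
    have "?L = \<kappa> # replicate (?N - 1) \<mu>"
      unfolding L by (rule properties_for_sort) (use False in auto)
    then have eq: "\<And>i. 1 \<le> i \<Longrightarrow> i < ?N \<Longrightarrow> ?L ! i = \<mu>"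
      by (auto simp: nth_Cons')
    have "truncated_laplacian k U x = (\<Sum>i = ?N - k + 1..?N. \<mu>)"
      unfolding truncated_laplacian_def
      by (rule sum.cong) (use assms(2,3) in \<open>auto intro!: eq\<close>)
    then show ?thesis using False assms by (simp add: of_nat_diff algebra_simps max_def)
  qed
qed

section \<open>Hessians of radial functions, away from the origin and at it\<close>

lemma norm_has_derivative:
  fixes x :: "'a::real_inner"
  assumes "x \<noteq> 0"
  shows "(norm has_derivative (\<lambda>h. (x \<bullet> h) / norm x)) (at x)"
  using has_derivative_norm[OF assms] 
  by (simp add: sgn_div_norm divide_inverse inner_commute mult.commute)

lemma partial_deriv_radial:
  fixes x :: "real ^ 'n::finite"
  assumes "x \<noteq> 0" and "(u has_real_derivative d) (at (norm x))"
  shows "partial_deriv j (\<lambda>y. u (norm y)) x = d * (x $ j / norm x)"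
proof -
  have "((\<lambda>y. u (norm y)) has_derivative (\<lambda>h. d * ((x \<bullet> h) / norm x))) (at x)"
    using has_derivative_compose[OF norm_has_derivative[OF assms(1)]
        assms(2)[unfolded has_field_derivative_def]] by simp
  then have "frechet_derivative (\<lambda>y. u (norm y)) (at x) = (\<lambda>h. d * ((x \<bullet> h) / norm x))"
    by (rule frechet_derivative_at[symmetric])
  then show ?thesis by (simp add: partial_deriv_def inner_axis)
qed

text \<open>The radial direction carries \<open>u''\<close> and all tangential directions carry
  \<open>u'/r\<close>. The second derivative is required at the single radius \<open>norm x\<close>
  only.\<close>

lemma hessian_radial:
  fixes x :: "real ^ 'n::finite"
  assumes "x \<noteq> 0" and "e > 0"
    and u: "\<And>r. \<bar>r - norm x\<bar> < e \<Longrightarrow> (u has_real_derivative v r) (at r)"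
    and v: "(v has_real_derivative a) (at (norm x))"
  shows "hessian (\<lambda>y. u (norm y)) x = (\<chi> i j. (if i = j then v (norm x) / norm x else 0)
    + (a - v (norm x) / norm x) * ((x /\<^sub>R norm x) $ i * (x /\<^sub>R norm x) $ j))"
proof -
  \<comment> \<open>This ball avoids the origin, where the norm is not differentiable, and keeps all
    norms within \<open>e\<close> of \<open>norm x\<close>.\<close>
  let ?S = "ball x (min e (norm x))"
  have xS: "x \<in> ?S" using assms by auto
  have S: "y \<noteq> 0 \<and> \<bar>norm y - norm x\<bar> < e" if "y \<in> ?S" for y
  proof -
    have "norm (x - y) < e" "norm (x - y) < norm x" using that by (auto simp: dist_norm)
    moreover have "\<bar>norm y - norm x\<bar> \<le> norm (x - y)" 
      by (metis norm_triangle_ineq3 norm_minus_commute)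
    ultimately show ?thesis by auto
  qed
  have "partial_deriv i (partial_deriv j (\<lambda>y. u (norm y))) x
    = (if i = j then v (norm x) / norm x else 0)
    + (a - v (norm x) / norm x) * ((x /\<^sub>R norm x) $ i * (x /\<^sub>R norm x) $ j)" for i j
  proof -
    have vn: "((\<lambda>y. v (norm y)) has_derivative (\<lambda>h. a * ((x \<bullet> h) / norm x))) (at x)"
      using has_derivative_compose[OF norm_has_derivative[OF assms(1)]
          v[unfolded has_field_derivative_def]] by simp
    have "((\<lambda>y. v (norm y) * (y $ j / norm y)) has_derivative
      (\<lambda>h. v (norm x) * (h $ j / norm x - x $ j * ((x \<bullet> h) / norm x) / (norm x)^2)
         + a * ((x \<bullet> h) / norm x) * (x $ j / norm x))) (at x)"
      using assms(1)
      by (auto intro!: derivative_eq_intros vn norm_has_derivative has_derivative_componentwise_within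
          bounded_linear.has_derivative[OF bounded_linear_vec_nth]
          simp: fun_eq_iff power2_eq_square divide_simps) (simp add: algebra_simps)?
    then have "((partial_deriv j (\<lambda>y. u (norm y))) has_derivative
      (\<lambda>h. v (norm x) * (h $ j / norm x - x $ j * ((x \<bullet> h) / norm x) / (norm x)^2)
         + a * ((x \<bullet> h) / norm x) * (x $ j / norm x))) (at x)"
    proof (rule has_derivative_transform_within_open[OF _ open_ball xS])
      fix y assume "y \<in> ?S"
      then show "v (norm y) * (y $ j / norm y) = partial_deriv j (\<lambda>y. u (norm y)) y"
        using partial_deriv_radial[OF _ u, of y j] S[of y] by auto
    qed
    then have "frechet_derivative (partial_deriv j (\<lambda>y. u (norm y))) (at x) =
      (\<lambda>h. v (norm x) * (h $ j / norm x - x $ j * ((x \<bullet> h) / norm x) / (norm x)^2)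
         + a * ((x \<bullet> h) / norm x) * (x $ j / norm x))"
      by (rule frechet_derivative_at[symmetric])
    then have "partial_deriv i (partial_deriv j (\<lambda>y. u (norm y))) x
      = v (norm x) * (axis i 1 $ j / norm x - x $ j * (x $ i / norm x) / (norm x)^2)
         + a * (x $ i / norm x) * (x $ j / norm x)"
      unfolding partial_deriv_def[of i] by (simp add: inner_axis)
    moreover have "axis i 1 $ j = (if i = j then 1 else (0::real))"
      by (simp add: axis_def)
    moreover have "(v (norm x) * (b / n - p * (q / n) / n^2) + a * (q / n) * (p / n)
        = b * (v (norm x) / n) + (a - v (norm x) / n) * ((q / n) * (p / n)))" if "n \<noteq> 0" for b n p q :: real
      using that by (simp add: field_simps power2_eq_square)
    ultimately show ?thesis using assms(1)
      by (simp add: divide_inverse[symmetric] mult.commute[of "inverse _"])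
  qed
  then show ?thesis by (simp add: hessian_def)
qed

text \<open>The chain rule fails at the origin, so difference quotients are used:
  \<open>v (norm y) / norm y\<close> tends to \<open>a\<close>, hence
  \<open>v (norm y) * (y $ j / norm y)\<close> differs from \<open>a * y $ j\<close> by
  \<open>o(norm y)\<close>. At \<open>y = 0\<close> division by zero yields the right value
  \<open>0\<close>.\<close>

lemma hessian_radial_0:
  assumes "e > 0" and u: "\<And>r. 0 < r \<Longrightarrow> r < e \<Longrightarrow> (u has_real_derivative v r) (at r)"
    and u0: "(u has_real_derivative 0) (at 0 within {0..})"
    and v0: "(v has_real_derivative a) (at 0 within {0..})" and "v 0 = 0"
  shows "hessian (\<lambda>y. u (norm y)) (0 :: real ^ 'n::finite) = (\<chi> i j. if i = j then a else 0)"
proof -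
  have o: "((\<lambda>y. f (norm y) / norm y) \<longlongrightarrow> b) (at (0 :: real ^ 'n))"
    if "(f has_real_derivative b) (at 0 within {0..})" "f 0 = 0" for f b
  proof -
    have "((\<lambda>r. f r / r) \<longlongrightarrow> b) (at 0 within {0..})"
      using that unfolding has_field_derivative_iff by simp
    moreover have "filterlim norm (at 0 within {0..}) (at (0 :: real ^ 'n))"
      unfolding filterlim_at by (auto intro!: tendsto_eq_intros eventually_at_filter[THEN iffD2])
    ultimately show ?thesis by (rule filterlim_compose)
  qed
  have d0: "((\<lambda>y. u (norm y)) has_derivative (\<lambda>h. 0)) (at (0 :: real ^ 'n))"
  proof -
    have "((\<lambda>r. u r - u 0) has_real_derivative 0) (at 0 within {0..})"
      using u0 by (auto intro!: derivative_eq_intros)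
    from tendsto_rabs[OF o[OF this]] show ?thesis
      unfolding has_derivative_at by (simp add: abs_divide)
  qed
  have p0: "partial_deriv j (\<lambda>y. u (norm y)) (0 :: real ^ 'n) = 0" for j
    by (simp add: partial_deriv_def frechet_derivative_at[OF d0, symmetric])
  have pd: "partial_deriv j (\<lambda>y. u (norm y)) y = v (norm y) * (y $ j / norm y)"
    if "y \<in> ball (0 :: real ^ 'n) e" for j y
    using that p0 assms partial_deriv_radial[OF _ u[of "norm y"], of j] by (cases "y = 0") auto
  have "partial_deriv i (partial_deriv j (\<lambda>y. u (norm y))) (0 :: real ^ 'n)
    = (if i = j then a else 0)" for i j
  proof -
    have "((\<lambda>y :: real ^ 'n. v (norm y) * (y $ j / norm y)) has_derivative (\<lambda>h. a * h $ j)) (at 0)"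
      unfolding has_derivative_at
    proof
      show "bounded_linear (\<lambda>h :: real ^ 'n. a * h $ j)"
        by (intro bounded_linear_const_mult bounded_linear_vec_nth)
      have z: "((\<lambda>y :: real ^ 'n. \<bar>v (norm y) / norm y - a\<bar>) \<longlongrightarrow> 0) (at 0)"
        using o[OF v0 \<open>v 0 = 0\<close>] by (simp add: LIM_zero tendsto_rabs_zero)
      have "norm (norm (v (norm y) * (y $ j / norm y) - a * y $ j) / norm y)
        \<le> \<bar>v (norm y) / norm y - a\<bar>" for y :: "real ^ 'n"
      proof (cases "y = 0")
        case False
        have "v (norm y) * (y $ j / norm y) - a * y $ j = (v (norm y) / norm y - a) * y $ j"
          using False by (simp add: field_simps)
        then show ?thesis
          using component_le_norm_cart[of y j] False
          by (simp add: abs_mult divide_simps mult_left_mono)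
      qed simp
      then show "((\<lambda>h. norm (v (norm (0 + h)) * ((0 + h) $ j / norm (0 + h))
          - v (norm 0) * (0 $ j / norm (0 :: real ^ 'n)) - a * h $ j) / norm h) \<longlongrightarrow> 0) (at 0)"
        by (intro Lim_null_comparison[OF _ z] always_eventually) simp
    qed
    then have "((partial_deriv j (\<lambda>y. u (norm y))) has_derivative (\<lambda>h. a * h $ j)) (at (0 :: real ^ 'n))"
      by (rule has_derivative_transform_within_open[OF _ open_ball[of 0 e]])
        (use pd assms in auto)
    then have "frechet_derivative (partial_deriv j (\<lambda>y. u (norm y))) (at (0 :: real ^ 'n))
       = (\<lambda>h. a * h $ j)"
      by (rule frechet_derivative_at[symmetric])
    then show ?thesis by (simp add: partial_deriv_def[of i] axis_def)
  qed
  then show ?thesis by (simp add: hessian_def)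
qed

section \<open>The velocity determined by a reaction\<close>

text \<open>For a path \<open>u\<close> put \<open>f t = g (u t)\<close>. In terms of \<open>p r = r ^ (k - 1) * u' r\<close> the radial
  equation says that \<open>p + flux k f\<close> is nonincreasing, that \<open>p r \<le> - r ^ k * f r / k\<close>, and that
  \<open>p + flux k f\<close> is constant as long as this inequality is strict. The running infimum of
  \<open>obstacle k f\<close> is the only function \<open>p + flux k f\<close> of this kind with \<open>p 0 = 0\<close>. At \<open>r = 0\<close>
  the division in \<open>vel\<close> gives \<open>0\<close>, which is the required value.\<close>

definition flux :: "nat \<Rightarrow> (real \<Rightarrow> real) \<Rightarrow> real \<Rightarrow> real" where
  "flux k f r = integral {0..r} (\<lambda>t. t ^ (k - 1) * f t)"

definition obstacle :: "nat \<Rightarrow> (real \<Rightarrow> real) \<Rightarrow> real \<Rightarrow> real" where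
  "obstacle k f s = flux k f s - s ^ k * f s / k"

definition run_inf :: "nat \<Rightarrow> (real \<Rightarrow> real) \<Rightarrow> real \<Rightarrow> real" where
  "run_inf k f r = (INF s\<in>{0..r}. obstacle k f s)"

definition vel :: "nat \<Rightarrow> (real \<Rightarrow> real) \<Rightarrow> real \<Rightarrow> real" where
  "vel k f r = (run_inf k f r - flux k f r) / r ^ (k - 1)"

text \<open>Between \<open>x\<close> and a later \<open>y\<close> the infimum drops by at most the
  oscillation of the function over \<open>[x,y]\<close>, which uniform continuity makes
  small.\<close>

lemma continuous_on_running_Inf:
  fixes \<phi> :: "real \<Rightarrow> real"
  assumes "continuous_on {0..b} \<phi>"
  shows "continuous_on {0..b} (\<lambda>r. INF s\<in>{0..r}. \<phi> s)"
proof -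
  let ?M = "\<lambda>r. INF s\<in>{0..r}. \<phi> s"
  have bdd: "bdd_below (\<phi> ` {0..r})" if "r \<le> b" for r
  proof -
    have "compact (\<phi> ` {0..r})"
      by (intro compact_continuous_image continuous_on_subset[OF assms]) (use that in auto)
    then show ?thesis by (simp add: bounded_imp_bdd_below compact_imp_bounded)
  qed
  have "uniformly_continuous_on {0..b} \<phi>"
    using assms by (simp add: compact_uniformly_continuous)
  show ?thesis
    unfolding continuous_on_iff
  proof (intro ballI allI impI)
    fix r e :: real assume r: "r \<in> {0..b}" and "0 < e"
    then obtain d where d: "d > 0"
      "\<And>x y. x \<in> {0..b} \<Longrightarrow> y \<in> {0..b} \<Longrightarrow> dist y x < d \<Longrightarrow> dist (\<phi> y) (\<phi> x) < e / 2"
      using \<open>uniformly_continuous_on {0..b} \<phi>\<close>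
      unfolding uniformly_continuous_on_def by (meson half_gt_zero)
    have le: "?M y \<le> ?M x \<and> ?M x - e / 2 \<le> ?M y"
      if "x \<in> {0..b}" "y \<in> {0..b}" "x \<le> y" "y - x < d" for x y
    proof
      show "?M y \<le> ?M x"
        by (rule cINF_superset_mono) (use that bdd[of y] in auto)
      show "?M x - e / 2 \<le> ?M y"
      proof (rule cINF_greatest)
        fix s assume s: "s \<in> {0..y}"
        show "?M x - e / 2 \<le> \<phi> s"
        proof (cases "s \<le> x")
          case True
          then have "?M x \<le> \<phi> s" by (intro cINF_lower bdd) (use s that in auto)
          then show ?thesis using \<open>0 < e\<close> by simp
        next
          case False
          have "?M x \<le> \<phi> x" by (intro cINF_lower bdd) (use that in auto)
          moreover have "dist (\<phi> s) (\<phi> x) < e / 2"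
            by (rule d(2)) (use False s that in \<open>auto simp: dist_real_def\<close>)
          ultimately show ?thesis by (auto simp: dist_real_def abs_if split: if_splits)
        qed
      qed (use that in auto)
    qed
    show "\<exists>d>0. \<forall>y\<in>{0..b}. dist y r < d \<longrightarrow> dist (?M y) (?M r) < e"
    proof (intro exI[of _ d] conjI ballI impI)
      fix y assume y: "y \<in> {0..b}" "dist y r < d"
      show "dist (?M y) (?M r) < e"
      proof (cases "y \<le> r")
        case True
        then show ?thesis using le[of y r] y r \<open>0 < e\<close> by (auto simp: dist_real_def)
      next
        case False
        then show ?thesis using le[of r y] y r \<open>0 < e\<close> by (auto simp: dist_real_def)
      qed
    qed (use d in auto)
  qed
qed

text \<open>An equation with memory: the velocity at \<open>r\<close> depends on \<open>u\<close>
  over all of \<open>[0,r]\<close>. Solutions can be compared on initial segments, but not restarted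
  from their data at an interior radius.\<close>

definition evolves :: "nat \<Rightarrow> (real \<Rightarrow> real) \<Rightarrow> real set \<Rightarrow> (real \<Rightarrow> real) \<Rightarrow> bool" where
  "evolves k g S u \<longleftrightarrow>
    (\<forall>r\<in>S. (u has_real_derivative vel k (\<lambda>t. g (u t)) r) (at r within S))"

section \<open>Estimates for the velocity functional\<close>

context
  fixes k :: nat assumes k2: "2 \<le> k"
begin

lemma flux_integrable:
  fixes f :: "real \<Rightarrow> real"
  shows "continuous_on {0..b} f \<Longrightarrow> 0 \<le> s \<Longrightarrow> r \<le> b \<Longrightarrow> (\<lambda>t. t ^ (k - 1) * f t) integrable_on {s..r}"
  by (intro integrable_continuous_real continuous_on_mult continuous_on_power continuous_on_id)
    (auto elim: continuous_on_subset)



lemma flux_diff: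
  assumes "continuous_on {0..r} f" "0 \<le> s" "s \<le> r"
  shows "flux k f r - flux k f s = integral {s..r} (\<lambda>t. t ^ (k - 1) * f t)"
  using Henstock_Kurzweil_Integration.integral_combine[OF assms(2,3), of "\<lambda>t. t ^ (k - 1) * f t"]
    flux_integrable[OF assms(1), of 0 r] by (simp add: flux_def)

lemma flux_has_derivative:
  assumes "continuous_on {0..b} f" "r \<in> {0..b}"
  shows "(flux k f has_real_derivative r ^ (k - 1) * f r) (at r within {0..b})"
  unfolding flux_def[abs_def]
  by (rule integral_has_real_derivative) (intro assms continuous_intros)+

lemma continuous_on_flux:
  "continuous_on {0..b} f \<Longrightarrow> continuous_on {0..b} (flux k f)"
  by (meson DERIV_continuous_on flux_has_derivative)

lemma continuous_on_obstacle:
  "continuous_on {0..b} f \<Longrightarrow> continuous_on {0..b} (obstacle k f)"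
  unfolding obstacle_def[abs_def] using k2 by (intro continuous_intros continuous_on_flux) auto

lemma continuous_on_run_inf:
  "continuous_on {0..b} f \<Longrightarrow> continuous_on {0..b} (run_inf k f)"
  unfolding run_inf_def[abs_def] by (intro continuous_on_running_Inf continuous_on_obstacle)

lemma obstacle_bdd_below:
  assumes "continuous_on {0..r} f" shows "bdd_below (obstacle k f ` {0..r})"
  by (intro bounded_imp_bdd_below compact_imp_bounded compact_continuous_image
      continuous_on_obstacle assms) simp

lemma run_inf_le:
  "continuous_on {0..r} f \<Longrightarrow> 0 \<le> s \<Longrightarrow> s \<le> r \<Longrightarrow> run_inf k f r \<le> obstacle k f s"
  unfolding run_inf_def by (intro cINF_lower obstacle_bdd_below) auto

lemma run_inf_antimono:
  "continuous_on {0..r} f \<Longrightarrow> 0 \<le> s \<Longrightarrow> s \<le> r \<Longrightarrow> run_inf k f r \<le> run_inf k f s"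
  unfolding run_inf_def by (intro cINF_superset_mono obstacle_bdd_below) auto

lemma run_inf_attained:
  assumes "continuous_on {0..r} f" "0 \<le> r"
  obtains s where "0 \<le> s" "s \<le> r" "run_inf k f r = obstacle k f s"
proof -
  obtain s where s: "s \<in> {0..r}" "\<And>t. t \<in> {0..r} \<Longrightarrow> obstacle k f s \<le> obstacle k f t"
    using continuous_attains_inf[OF _ _ continuous_on_obstacle[OF assms(1)]] assms(2) by auto
  have "run_inf k f r = obstacle k f s"
    by (intro antisym run_inf_le assms) (use s assms in \<open>auto simp: run_inf_def intro!: cINF_greatest\<close>)
  then show ?thesis using that s by auto
qed

text \<open>The division in \<open>vel\<close> loses nothing at \<open>r = 0\<close>, where both
  sides vanish.\<close>

lemma vel_eq:
  assumes "0 \<le> r" shows "r ^ (k - 1) * vel k f r = run_inf k f r - flux k f r"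
proof (cases "r = 0")
  case True
  then show ?thesis using k2 by (simp add: vel_def run_inf_def obstacle_def)
qed (simp add: vel_def)

lemma vel_0 [simp]: "vel k f 0 = 0"
  using k2 by (simp add: vel_def)

text \<open>In \<open>obstacle k h s - flux k h r\<close> the error \<open>D\<close> enters with
  weight \<open>s ^ k / k + (r ^ k - s ^ k) / k = r ^ k / k\<close>, whatever \<open>s\<close> is.
  It therefore passes through the infimum, and division by \<open>r ^ (k - 1)\<close> leaves
  \<open>r * D / k\<close>, without any singularity at \<open>0\<close>.\<close>

lemma vel_mono:
  assumes f: "continuous_on {0..r} f" and h: "continuous_on {0..r} h" and "0 \<le> r"
    and le: "\<And>t. 0 \<le> t \<Longrightarrow> t \<le> r \<Longrightarrow> h t \<le> f t + D"
  shows "vel k f r \<le> vel k h r + r * D / k"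
proof (cases "r = 0")
  case False
  have k': "r ^ k = r ^ (k - 1) * r" using k2 by (cases k) auto
  have "run_inf k f r - flux k f r + flux k h r - r ^ k * D / k \<le> run_inf k h r"
    unfolding run_inf_def[of k h r]
  proof (rule cINF_greatest)
    fix s assume s: "s \<in> {0..r}"
    have hi: "((\<lambda>t. t ^ (k - 1)) has_integral (r ^ k - s ^ k) / k) {s..r}"
    proof -
      have "((\<lambda>t. t ^ (k - 1)) has_integral (r ^ k / k - s ^ k / k)) {s..r}"
        using s k2
        by (intro fundamental_theorem_of_calculus)
          (auto intro!: derivative_eq_intros simp flip: has_real_derivative_iff_has_vector_derivative)
      then show ?thesis by (simp add: diff_divide_distrib)
    qed
    have "integral {s..r} (\<lambda>t. t ^ (k - 1) * h t)
      \<le> integral {s..r} (\<lambda>t. t ^ (k - 1) * f t + t ^ (k - 1) * D)"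
    proof (rule integral_le)
      show "(\<lambda>t. t ^ (k - 1) * f t + t ^ (k - 1) * D) integrable_on {s..r}"
        using s hi by (intro integrable_add flux_integrable[OF f] integrable_on_mult_left) auto
      fix t assume t: "t \<in> {s..r}"
      have "t ^ (k - 1) * h t \<le> t ^ (k - 1) * (f t + D)"
        by (intro mult_left_mono le) (use s t in auto)
      then show "t ^ (k - 1) * h t \<le> t ^ (k - 1) * f t + t ^ (k - 1) * D"
        by (simp add: algebra_simps)
    qed (use s flux_integrable[OF h] in auto)
    also have "\<dots> = integral {s..r} (\<lambda>t. t ^ (k - 1) * f t) + (r ^ k - s ^ k) / k * D"
    proof (rule integral_unique[OF has_integral_add])
      show "((\<lambda>t. t ^ (k - 1) * f t) has_integral integral {s..r} (\<lambda>t. t ^ (k - 1) * f t)) {s..r}"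
        using s by (intro integrable_integral flux_integrable[OF f]) auto
    qed (rule has_integral_mult_left[OF hi])
    finally have "flux k h r - flux k h s \<le> flux k f r - flux k f s + (r ^ k - s ^ k) / k * D"
      using s by (simp add: flux_diff f h)
    moreover have "run_inf k f r \<le> flux k f s - s ^ k * f s / k"
      using run_inf_le[OF f, of s] s by (simp add: obstacle_def)
    moreover have "s ^ k * h s / k \<le> s ^ k * (f s + D) / k"
      by (intro divide_right_mono mult_left_mono le) (use s in auto)
    ultimately show "run_inf k f r - flux k f r + flux k h r - r ^ k * D / k \<le> obstacle k h s"
      unfolding obstacle_def by (simp add: algebra_simps add_divide_distrib diff_divide_distrib)
  qed (use assms in auto)
  then have "r ^ (k - 1) * vel k f r \<le> r ^ (k - 1) * (vel k h r + r * D / k)"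
    unfolding distrib_left vel_eq[OF \<open>0 \<le> r\<close>] by (simp add: k')
  then show ?thesis using False \<open>0 \<le> r\<close> by simp
qed simp

lemma vel_dist:
  assumes f: "continuous_on {0..r} f" and h: "continuous_on {0..r} h" and "0 \<le> r"
    and "\<And>t. 0 \<le> t \<Longrightarrow> t \<le> r \<Longrightarrow> \<bar>f t - h t\<bar> \<le> D"
  shows "\<bar>vel k f r - vel k h r\<bar> \<le> r * D / k"
proof -
  have "h t \<le> f t + D \<and> f t \<le> h t + D" if "0 \<le> t" "t \<le> r" for t
    using assms(4)[OF that] by auto
  then show ?thesis
    using vel_mono[OF f h \<open>0 \<le> r\<close>, of D] vel_mono[OF h f \<open>0 \<le> r\<close>, of D] by auto
qed

lemma vel_cong:
  assumes "continuous_on {0..r} f" "0 \<le> r" "\<And>t. 0 \<le> t \<Longrightarrow> t \<le> r \<Longrightarrow> f t = h t"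
  shows "vel k f r = vel k h r"
proof -
  have "continuous_on {0..r} h"
    using continuous_on_cong[of "{0..r}" "{0..r}" f h] assms by auto
  then show ?thesis using vel_dist[OF assms(1) _ assms(2), of h 0] assms(3) by simp
qed

text \<open>For a constant reaction the obstacle vanishes identically. Such reactions serve as
  reference in \<open>vel_dist\<close>: \<open>c = 0\<close> bounds the velocity, and the initial
  value of the reaction gives the derivative of the velocity at \<open>0\<close>.\<close>

lemma vel_const:
  assumes "0 \<le> r" shows "vel k (\<lambda>_. c) r = - r * c / k"
proof (cases "r = 0")
  case False
  have k': "x ^ k = x ^ (k - 1) * x" for x :: real using k2 by (cases k) auto
  have fl: "flux k (\<lambda>_. c) s = s ^ k * c / k" if "0 \<le> s" for s
  proof -
    have "((\<lambda>t. t ^ (k - 1) * c) has_integral (s ^ k * c / k - 0 ^ k * c / k)) {0..s}"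
      using that k2
      by (intro fundamental_theorem_of_calculus)
        (auto intro!: derivative_eq_intros simp flip: has_real_derivative_iff_has_vector_derivative)
    then have "integral {0..s} (\<lambda>t. t ^ (k - 1) * c) = s ^ k * c / k - 0 ^ k * c / k"
      by (rule integral_unique)
    then show ?thesis using k2 unfolding flux_def by (simp add: zero_power)
  qed
  have "run_inf k (\<lambda>_. c) r = (INF s\<in>{0..r}. 0)"
    unfolding run_inf_def by (intro INF_cong refl) (simp add: obstacle_def fl)
  also have "\<dots> = 0" using assms by simp
  finally show ?thesis using assms False by (simp add: vel_def fl k' field_simps)
qed simp

text \<open>The choice \<open>s = r\<close> in the infimum.\<close>

lemma vel_le:
  assumes "continuous_on {0..r} f" "0 \<le> r"
  shows "vel k f r \<le> - r * f r / k"
proof (cases "r = 0")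
  case False
  have k': "r ^ k = r ^ (k - 1) * r" using k2 by (cases k) auto
  have "r ^ (k - 1) * vel k f r \<le> r ^ (k - 1) * (- r * f r / k)"
    unfolding vel_eq[OF assms(2)]
    using run_inf_le[OF assms(1), of r] assms by (simp add: obstacle_def k' mult.assoc)
  moreover have "0 < r ^ (k - 1)" using False assms by simp
  ultimately show ?thesis using mult_le_cancel_left_pos by blast
qed simp

text \<open>The quotient is continuous away from \<open>0\<close>; at \<open>0\<close> comparison
  with the zero reaction gives \<open>\<bar>vel k f r\<bar> \<le> r * C / k\<close>.\<close>

lemma continuous_on_vel:
  assumes "continuous_on {0..b} f" shows "continuous_on {0..b} (vel k f)"
proof -
  obtain C where "\<forall>y\<in>f ` {0..b}. norm y \<le> C"
    using compact_imp_bounded[OF compact_continuous_image[OF assms compact_Icc]]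
    unfolding bounded_iff by blast
  then have C: "\<And>t. t \<in> {0..b} \<Longrightarrow> \<bar>f t\<bar> \<le> C" by auto
  have "\<bar>vel k f r\<bar> \<le> r * C / k" if "r \<in> {0..b}" for r
  proof -
    have "continuous_on {0..r} f" by (rule continuous_on_subset[OF assms]) (use that in auto)
    from vel_dist[OF this continuous_on_const[of _ 0], of C] that C show ?thesis
      by (simp add: vel_const)
  qed
  then have "\<forall>\<^sub>F r in at 0 within {0..b}. norm (vel k f r) \<le> r * C / k"
    by (simp add: eventually_at_filter)
  moreover have "((\<lambda>r. r * C / k) \<longlongrightarrow> 0 * C / k) (at 0 within {0..b})"
    using k2 by (intro tendsto_intros) auto
  ultimately have "(vel k f \<longlongrightarrow> 0) (at 0 within {0..b})"
    by (metis Lim_null_comparison mult_zero_left div_0)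
  moreover have "(vel k f \<longlongrightarrow> vel k f r) (at r within {0..b})" if "r \<in> {0..b}" "r \<noteq> 0" for r
  proof -
    have "(run_inf k f \<longlongrightarrow> run_inf k f r) (at r within {0..b})"
      "(flux k f \<longlongrightarrow> flux k f r) (at r within {0..b})"
      using continuous_on_run_inf[OF assms] continuous_on_flux[OF assms] that(1)
      unfolding continuous_on_def by blast+
    then show ?thesis unfolding vel_def[abs_def]
      by (intro tendsto_divide tendsto_diff tendsto_power tendsto_ident_at) (use that in auto)
  qed
  ultimately show ?thesis unfolding continuous_on_def by (metis vel_0)
qed

end

section \<open>Picard iteration\<close>

context
  fixes k :: nat assumes k2: "2 \<le> k"
begin

lemma evolves_continuous_on: "evolves k g S u \<Longrightarrow> continuous_on S u"
  unfolding evolves_def by (meson DERIV_continuous_on)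

lemma evolves_subset: "evolves k g S u \<Longrightarrow> T \<subseteq> S \<Longrightarrow> evolves k g T u"
  unfolding evolves_def by (meson DERIV_subset subsetD)

text \<open>Serves to exchange \<open>g\<close> for a truncation of it. As \<open>vel\<close> looks
  back to \<open>0\<close>, the set \<open>S\<close> has to contain the whole past of each of its
  points.\<close>

lemma evolves_cong:
  assumes "evolves k g S u" and g: "continuous_on UNIV g"
    and S: "\<And>r. r \<in> S \<Longrightarrow> 0 \<le> r \<and> {0..r} \<subseteq> S"
    and eq: "\<And>r. r \<in> S \<Longrightarrow> w r = u r \<and> h (u r) = g (u r)"
  shows "evolves k h S w"
  unfolding evolves_def
proof
  fix r assume r: "r \<in> S"
  have "continuous_on {0..r} u"
    using evolves_continuous_on[OF assms(1)] S[OF r] continuous_on_subset by blast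
  then have "continuous_on {0..r} (\<lambda>t. g (u t))"
    by (intro continuous_on_compose2[OF g]) auto
  then have veq: "vel k (\<lambda>t. g (u t)) r = vel k (\<lambda>t. h (w t)) r"
    by (intro vel_cong[OF k2]) (use S[OF r] eq in auto)
  have "(u has_real_derivative vel k (\<lambda>t. g (u t)) r) (at r within S)"
    using assms(1) r unfolding evolves_def by blast
  from this[unfolded veq] show "(w has_real_derivative vel k (\<lambda>t. h (w t)) r) (at r within S)"
    by (rule has_field_derivative_transform_within[OF _ zero_less_one r]) (use eq in auto)
qed

lemma evolves_integral:
  assumes "evolves k g {0..b} u" and g: "continuous_on UNIV g" and r: "r \<in> {0..b}"
  shows "u r = u 0 + integral {0..r} (vel k (\<lambda>t. g (u t)))"
proof -
  have "(vel k (\<lambda>t. g (u t)) has_integral (u r - u 0)) {0..r}"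
  proof (rule fundamental_theorem_of_calculus)
    fix t assume "t \<in> {0..r}"
    then show "(u has_vector_derivative vel k (\<lambda>t. g (u t)) t) (at t within {0..r})"
      using evolves_subset[OF assms(1), of "{0..r}"] r
      by (auto simp: evolves_def simp flip: has_real_derivative_iff_has_vector_derivative)
  qed (use r in auto)
  then show ?thesis by (simp add: integral_unique)
qed

text \<open>The weight \<open>exp (2 b L t / k)\<close> makes the Picard operator on \<open>[0,b]\<close> a contraction with
  factor \<open>1/2\<close>, however large \<open>b\<close> is.\<close>

lemma picard_estimate:
  assumes g: "continuous_on UNIV g"
    and lip: "\<And>x y. x \<in> X \<Longrightarrow> y \<in> X \<Longrightarrow> \<bar>g x - g y\<bar> \<le> L * \<bar>x - y\<bar>" and "0 < L" "0 < b"
    and u: "continuous_on {0..b} u" "u ` {0..b} \<subseteq> X"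
    and w: "continuous_on {0..b} w" "w ` {0..b} \<subseteq> X"
    and le: "\<And>t. t \<in> {0..b} \<Longrightarrow> \<bar>u t - w t\<bar> \<le> D * exp (2 * b * L / k * t)"
    and r: "r \<in> {0..b}"
  shows "\<bar>vel k (\<lambda>t. g (u t)) r - vel k (\<lambda>t. g (w t)) r\<bar> \<le> b * L / k * D * exp (2 * b * L / k * r)"
    and "\<bar>integral {0..r} (vel k (\<lambda>t. g (u t))) - integral {0..r} (vel k (\<lambda>t. g (w t)))\<bar>
      \<le> D / 2 * exp (2 * b * L / k * r)"
proof -
  let ?l = "2 * b * L / k"
  have l: "0 < ?l" using assms k2 by simp
  have "0 \<le> D" using le[of 0] \<open>0 < b\<close> by auto
  have cont: "continuous_on {0..s} (\<lambda>t. g (u t))" "continuous_on {0..s} (\<lambda>t. g (w t))" if "s \<le> b" for s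
    by (rule continuous_on_compose2[OF g]; use u w that in \<open>auto intro: continuous_on_subset\<close>)+
  have vel: "\<bar>vel k (\<lambda>t. g (u t)) s - vel k (\<lambda>t. g (w t)) s\<bar> \<le> b * L / k * D * exp (?l * s)"
    if s: "s \<in> {0..b}" for s
  proof -
    have "\<bar>g (u t) - g (w t)\<bar> \<le> L * (D * exp (?l * s))" if "0 \<le> t" "t \<le> s" for t
    proof -
      have "\<bar>g (u t) - g (w t)\<bar> \<le> L * \<bar>u t - w t\<bar>"
        using that s u w by (intro lip) auto
      also have "\<dots> \<le> L * (D * exp (?l * t))"
        using that s \<open>0 < L\<close> by (intro mult_left_mono le) auto
      also have "\<dots> \<le> L * (D * exp (?l * s))"
        using \<open>t \<le> s\<close> l \<open>0 < L\<close> \<open>0 \<le> D\<close>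
        by (intro mult_left_mono iffD2[OF exp_le_cancel_iff] less_imp_le[OF l]) auto
      finally show ?thesis .
    qed
    then have "\<bar>vel k (\<lambda>t. g (u t)) s - vel k (\<lambda>t. g (w t)) s\<bar> \<le> s * (L * (D * exp (?l * s))) / k"
      by (intro vel_dist[OF k2]) (use s cont in auto)
    also have "\<dots> \<le> b * (L * (D * exp (?l * s))) / k"
      using s \<open>0 < L\<close> \<open>0 \<le> D\<close> by (intro divide_right_mono mult_right_mono) auto
    finally show ?thesis by simp
  qed
  from vel[OF r] show "\<bar>vel k (\<lambda>t. g (u t)) r - vel k (\<lambda>t. g (w t)) r\<bar>
      \<le> b * L / k * D * exp (2 * b * L / k * r)" .
  have int: "vel k (\<lambda>t. g (u t)) integrable_on {0..r}" "vel k (\<lambda>t. g (w t)) integrable_on {0..r}"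
    using r by (auto intro!: integrable_continuous_real continuous_on_vel[OF k2] cont)
  have ex: "((\<lambda>s. b * L / k * D * exp (?l * s)) has_integral (D / 2 * exp (?l * r) - D / 2 * exp (?l * 0))) {0..r}"
    using r k2 by (intro fundamental_theorem_of_calculus)
      (auto intro!: derivative_eq_intros simp flip: has_real_derivative_iff_has_vector_derivative)
  have "norm (integral {0..r} (\<lambda>s. vel k (\<lambda>t. g (u t)) s - vel k (\<lambda>t. g (w t)) s))
    \<le> integral {0..r} (\<lambda>s. b * L / k * D * exp (?l * s))"
    by (rule integral_norm_bound_integral) (use int ex vel r in \<open>auto intro: integrable_diff\<close>)
  also have "\<dots> \<le> D / 2 * exp (?l * r)"
    unfolding integral_unique[OF ex] using \<open>0 \<le> D\<close> by simp
  finally show "\<bar>integral {0..r} (vel k (\<lambda>t. g (u t))) - integral {0..r} (vel k (\<lambda>t. g (w t)))\<bar>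
      \<le> D / 2 * exp (2 * b * L / k * r)"
    using int by (simp add: integral_diff)
qed

text \<open>Gronwall's inequality by contraction: inserting the weighted maximal distance
  \<open>D\<close> into the integral equations gives
  \<open>D \<le> \<bar>u 0 - w 0\<bar> + D / 2\<close>, whence the factor \<open>2\<close>. Equal
  starting values give uniqueness.\<close>

lemma evolves_dist:
  assumes g: "continuous_on UNIV g"
    and lip: "\<And>x y. x \<in> X \<Longrightarrow> y \<in> X \<Longrightarrow> \<bar>g x - g y\<bar> \<le> L * \<bar>x - y\<bar>" and "0 < L" "0 < b"
    and u: "evolves k g {0..b} u" "u ` {0..b} \<subseteq> X"
    and w: "evolves k g {0..b} w" "w ` {0..b} \<subseteq> X" 
    and r: "r \<in> {0..b}"
  shows "\<bar>u r - w r\<bar> \<le> 2 * \<bar>u 0 - w 0\<bar> * exp (2 * b * L / k * r)"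
    and "\<bar>vel k (\<lambda>t. g (u t)) r - vel k (\<lambda>t. g (w t)) r\<bar>
      \<le> b * L / k * (2 * \<bar>u 0 - w 0\<bar>) * exp (2 * b * L / k * r)"
proof -
  let ?l = "2 * b * L / k"
  note cont = evolves_continuous_on[OF u(1)] evolves_continuous_on[OF w(1)]
  have "continuous_on {0..b} (\<lambda>t. \<bar>u t - w t\<bar> * exp (- ?l * t))"
    by (intro continuous_intros cont)
  from continuous_attains_sup[OF _ _ this] \<open>0 < b\<close> obtain m where m: "m \<in> {0..b}"
    "\<And>t. t \<in> {0..b} \<Longrightarrow> \<bar>u t - w t\<bar> * exp (- ?l * t) \<le> \<bar>u m - w m\<bar> * exp (- ?l * m)"
    by auto
  define D where "D = \<bar>u m - w m\<bar> * exp (- ?l * m)"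
  have le: "\<bar>u t - w t\<bar> \<le> D * exp (?l * t)" if "t \<in> {0..b}" for t
    using m(2)[OF that] unfolding D_def[symmetric] by (simp add: exp_minus field_simps)
  note est = picard_estimate[OF g lip \<open>0 < L\<close> \<open>0 < b\<close> cont(1) u(2) cont(2) w(2)]
  have "\<bar>u m - w m\<bar> \<le> \<bar>u 0 - w 0\<bar> + D / 2 * exp (?l * m)"
  proof -
    have "u m - w m = (u 0 - w 0) + (integral {0..m} (vel k (\<lambda>t. g (u t)))
        - integral {0..m} (vel k (\<lambda>t. g (w t))))"
      using evolves_integral[OF u(1) g m(1)] evolves_integral[OF w(1) g m(1)] by linarith
    moreover have "\<bar>integral {0..m} (vel k (\<lambda>t. g (u t))) - integral {0..m} (vel k (\<lambda>t. g (w t)))\<bar>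
        \<le> D / 2 * exp (?l * m)"
      using est(2)[OF _ _ le m(1)] by blast
    ultimately show ?thesis using abs_triangle_ineq by linarith
  qed
  then have "D \<le> (\<bar>u 0 - w 0\<bar> + D / 2 * exp (?l * m)) * exp (- ?l * m)"
    unfolding D_def by (intro mult_right_mono) auto
  also have "\<dots> = \<bar>u 0 - w 0\<bar> * exp (- ?l * m) + D / 2"
    by (simp add: distrib_right exp_minus field_simps)
  also have "\<dots> \<le> \<bar>u 0 - w 0\<bar> * 1 + D / 2"
    using m(1) assms k2 by (intro add_right_mono mult_left_mono) auto
  finally have D: "D \<le> 2 * \<bar>u 0 - w 0\<bar>" by simp
  have le': "\<bar>u t - w t\<bar> \<le> 2 * \<bar>u 0 - w 0\<bar> * exp (?l * t)" if "t \<in> {0..b}" for t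
    by (rule order_trans[OF le[OF that] mult_right_mono[OF D]]) simp
  then show "\<bar>u r - w r\<bar> \<le> 2 * \<bar>u 0 - w 0\<bar> * exp (?l * r)" using r .
  show "\<bar>vel k (\<lambda>t. g (u t)) r - vel k (\<lambda>t. g (w t)) r\<bar>
      \<le> b * L / k * (2 * \<bar>u 0 - w 0\<bar>) * exp (?l * r)"
    using est(1)[OF _ _ le' r] by blast
qed

lemma evolves_exists:
  assumes g: "continuous_on UNIV g"
    and lip: "\<And>x y. \<bar>g x - g y\<bar> \<le> L * \<bar>x - y\<bar>" and "0 < L" "0 < b"
  obtains u where "u 0 = \<xi>" "evolves k g {0..b} u"
proof -
  let ?l = "2 * b * L / k"
  have l: "0 < ?l" using assms k2 by simp
  \<comment> \<open>The complete space at hand consists of bounded continuous functions on the whole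
    line, so arguments are clamped to \<open>[0,b]\<close>.\<close>
  define cl where "cl = (\<lambda>r::real. max 0 (min b r))"
  have cl: "cl r \<in> {0..b}" "r \<in> {0..b} \<Longrightarrow> cl r = r" for r
    using \<open>0 < b\<close> by (auto simp: cl_def)
  have contcl: "continuous_on UNIV cl" unfolding cl_def[abs_def] by (intro continuous_intros)
  \<comment> \<open>The fixed point is sought for the path divided by its exponential weight.
    \<open>W\<close> restores the path, so that the ordinary distance of \<open>x\<close> and
    \<open>y\<close> is the weighted distance of the paths.\<close>
  define W where "W = (\<lambda>(x :: real \<Rightarrow>\<^sub>C real) r. exp (?l * r) * x r)"
  define T where "T = (\<lambda>x r. \<xi> + integral {0..r} (vel k (\<lambda>t. g (W x t))))"
  have contW: "continuous_on S (W x)" for x S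
    unfolding W_def by (intro continuous_intros) auto
  have contv: "continuous_on {0..b} (vel k (\<lambda>t. g (W x t)))" for x
    by (intro continuous_on_vel[OF k2] continuous_on_compose2[OF g contW]) auto
  have contT: "continuous_on {0..b} (T x)" for x
    unfolding T_def
    by (intro continuous_intros indefinite_integral_continuous_1 integrable_continuous_real contv)
  define P where "P = (\<lambda>x. Bcontfun (\<lambda>r. exp (- ?l * cl r) * T x (cl r)))"
  have P: "apply_bcontfun (P x) = (\<lambda>r. exp (- ?l * cl r) * T x (cl r))" for x
  proof -
    have c: "continuous_on {0..b} (\<lambda>r. exp (- ?l * r) * T x r)"
      by (intro continuous_intros contT)
    have "(\<lambda>r. exp (- ?l * cl r) * T x (cl r)) \<in> bcontfun"
      unfolding bcontfun_def
    proof safe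
      show "continuous_on UNIV (\<lambda>r. exp (- ?l * cl r) * T x (cl r))"
        using continuous_on_compose2[OF c contcl] cl(1) by (simp add: image_subset_iff)
      have "bounded ((\<lambda>r. exp (- ?l * r) * T x r) ` {0..b})"
        by (intro compact_imp_bounded compact_continuous_image c) auto
      then show "bounded (range (\<lambda>r. exp (- ?l * cl r) * T x (cl r)))"
        by (rule bounded_subset) (use cl in auto)
    qed
    then show ?thesis unfolding P_def by (simp add: Bcontfun_inverse)
  qed
  have "dist (P x) (P y) \<le> 1 / 2 * dist x y" for x y
  proof (rule dist_bound)
    fix r
    have W: "\<bar>W x t - W y t\<bar> \<le> dist x y * exp (?l * t)" for t
    proof -
      have "\<bar>W x t - W y t\<bar> = exp (?l * t) * dist (x t) (y t)"
        by (simp add: W_def dist_real_def abs_mult flip: right_diff_distrib)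
      also have "\<dots> \<le> exp (?l * t) * dist x y"
        by (intro mult_left_mono dist_bounded) auto
      finally show ?thesis by (simp add: mult.commute)
    qed
    have "\<bar>T x (cl r) - T y (cl r)\<bar> \<le> dist x y / 2 * exp (?l * cl r)"
      using picard_estimate(2)[where X = UNIV, OF g lip \<open>0 < L\<close> \<open>0 < b\<close> contW _ contW _ W cl(1)]
      by (simp add: T_def)
    then have "exp (- ?l * cl r) * \<bar>T x (cl r) - T y (cl r)\<bar>
        \<le> exp (- ?l * cl r) * (dist x y / 2 * exp (?l * cl r))"
      by (intro mult_left_mono) auto
    also have "\<dots> = 1 / 2 * dist x y" by (simp add: exp_minus)
    finally show "dist (P x r) (P y r) \<le> 1 / 2 * dist x y"
      by (simp add: P dist_real_def abs_mult flip: right_diff_distrib)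
  qed
  then obtain x where x: "P x = x"
    using banach_fix_type[of "1/2" P] by auto
  have fixed: "W x r = T x r" if "r \<in> {0..b}" for r
  proof -
    have "x r = exp (- ?l * r) * T x r"
      using fun_cong[OF P[of x], of r] cl(2)[OF that] x by simp
    then show ?thesis by (simp add: W_def exp_minus)
  qed
  have "evolves k g {0..b} (W x)"
    unfolding evolves_def
  proof
    fix r assume r: "r \<in> {0..b}"
    have "(T x has_real_derivative vel k (\<lambda>t. g (W x t)) r) (at r within {0..b})"
      unfolding T_def
      by (rule derivative_eq_intros integral_has_real_derivative[OF contv r] refl | simp)+
    then show "(W x has_real_derivative vel k (\<lambda>t. g (W x t)) r) (at r within {0..b})"
      by (rule has_field_derivative_transform_within[OF _ zero_less_one r]) (use fixed in auto)
  qed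
  moreover have "W x 0 = \<xi>" using fixed[of 0] \<open>0 < b\<close> by (simp add: T_def)
  ultimately show ?thesis using that by blast
qed

end

section \<open>Maximal solutions and continuous dependence\<close>

text \<open>Unboundedness of \<open>u\<close> alone suffices as maximality: while \<open>u\<close>
  is bounded on a finite interval the solution can be continued. The stronger divergence demanded of
  radial solutions is recovered later from monotonicity.\<close>

definition max_solution :: "nat \<Rightarrow> (real \<Rightarrow> real) \<Rightarrow> ereal \<Rightarrow> (real \<Rightarrow> real) \<Rightarrow> bool" where
  "max_solution k g R u \<longleftrightarrow>
    0 < R \<and> evolves k g (radii R) u \<and> (R \<noteq> \<infinity> \<longrightarrow> \<not> bounded (u ` radii R))"

lemma radii_down: "r \<in> radii R \<Longrightarrow> 0 \<le> r \<and> {0..r} \<subseteq> radii R"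
  by (auto simp: radii_def intro: le_less_trans[of "ereal _" "ereal r"])

lemma radii_mono: "R \<le> R' \<Longrightarrow> radii R \<subseteq> radii R'"
  by (auto simp: radii_def)

locale reaction =
  fixes k :: nat and g :: "real \<Rightarrow> real"
  assumes k2: "2 \<le> k" and g: "continuous_on UNIV g"
    and loc_lip: "\<And>M. \<exists>L>0. \<forall>x\<in>{-M..M}. \<forall>y\<in>{-M..M}. \<bar>g x - g y\<bar> \<le> L * \<bar>x - y\<bar>"
begin

lemma max_solutionD:
  assumes "max_solution k g R u"
  shows "0 < R" "evolves k g (radii R) u" "R \<noteq> \<infinity> \<Longrightarrow> \<not> bounded (u ` radii R)"
  using assms by (auto simp: max_solution_def)

text \<open>Picard iteration needs a global Lipschitz constant. Solutions of the truncated problem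
  solve the original one as long as they stay in \<open>[-M,M]\<close>.\<close>

definition cutoff :: "real \<Rightarrow> real \<Rightarrow> real" where
  "cutoff M x = g (max (- M) (min M x))"

lemma cutoff_eq: "\<bar>x\<bar> \<le> M \<Longrightarrow> cutoff M x = g x"
  by (simp add: cutoff_def)

lemma cutoff_continuous: "continuous_on UNIV (cutoff M)"
  unfolding cutoff_def[abs_def] by (intro continuous_on_compose2[OF g] continuous_intros) auto

lemma cutoff_lip: "0 < M \<Longrightarrow> \<exists>L>0. \<forall>x y. \<bar>cutoff M x - cutoff M y\<bar> \<le> L * \<bar>x - y\<bar>"
proof -
  assume "0 < M"
  obtain L where L: "L > 0" "\<And>x y. x \<in> {-M..M} \<Longrightarrow> y \<in> {-M..M} \<Longrightarrow> \<bar>g x - g y\<bar> \<le> L * \<bar>x - y\<bar>"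
    using loc_lip[of M] by blast
  have "\<bar>cutoff M x - cutoff M y\<bar> \<le> L * \<bar>x - y\<bar>" for x y
  proof -
    have "\<bar>cutoff M x - cutoff M y\<bar> \<le> L * \<bar>max (- M) (min M x) - max (- M) (min M y)\<bar>"
      unfolding cutoff_def by (rule L(2)) (use \<open>0 < M\<close> in auto)
    also have "\<dots> \<le> L * \<bar>x - y\<bar>"
      using L(1) by (intro mult_left_mono) auto
    finally show ?thesis .
  qed
  then show ?thesis using L(1) by blast
qed

lemma cutoff_evolves:
  assumes "0 < M" "0 < b"
  obtains u where "u 0 = \<xi>" "evolves k (cutoff M) {0..b} u"
proof -
  obtain L where L: "0 < L" "\<And>x y. \<bar>cutoff M x - cutoff M y\<bar> \<le> L * \<bar>x - y\<bar>"
    using cutoff_lip[OF \<open>0 < M\<close>] by blast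
  from evolves_exists[OF k2 cutoff_continuous[of M] L(2,1) \<open>0 < b\<close>, of \<xi>] show ?thesis
    using that by blast
qed

lemma evolves_cutoff_iff:
  assumes "\<And>r. r \<in> {0..b} \<Longrightarrow> \<bar>u r\<bar> \<le> M"
  shows "evolves k (cutoff M) {0..b} u \<longleftrightarrow> evolves k g {0..b} u"
proof
  show "evolves k g {0..b} u" if "evolves k (cutoff M) {0..b} u"
    by (rule evolves_cong[OF k2 that cutoff_continuous]) (use assms in \<open>auto simp: cutoff_eq\<close>)
  show "evolves k (cutoff M) {0..b} u" if "evolves k g {0..b} u"
    by (rule evolves_cong[OF k2 that g]) (use assms in \<open>auto simp: cutoff_eq\<close>)
qed

lemma evolves_bound:
  assumes "evolves k h {0..b} u" 
  obtains M where "0 < M" "\<And>r. r \<in> {0..b} \<Longrightarrow> \<bar>u r\<bar> \<le> M"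
proof -
  have "bounded (u ` {0..b})"
    by (intro compact_imp_bounded compact_continuous_image evolves_continuous_on[OF k2 assms]) auto
  then obtain M where "\<forall>x\<in>u ` {0..b}. norm x \<le> M" unfolding bounded_iff by blast
  then have "\<And>r. r \<in> {0..b} \<Longrightarrow> \<bar>u r\<bar> \<le> max 1 M" by (simp add: le_max_iff_disj)
  then show ?thesis using that[of "max 1 M"] by auto
qed

lemma evolves_unique:
  assumes u: "evolves k g {0..b} u" and w: "evolves k g {0..b} w" and "u 0 = w 0"
    and r: "r \<in> {0..b}"
  shows "u r = w r"
proof (cases "b = 0")
  case False
  obtain M1 where M1: "0 < M1" "\<And>r. r \<in> {0..b} \<Longrightarrow> \<bar>u r\<bar> \<le> M1" using evolves_bound[OF u] by blast
  obtain M2 where M2: "0 < M2" "\<And>r. r \<in> {0..b} \<Longrightarrow> \<bar>w r\<bar> \<le> M2" using evolves_bound[OF w] by blast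
  define M where "M = max M1 M2"
  obtain L where L: "L > 0" "\<And>x y. x \<in> {-M..M} \<Longrightarrow> y \<in> {-M..M} \<Longrightarrow> \<bar>g x - g y\<bar> \<le> L * \<bar>x - y\<bar>"
    using loc_lip[of M] by blast
  have "\<bar>u r - w r\<bar> \<le> 2 * \<bar>u 0 - w 0\<bar> * exp (2 * b * L / k * r)"
  proof (rule evolves_dist(1)[OF k2 g _ L(1) _ u _ w _ r, where X = "{-M..M}"])
    show "u ` {0..b} \<subseteq> {-M..M}" "w ` {0..b} \<subseteq> {-M..M}"
      using M1 M2 unfolding M_def by fastforce+
  qed (use L r False in auto)
  then show ?thesis using assms by simp
qed (use assms in auto)

text \<open>Were \<open>R' < R\<close>, then \<open>w\<close> would agree on \<open>[0,R')\<close>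
  with \<open>u\<close>, which is bounded on the compact interval \<open>[0,R']\<close>, against the
  maximality of \<open>w\<close>.\<close>

lemma max_solution_prefix:
  assumes u: "evolves k g (radii R) u" and w: "max_solution k g R' w" and "u 0 = w 0"
  shows "R \<le> R'" "\<And>r. r \<in> radii R \<Longrightarrow> u r = w r"
proof -
  have eq: "u r = w r" if "r \<in> radii R" "r \<in> radii R'" for r
    using evolves_unique[of r u w r] evolves_subset[OF k2 u] evolves_subset[OF k2 max_solutionD(2)[OF w]]
      radii_down[OF that(1)] radii_down[OF that(2)] assms(3) by auto
  show le: "R \<le> R'"
  proof (rule ccontr)
    assume "\<not> R \<le> R'"
    then have lt: "R' < R" by simp
    obtain b where b: "R' = ereal b" "0 < b"
      using lt max_solutionD(1)[OF w] by (cases R') auto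
    have "{0..b} \<subseteq> radii R" using lt b by (auto simp: radii_def intro: le_less_trans[of _ "ereal b"])
    from evolves_bound[OF evolves_subset[OF k2 u this]] obtain M where
      "\<And>r. r \<in> {0..b} \<Longrightarrow> \<bar>u r\<bar> \<le> M" by blast
    then have "\<bar>w r\<bar> \<le> M" if "r \<in> radii R'" for r
      using that eq[OF _ that] \<open>{0..b} \<subseteq> radii R\<close> b by (fastforce simp: radii_def subset_iff)
    then have "bounded (w ` radii R')" by (auto simp: bounded_iff)
    then show False using max_solutionD(3)[OF w] b by auto
  qed
  show "\<And>r. r \<in> radii R \<Longrightarrow> u r = w r" using eq radii_mono[OF le] by blast
qed

lemma max_solution_unique:
  assumes u: "max_solution k g R u" and w: "max_solution k g R' w" and "u 0 = w 0"
  shows "R = R'" "\<And>r. r \<in> radii R \<Longrightarrow> u r = w r"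
  using max_solution_prefix[OF max_solutionD(2)[OF u] w assms(3)]
    max_solution_prefix[OF max_solutionD(2)[OF w] u assms(3)[symmetric]] by auto

lemma evolves_radiiI:
  assumes "\<And>b. b \<in> radii R \<Longrightarrow> evolves k g {0..b} u"
  shows "evolves k g (radii R) u"
  unfolding evolves_def
proof
  fix r assume "r \<in> radii R"
  then obtain b where b: "r < b" "b \<in> radii R" "0 \<le> r"
    unfolding radii_def using ereal_dense2[of "ereal r" R] by (fastforce simp: less_eq_real_def)
  have "(u has_real_derivative vel k (\<lambda>t. g (u t)) r) (at r within {0..b})"
    using assms[OF b(2)] b unfolding evolves_def by auto
  moreover have "at r within {0..b} = at r within radii R"
    by (rule at_within_nhd[of r "{..<b}"]) (use b radii_down[OF b(2)] in \<open>auto simp: radii_def\<close>)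
  ultimately show "(u has_real_derivative vel k (\<lambda>t. g (u t)) r) (at r within radii R)" by simp
qed

text \<open>Because of the memory \<open>u\<close> is not continued from \<open>b\<close>. The
  truncated problem is solved afresh from \<open>0\<close> on \<open>[0,b + 1]\<close>; its solution
  agrees with \<open>u\<close> before \<open>b\<close>, so it satisfies
  \<open>\<bar>w b\<bar> \<le> M\<close> and stays within the truncation level \<open>M + 1\<close>
  a little beyond \<open>b\<close>.\<close>

lemma evolves_extend:
  assumes u: "\<And>c. 0 \<le> c \<Longrightarrow> c < b \<Longrightarrow> evolves k g {0..c} u"
    and "0 < b" and M: "\<And>r. 0 \<le> r \<Longrightarrow> r < b \<Longrightarrow> \<bar>u r\<bar> \<le> M"
  obtains c w where "b < c" "evolves k g {0..c} w" "w 0 = u 0"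
proof -
  have "0 \<le> M" using M[of 0] \<open>0 < b\<close> by auto
  obtain w where w: "w 0 = u 0" "evolves k (cutoff (M + 1)) {0..b + 1} w"
    using cutoff_evolves[of "M + 1" "b + 1" "u 0"] \<open>0 \<le> M\<close> \<open>0 < b\<close> by auto
  have cw: "continuous_on {0..b + 1} w" by (rule evolves_continuous_on[OF k2 w(2)])
  have sub: "evolves k (cutoff (M + 1)) {0..c} w" if "c \<le> b + 1" for c
    using evolves_subset[OF k2 w(2)] that by auto
  obtain L where L: "0 < L" "\<And>x y. \<bar>cutoff (M+1) x - cutoff (M+1) y\<bar> \<le> L * \<bar>x - y\<bar>"
    using cutoff_lip[of "M + 1"] \<open>0 \<le> M\<close> by auto
  have eq: "w c = u c" if c: "0 \<le> c" "c < b" for c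
  proof (cases "c = 0")
    case False
    have "evolves k (cutoff (M + 1)) {0..c} u"
      using u[OF c] M c by (subst evolves_cutoff_iff) fastforce+
    from evolves_dist(1)[where X = UNIV, OF k2 cutoff_continuous L(2,1) _ sub _ this, of c]
    show ?thesis using c w(1) False by auto
  qed (use w in auto)
  have "\<bar>w b\<bar> \<le> M"
  proof (rule tendsto_upperbound)
    have "(w \<longlongrightarrow> w b) (at b within {0..b + 1})"
      using cw \<open>0 < b\<close> unfolding continuous_on_def by auto
    moreover have "at b within {0..b + 1} = at b"
      by (rule at_within_interior) (use \<open>0 < b\<close> in auto)
    ultimately show "((\<lambda>r. \<bar>w r\<bar>) \<longlongrightarrow> \<bar>w b\<bar>) (at_left b)"
      by (intro tendsto_rabs) (simp add: filterlim_at_split)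
    show "\<forall>\<^sub>F r in at_left b. \<bar>w r\<bar> \<le> M"
      using eventually_at_left_real[OF \<open>0 < b\<close>]
      by eventually_elim (use eq M in auto)
  qed auto
  then obtain d where d: "0 < d" "\<And>r. r \<in> {0..b + 1} \<Longrightarrow> dist r b < d \<Longrightarrow> dist (w r) (w b) < 1"
    using cw \<open>0 < b\<close> unfolding continuous_on_iff
    by (metis add_increasing2 atLeastAtMost_iff less_eq_real_def zero_le_one zero_less_one le_add_same_cancel1)
  define c where "c = b + min 1 (d / 2)"
  have c: "b < c" "c \<le> b + 1" "c < b + d" using d by (auto simp: c_def)
  have "\<bar>w r\<bar> \<le> M + 1" if "r \<in> {0..c}" for r
  proof (cases "r < b")
    case True
    then show ?thesis using eq[of r] M[of r] that by auto
  next
    case False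
    then have "dist (w r) (w b) < 1" using that c by (intro d(2)) (auto simp: dist_real_def)
    then show ?thesis using \<open>\<bar>w b\<bar> \<le> M\<close> by (auto simp: dist_real_def)
  qed
  then have "evolves k g {0..c} w"
    using sub[OF c(2)] evolves_cutoff_iff[of c w "M + 1"] by blast
  then show ?thesis using that c w by blast
qed

text \<open>Local solutions agree where both exist and are glued together; \<open>R\<close> is the
  supremum of their lengths. A bounded solution on a finite \<open>[0,R)\<close> would extend beyond
  that supremum.\<close>

lemma max_solution_exists: "\<exists>R u. max_solution k g R u \<and> u 0 = \<xi>"
proof -
  define B where "B = {b. 0 < b \<and> (\<exists>u. u 0 = \<xi> \<and> evolves k g {0..b} u)}"
  define R where "R = (SUP b\<in>B. ereal b)"
  have "\<exists>b. b \<in> B"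
  proof -
    obtain w where w: "w 0 = \<xi>" "evolves k (cutoff (\<bar>\<xi>\<bar> + 1)) {0..1} w"
      by (rule cutoff_evolves[of "\<bar>\<xi>\<bar> + 1" 1 \<xi>]) auto
    obtain d where d: "0 < d" "\<And>r. r \<in> {0..1} \<Longrightarrow> dist r 0 < d \<Longrightarrow> dist (w r) (w 0) < 1"
      using evolves_continuous_on[OF k2 w(2)] unfolding continuous_on_iff
      by (metis atLeastAtMost_iff order_refl zero_le_one zero_less_one)
    define c where "c = min 1 (d / 2)"
    have c: "0 < c" "c \<le> 1" "c < d" using d by (auto simp: c_def)
    have "\<bar>w r\<bar> \<le> \<bar>\<xi>\<bar> + 1" if "r \<in> {0..c}" for r
    proof -
      have "dist (w r) (w 0) < 1" using that c by (intro d(2)) (auto simp: dist_real_def)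
      then show ?thesis using w(1) by (auto simp: dist_real_def)
    qed
    moreover have "evolves k (cutoff (\<bar>\<xi>\<bar> + 1)) {0..c} w"
      by (rule evolves_subset[OF k2 w(2)]) (use c in auto)
    ultimately have "evolves k g {0..c} w"
      using evolves_cutoff_iff[of c w "\<bar>\<xi>\<bar> + 1"] by blast
    then show ?thesis using c w by (auto simp: B_def)
  qed
  then obtain b0 where b0: "b0 \<in> B" "0 < b0" by (auto simp: B_def)
  then have "0 < R" unfolding R_def by (auto simp: less_SUP_iff)
  have ex: "\<exists>b\<in>B. r < b" if "r \<in> radii R" for r
    using that by (auto simp: radii_def R_def less_SUP_iff)
  define s where "s = (\<lambda>b. SOME u. u 0 = \<xi> \<and> evolves k g {0..b} u)"
  have s: "s b 0 = \<xi>" "evolves k g {0..b} (s b)" if "b \<in> B" for b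
    using someI_ex[of "\<lambda>u. u 0 = \<xi> \<and> evolves k g {0..b} u"] that by (auto simp: B_def s_def)
  \<comment> \<open>Here \<open>\<beta> r\<close> is a length beyond \<open>r\<close> of some local
    solution; it has nothing to do with the parameter of the nonlinearity.\<close>
  define \<beta> where "\<beta> = (\<lambda>r. SOME b. b \<in> B \<and> r < b)"
  have \<beta>: "\<beta> r \<in> B" "r < \<beta> r" if "r \<in> radii R" for r
    using someI_ex[of "\<lambda>b. b \<in> B \<and> r < b"] ex[OF that] by (auto simp: \<beta>_def)
  define u where "u = (\<lambda>r. s (\<beta> r) r)"
  have us: "u r = s b r" if "b \<in> B" "r \<in> {0..b}" "r \<in> radii R" for b r
    unfolding u_def
  proof (rule evolves_unique[of r "s (\<beta> r)" "s b" r])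
    show "evolves k g {0..r} (s (\<beta> r))" "evolves k g {0..r} (s b)"
      using evolves_subset[OF k2 s(2)[OF \<beta>(1)[OF that(3)]]] evolves_subset[OF k2 s(2)[OF that(1)]]
        \<beta>(2)[OF that(3)] that by auto
  qed (use that \<beta> s in auto)
  have ev: "evolves k g {0..c} u" if "c \<in> radii R" for c
  proof -
    obtain b where b: "b \<in> B" "c < b" using ex[OF \<open>c \<in> radii R\<close>] by blast
    then have sb: "evolves k g {0..c} (s b)"
      using evolves_subset[OF k2 s(2)[OF b(1)]] by auto
    have ub: "u r = s b r" if "r \<in> {0..c}" for r
    proof (rule us[OF b(1)])
      show "r \<in> radii R" using that radii_down[OF \<open>c \<in> radii R\<close>] by blast
    qed (use that b in simp)
    show ?thesis by (rule evolves_cong[OF k2 sb g]) (simp_all add: ub)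
  qed
  have "0 \<in> radii R" using \<open>0 < R\<close> by (simp add: radii_def zero_ereal_def)
  then have u0: "u 0 = \<xi>" using us[OF b0(1)] s(1)[OF b0(1)] b0 by auto
  have "\<not> bounded (u ` radii R)" if R: "R \<noteq> \<infinity>"
  proof (rule notI)
    assume "bounded (u ` radii R)"
    then obtain M where M: "\<And>r. r \<in> radii R \<Longrightarrow> \<bar>u r\<bar> \<le> M" by (auto simp: bounded_iff)
    obtain b where b: "R = ereal b" "0 < b" using R \<open>0 < R\<close> by (cases R) auto
    have "evolves k g {0..c} u" if "0 \<le> c" "c < b" for c
      using ev[of c] that b by (simp add: radii_def)
    moreover have "\<bar>u r\<bar> \<le> M" if "0 \<le> r" "r < b" for r
      using M[of r] that b by (simp add: radii_def)
    ultimately obtain c w where c: "b < c" "evolves k g {0..c} w" "w 0 = u 0"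
      using evolves_extend[of b u M] b(2) by blast
    then have "c \<in> B" using u0 b by (auto simp: B_def)
    then have "ereal c \<le> R" unfolding R_def by (intro SUP_upper)
    then show False using b c by simp
  qed
  then have "max_solution k g R u"
    using \<open>0 < R\<close> evolves_radiiI[OF ev] by (simp add: max_solution_def)
  then show ?thesis using u0 by blast
qed

text \<open>The truncated problem with level \<open>M + 1\<close> has a solution \<open>z\<close>
  from \<open>w 0\<close> on all of \<open>[0,T]\<close>. Staying within \<open>1\<close> of
  \<open>u\<close>, it never feels the truncation, so \<open>w\<close> follows it; and
  \<open>w\<close> cannot end before \<open>T\<close>, since it would be bounded.\<close>

lemma max_solution_dependence:
  assumes u: "max_solution k g R u" and T: "0 < T" "ereal T < R" and "0 < \<epsilon>"
  shows "\<exists>\<delta>>0. \<forall>R' w. max_solution k g R' w \<and> \<bar>w 0 - u 0\<bar> < \<delta> \<longrightarrow> ereal T < R' \<and>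
    (\<forall>r\<in>{0..T}. \<bar>w r - u r\<bar> < \<epsilon> \<and> \<bar>vel k (\<lambda>t. g (w t)) r - vel k (\<lambda>t. g (u t)) r\<bar> < \<epsilon>)"
proof -
  have "{0..T} \<subseteq> radii R" using radii_down[of T R] T by (simp add: radii_def)
  then have uT: "evolves k g {0..T} u" using evolves_subset[OF k2 max_solutionD(2)[OF u]] by blast
  obtain M where M: "0 < M" "\<And>r. r \<in> {0..T} \<Longrightarrow> \<bar>u r\<bar> \<le> M" using evolves_bound[OF uT] by blast
  obtain L where L: "0 < L" "\<And>x y. \<bar>cutoff (M+1) x - cutoff (M+1) y\<bar> \<le> L * \<bar>x - y\<bar>"
    using cutoff_lip[of "M + 1"] M by auto
  \<comment> \<open>\<open>C\<close> bounds the factor in the estimate of the paths, and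
    \<open>K\<close> also covers the additional factor \<open>T * L / k\<close> in the estimate of
    the velocities.\<close>
  define C where "C = 2 * exp (2 * T * L / k * T)"
  have C: "0 < C" by (simp add: C_def)
  define K where "K = max 1 (T * L / k)"
  have K: "1 \<le> K" "T * L / k \<le> K" by (auto simp: K_def)
  define \<delta> where "\<delta> = min 1 \<epsilon> / (C * K)"
  have \<delta>: "0 < \<delta>" using \<open>0 < \<epsilon>\<close> C K by (simp add: \<delta>_def)
  have uc: "evolves k (cutoff (M + 1)) {0..T} u"
    using uT M by (subst evolves_cutoff_iff) fastforce+
  have "ereal T < R' \<and> (\<forall>r\<in>{0..T}. \<bar>w r - u r\<bar> < \<epsilon>
      \<and> \<bar>vel k (\<lambda>t. g (w t)) r - vel k (\<lambda>t. g (u t)) r\<bar> < \<epsilon>)"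
    if w: "max_solution k g R' w" "\<bar>w 0 - u 0\<bar> < \<delta>" for R' w
  proof -
    obtain z where z: "z 0 = w 0" "evolves k (cutoff (M + 1)) {0..T} z"
      using cutoff_evolves[of "M + 1" T "w 0"] M T by auto
    have small: "C * K * \<bar>z 0 - u 0\<bar> < min 1 \<epsilon>"
      using w(2) z(1) C K unfolding \<delta>_def by (simp add: pos_less_divide_eq mult.commute)
    have est: "\<bar>z r - u r\<bar> < min 1 \<epsilon> \<and>
        \<bar>vel k (\<lambda>t. cutoff (M+1) (z t)) r - vel k (\<lambda>t. cutoff (M+1) (u t)) r\<bar> < min 1 \<epsilon>"
      if r: "r \<in> {0..T}" for r
    proof -
      let ?e = "2 * exp (2 * T * L / k * r)"
      have e: "?e \<le> C" "0 \<le> ?e"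
        using r T L k2 by (auto simp: C_def intro!: divide_right_mono mult_left_mono)
      have "\<bar>z r - u r\<bar> \<le> 2 * \<bar>z 0 - u 0\<bar> * exp (2 * T * L / k * r)"
        using evolves_dist(1)[where X = UNIV, OF k2 cutoff_continuous L(2,1) T(1) z(2) _ uc _ r] by simp
      also have "\<dots> = (?e * 1) * \<bar>z 0 - u 0\<bar>" by simp
      also have "\<dots> \<le> C * K * \<bar>z 0 - u 0\<bar>"
        using e K C by (intro mult_right_mono mult_mono) auto
      finally have 1: "\<bar>z r - u r\<bar> < min 1 \<epsilon>" using small by linarith
      have "\<bar>vel k (\<lambda>t. cutoff (M+1) (z t)) r - vel k (\<lambda>t. cutoff (M+1) (u t)) r\<bar>
          \<le> T * L / k * (2 * \<bar>z 0 - u 0\<bar>) * exp (2 * T * L / k * r)"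
        using evolves_dist(2)[where X = UNIV, OF k2 cutoff_continuous L(2,1) T(1) z(2) _ uc _ r] by simp
      also have "\<dots> = (?e * (T * L / k)) * \<bar>z 0 - u 0\<bar>" by simp
      also have "\<dots> \<le> C * K * \<bar>z 0 - u 0\<bar>"
        using e K T L C by (intro mult_right_mono mult_mono) auto
      finally show ?thesis using small 1 by linarith
    qed
    have zM: "\<bar>z r\<bar> \<le> M + 1" if "r \<in> {0..T}" for r
      using est[OF that] M(2)[OF that] by auto
    then have zg: "evolves k g {0..T} z" using z(2) evolves_cutoff_iff[of T z "M + 1"] by blast
    have wz: "w r = z r" if "r \<in> radii R'" "r \<in> {0..T}" for r
      using evolves_unique[of r w z r] evolves_subset[OF k2 max_solutionD(2)[OF w(1)]]
        radii_down[OF that(1)] evolves_subset[OF k2 zg] z(1) that by auto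
    have "ereal T < R'"
    proof (rule ccontr)
      assume "\<not> ereal T < R'"
      then have le: "R' \<le> ereal T" by simp
      then have "w r = z r \<and> r \<in> {0..T}" if "r \<in> radii R'" for r
        using wz[OF that] that by (cases R') (auto simp: radii_def)
      then have "\<bar>w r\<bar> \<le> M + 1" if "r \<in> radii R'" for r
        using zM that by metis
      then have "bounded (w ` radii R')" by (auto simp: bounded_iff)
      moreover have "R' \<noteq> \<infinity>" using le by auto
      ultimately show False using max_solutionD(3)[OF w(1)] by blast
    qed
    then have wz': "w r = z r" if "r \<in> {0..T}" for r
      using wz that radii_down[of T R'] T by (auto simp: radii_def)
    show ?thesis
    proof (intro conjI ballI)
      fix r assume r: "r \<in> {0..T}"
      show "\<bar>w r - u r\<bar> < \<epsilon>" using est[OF r] wz'[OF r] by auto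
      have cont: "continuous_on {0..r} (\<lambda>t. cutoff (M+1) (z t))"
         "continuous_on {0..r} (\<lambda>t. cutoff (M+1) (u t))"
        using evolves_continuous_on[OF k2 z(2)] evolves_continuous_on[OF k2 uT] r
        by (auto intro!: continuous_on_compose2[OF cutoff_continuous] intro: continuous_on_subset)
      have "vel k (\<lambda>t. cutoff (M+1) (z t)) r = vel k (\<lambda>t. g (w t)) r"
        by (rule vel_cong[OF k2 cont(1)]) (use zM wz' r in \<open>auto simp: cutoff_eq\<close>)
      moreover have "vel k (\<lambda>t. cutoff (M+1) (u t)) r = vel k (\<lambda>t. g (u t)) r"
        by (rule vel_cong[OF k2 cont(2)]) (use M r in \<open>fastforce simp: cutoff_eq\<close>)+
      ultimately show "\<bar>vel k (\<lambda>t. g (w t)) r - vel k (\<lambda>t. g (u t)) r\<bar> < \<epsilon>"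
        using est[OF r] by auto
    qed fact
  qed
  then show ?thesis using \<delta> by blast
qed

end

section \<open>Tight and free motion\<close>

lemma mono_from_derivative:
  fixes f :: "real \<Rightarrow> real"
  assumes "a \<le> b" "continuous_on {a..b} f"
    and "\<And>x. a < x \<Longrightarrow> x < b \<Longrightarrow> (f has_real_derivative f' x) (at x)"
    and "\<And>x. a < x \<Longrightarrow> x < b \<Longrightarrow> 0 \<le> f' x"
  shows "f a \<le> f b"
proof (cases "a < b")
  case True
  obtain l z where z: "a < z" "z < b" "(f has_real_derivative l) (at z)" "f b - f a = (b - a) * l"
    using MVT[OF True assms(2)] assms(3) real_differentiable_def by metis
  then have "l = f' z" using assms(3) DERIV_unique by blast
  then show ?thesis using z assms(4) True by (metis diff_ge_0_iff_ge less_eq_real_def mult_nonneg_nonneg)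
qed (use assms in auto)

lemma strict_mono_from_derivative:
  fixes f :: "real \<Rightarrow> real"
  assumes "a < b" "continuous_on {a..b} f"
    and "\<And>x. a < x \<Longrightarrow> x < b \<Longrightarrow> (f has_real_derivative f' x) (at x)"
    and "\<And>x. a < x \<Longrightarrow> x < b \<Longrightarrow> 0 < f' x"
  shows "f a < f b"
proof -
  obtain l z where z: "a < z" "z < b" "(f has_real_derivative l) (at z)" "f b - f a = (b - a) * l"
    using MVT[OF assms(1,2)] assms(3) real_differentiable_def by metis
  then have "l = f' z" using assms(3) DERIV_unique by blast
  then show ?thesis using z assms(1,4) by (metis diff_gt_0_iff_gt mult_pos_pos)
qed

lemma first_hit:
  fixes f :: "real \<Rightarrow> real"
  assumes "continuous_on {a..b} f" "a \<le> b" "f a < z" "z \<le> f b"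
  obtains c where "a < c" "c \<le> b" "f c = z" "\<And>t. a \<le> t \<Longrightarrow> t < c \<Longrightarrow> f t < z"
proof -
  define S where "S = {t \<in> {a..b}. z \<le> f t}"
  have "closed ({a..b} \<inter> f -` {z..})"
    by (intro continuous_closed_preimage assms) auto
  then have "compact ({a..b} \<inter> ({a..b} \<inter> f -` {z..}))" by (intro compact_Int_closed) auto
  moreover have "{a..b} \<inter> ({a..b} \<inter> f -` {z..}) = S" by (auto simp: S_def)
  ultimately have S: "compact S" "b \<in> S" using assms by (auto simp: S_def)
  obtain c where c: "c \<in> S" "\<And>t. t \<in> S \<Longrightarrow> c \<le> t"
    using compact_attains_inf[OF S(1)] S(2) by blast
  have lt: "f t < z" if "a \<le> t" "t < c" for t
    using c(2)[of t] that c(1) by (force simp: S_def)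
  have "a < c" using c(1) assms(3) by (cases "c = a") (auto simp: S_def)
  have "f c = z"
  proof (rule ccontr)
    assume "f c \<noteq> z"
    then have "z < f c" using c(1) by (auto simp: S_def)
    moreover have "continuous_on {a..c} f"
      using assms(1) c(1) by (auto simp: S_def intro: continuous_on_subset)
    ultimately obtain t where "a \<le> t" "t \<le> c" "f t = z"
      using IVT'[of f a z c] assms(3) \<open>a < c\<close> by auto
    then show False using lt[of t] \<open>z < f c\<close> by (cases "t = c") auto
  qed
  then show ?thesis using that \<open>a < c\<close> c(1) lt by (auto simp: S_def)
qed

locale trajectory = reaction +
  fixes R :: ereal and u :: "real \<Rightarrow> real"
  assumes R_pos: "0 < R" and evolves: "evolves k g (radii R) u"
begin

abbreviation v :: "real \<Rightarrow> real" where "v \<equiv> vel k (\<lambda>t. g (u t))"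
text \<open>Where \<open>w = 0\<close> the motion is tight: \<open>u' = - r g(u) / k\<close>, and all \<open>k\<close> largest eigenvalues of
  the Hessian are \<open>u'/r\<close>. Where \<open>w < 0\<close> it is free: \<open>u'' = - (k - 1) u'/r - g(u)\<close>. Since
  \<open>\<phi>' = - r ^ k g'(u) u' / k\<close>, the sign of \<open>g'(u) u'\<close> decides which of the two prevails.\<close>

abbreviation w :: "real \<Rightarrow> real" where "w r \<equiv> v r + r * g (u r) / k"
abbreviation F :: "real \<Rightarrow> real" where "F \<equiv> flux k (\<lambda>t. g (u t))"
abbreviation M :: "real \<Rightarrow> real" where "M \<equiv> run_inf k (\<lambda>t. g (u t))"
abbreviation \<phi> :: "real \<Rightarrow> real" where "\<phi> \<equiv> obstacle k (\<lambda>t. g (u t))"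

lemma k_pos: "0 < real k" using k2 by simp

lemma power_k: "x ^ k = x ^ (k - 1) * (x::real)"
  using k2 by (cases k) auto

lemma radii_le: "b \<in> radii R \<Longrightarrow> r \<le> b \<Longrightarrow> 0 \<le> r \<Longrightarrow> r \<in> radii R"
  using radii_down by fastforce

lemma at_radii: 
  assumes "r \<in> radii R" "0 < r" shows "at r within radii R = at r"
proof -
  obtain b where "r < b" "ereal b < R"
    using assms ereal_dense2[of "ereal r" R] by (auto simp: radii_def)
  then show ?thesis
    using assms by (intro at_within_open_subset[of r "{0<..<b}"])
      (auto simp: radii_def intro: less_trans[of "ereal _" "ereal b"])
qed

lemma at_0_radii: "at 0 within radii R = at 0 within {0..}"
proof -
  obtain b where "0 < b" "ereal b < R"
    using R_pos ereal_dense2[of 0 R] by (auto simp: zero_ereal_def)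
  then show ?thesis
    by (intro at_within_nhd[of 0 "{..<b}"])
      (auto simp: radii_def intro: less_trans[of "ereal _" "ereal b"])
qed

lemma radii_extend: 
  assumes "r \<in> radii R" obtains b where "r < b" "b \<in> radii R"
  using assms ereal_dense2[of "ereal r" R] unfolding radii_def by (fastforce simp: less_eq_real_def)

lemma continuous_u: "continuous_on (radii R) u"
  by (rule evolves_continuous_on[OF k2 evolves])

lemma continuous_u': "b \<in> radii R \<Longrightarrow> 0 \<le> a \<Longrightarrow> continuous_on {a..b} u"
  by (rule continuous_on_subset[OF continuous_u]) (auto intro: radii_le)

lemma continuous_gu: "b \<in> radii R \<Longrightarrow> 0 \<le> a \<Longrightarrow> continuous_on {a..b} (\<lambda>t. g (u t))"
  by (intro continuous_on_compose2[OF g] continuous_u') auto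

lemma u_deriv: "r \<in> radii R \<Longrightarrow> (u has_real_derivative v r) (at r within radii R)"
  using evolves by (simp add: evolves_def)

lemma u_deriv': "r \<in> radii R \<Longrightarrow> 0 < r \<Longrightarrow> (u has_real_derivative v r) (at r)"
  using u_deriv at_radii by fastforce

lemma isCont_u: "r \<in> radii R \<Longrightarrow> 0 < r \<Longrightarrow> isCont u r"
  using u_deriv' DERIV_isCont by blast

lemma continuous_v': "b \<in> radii R \<Longrightarrow> 0 \<le> a \<Longrightarrow> continuous_on {a..b} v"
  by (rule continuous_on_subset[OF continuous_on_vel[OF k2 continuous_gu[of b 0]]]) auto

lemma continuous_radiiI:
  assumes "\<And>b. b \<in> radii R \<Longrightarrow> continuous_on {0..b} (f :: real \<Rightarrow> real)"
  shows "continuous_on (radii R) f"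
  unfolding continuous_on_eq_continuous_within
proof
  fix r assume r: "r \<in> radii R"
  obtain b where b: "r < b" "b \<in> radii R" using radii_extend[OF r] by blast
  have "at r within {0..b} = at r within radii R"
    by (rule at_within_nhd[of r "{..<b}"]) (use b radii_down[OF b(2)] in \<open>auto simp: radii_def\<close>)
  moreover have "continuous (at r within {0..b}) f"
    using assms[OF b(2)] r b by (auto simp: continuous_on_eq_continuous_within radii_def)
  ultimately show "continuous (at r within radii R) f" by simp
qed

lemma continuous_v: "continuous_on (radii R) v"
  by (rule continuous_radiiI) (simp add: continuous_v')

lemma isCont_v: "r \<in> radii R \<Longrightarrow> 0 < r \<Longrightarrow> isCont v r"
  using continuous_v at_radii unfolding continuous_on_eq_continuous_within by fastforce

lemma w_le: "r \<in> radii R \<Longrightarrow> w r \<le> 0"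
  using vel_le[OF k2 continuous_gu[of r 0]] by (auto simp: radii_def)

lemma p_eq: "0 \<le> r \<Longrightarrow> r ^ (k - 1) * v r = M r - F r"
  by (rule vel_eq[OF k2])

lemma w_eq: "0 \<le> r \<Longrightarrow> r ^ (k - 1) * w r = M r - \<phi> r"
  using p_eq[of r] by (simp add: obstacle_def power_k algebra_simps)

lemma w_zero_iff: "0 < r \<Longrightarrow> w r = 0 \<longleftrightarrow> M r = \<phi> r"
  using w_eq[of r] by auto

lemma w_neg_iff: "0 < r \<Longrightarrow> w r < 0 \<longleftrightarrow> M r < \<phi> r"
proof -
  assume "0 < r"
  then have "w r < 0 \<longleftrightarrow> r ^ (k - 1) * w r < 0" by (simp add: mult_less_0_iff)
  then show ?thesis using w_eq[of r] \<open>0 < r\<close> by auto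
qed

lemma M_le_\<phi>: "b \<in> radii R \<Longrightarrow> 0 \<le> s \<Longrightarrow> s \<le> b \<Longrightarrow> M b \<le> \<phi> s"
  by (rule run_inf_le[OF k2 continuous_gu]) auto

lemma M_antimono: "b \<in> radii R \<Longrightarrow> 0 \<le> s \<Longrightarrow> s \<le> b \<Longrightarrow> M b \<le> M s"
  by (rule run_inf_antimono[OF k2 continuous_gu]) auto

lemma M_attained:
  assumes "b \<in> radii R" obtains s where "0 \<le> s" "s \<le> b" "M b = \<phi> s"
  using run_inf_attained[OF k2 continuous_gu[OF assms order_refl]] assms by (auto simp: radii_def)

text \<open>Either the infimum has not moved since \<open>a\<close>, or a minimiser \<open>s\<close>
  lies after \<open>a\<close>, and there the running infimum touches \<phi>. Momentum estimates are
  made separately in the two cases.\<close>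

lemma M_cases:
  assumes "b \<in> radii R" "0 \<le> a" "a \<le> b"
  obtains "M b = M a" | s where "a < s" "s \<le> b" "M b = \<phi> s" "M s = \<phi> s"
proof -
  obtain s where s: "0 \<le> s" "s \<le> b" "M b = \<phi> s" using M_attained[OF assms(1)] .
  have "s \<in> radii R" "a \<in> radii R" using assms s radii_le by auto
  show ?thesis
  proof (cases "a < s")
    case True
    have "M s = \<phi> s" using M_antimono[OF assms(1) s(1,2)] M_le_\<phi>[of s s] s \<open>s \<in> radii R\<close> by auto
    then show ?thesis using that s True by blast
  next
    case False
    then have "M a \<le> \<phi> s" using M_le_\<phi>[of a s] \<open>a \<in> radii R\<close> s by auto
    then show ?thesis using that(1) M_antimono[OF assms] s by auto
  qed
qed

lemma p_le:
  assumes "b \<in> radii R" "0 \<le> a" "a \<le> b"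
  shows "b ^ (k - 1) * v b \<le> a ^ (k - 1) * v a - (F b - F a)"
  using M_antimono[OF assms] p_eq[of a] p_eq[of b] assms by auto

text \<open>Without contact after \<open>a\<close> the infimum is frozen, and the momentum changes
  exactly by the flux. Contact at \<open>a\<close> itself is allowed.\<close>

lemma p_eq_free:
  assumes "b \<in> radii R" "0 \<le> a" "a \<le> b" "\<And>s. a < s \<Longrightarrow> s \<le> b \<Longrightarrow> w s < 0"
  shows "M b = M a" "b ^ (k - 1) * v b = a ^ (k - 1) * v a - (F b - F a)"
proof -
  show *: "M b = M a"
  proof (rule M_cases[OF assms(1-3)])
    fix s assume s: "a < s" "s \<le> b" "M b = \<phi> s" "M s = \<phi> s"
    then show ?thesis using assms(4)[of s] w_zero_iff[of s] assms(2) by auto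
  qed
  show "b ^ (k - 1) * v b = a ^ (k - 1) * v a - (F b - F a)"
    using * p_eq[of a] p_eq[of b] assms by auto
qed

lemma F_diff_le:
  assumes "b \<in> radii R" "0 \<le> a" "a \<le> b" "\<And>t. a \<le> t \<Longrightarrow> t \<le> b \<Longrightarrow> g (u t) \<le> c"
  shows "F b - F a \<le> c * (b ^ k - a ^ k) / k"
proof -
  have c: "((\<lambda>t. t ^ (k - 1) * c) has_integral (c * b ^ k / k - c * a ^ k / k)) {a..b}"
    using assms k2
    by (intro fundamental_theorem_of_calculus)
      (auto intro!: derivative_eq_intros simp flip: has_real_derivative_iff_has_vector_derivative)
  have gI: "((\<lambda>t. t ^ (k - 1) * g (u t)) has_integral (F b - F a)) {a..b}"
    unfolding flux_diff[OF k2 continuous_gu[OF assms(1) order_refl] assms(2,3)]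
    by (intro integrable_integral flux_integrable[OF k2 continuous_gu[OF assms(1) order_refl]] assms) auto
  have "F b - F a \<le> c * b ^ k / k - c * a ^ k / k"
    by (rule has_integral_le[OF gI c]) (use assms in \<open>auto intro!: mult_left_mono\<close>)
  then show ?thesis by (simp add: diff_divide_distrib right_diff_distrib)
qed

text \<open>The running infimum only decreases, so the flux gained since \<open>a\<close> might seem
  to be lost. But at a contact point \<open>s\<close> the momentum equals
  \<open>- (s ^ k * g (u s)) / k\<close>, which is already at least \<open>c * s ^ k / k\<close>;
  from there on the flux adds the rest.\<close>

lemma p_lower:
  assumes b: "b \<in> radii R" and a: "0 \<le> a" "a \<le> b" and "0 \<le> v a" "0 \<le> c"
    and c: "\<And>t. a \<le> t \<Longrightarrow> t \<le> b \<Longrightarrow> g (u t) \<le> - c"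
  shows "c * (b ^ k - a ^ k) / k \<le> b ^ (k - 1) * v b"
proof (rule M_cases[OF b a])
  assume "M b = M a"
  then have "b ^ (k - 1) * v b = a ^ (k - 1) * v a - (F b - F a)"
    using p_eq[of a] p_eq[of b] a by auto
  moreover have "0 \<le> a ^ (k - 1) * v a" using a \<open>0 \<le> v a\<close> by simp
  ultimately show ?thesis using F_diff_le[OF b a, of "- c"] c by auto
next
  fix s assume s: "a < s" "s \<le> b" "M b = \<phi> s"
  have "c * (s ^ k - a ^ k) \<le> - (s ^ k * g (u s))"
  proof -
    have "0 \<le> s ^ k * (- c - g (u s)) + c * a ^ k"
      using c[of s] s a \<open>0 \<le> c\<close> by (auto intro!: add_nonneg_nonneg mult_nonneg_nonneg)
    then show ?thesis by (simp add: algebra_simps)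
  qed
  then have "c * (s ^ k - a ^ k) / k \<le> - (s ^ k * g (u s)) / k"
    by (rule divide_right_mono) simp
  moreover have "F b - F s \<le> - c * (b ^ k - s ^ k) / k"
    by (rule F_diff_le[OF b]) (use s a c in auto)
  moreover have "b ^ (k - 1) * v b = \<phi> s - F b" using p_eq[of b] s a by simp
  ultimately show ?thesis
    unfolding obstacle_def by (simp add: algebra_simps diff_divide_distrib)
qed

lemma v_pos:
  assumes b: "b \<in> radii R" and a: "0 \<le> a" "a < b" and "0 \<le> v a"
    and neg: "\<And>t. a \<le> t \<Longrightarrow> t \<le> b \<Longrightarrow> g (u t) < 0"
  shows "0 < v b"
proof -
  obtain m where m: "m \<in> {a..b}" "\<And>t. t \<in> {a..b} \<Longrightarrow> g (u t) \<le> g (u m)"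
    using continuous_attains_sup[of "{a..b}" "\<lambda>t. g (u t)"] continuous_gu[OF b a(1)] a by auto
  have "- g (u m) * (b ^ k - a ^ k) / k \<le> b ^ (k - 1) * v b"
    by (rule p_lower[OF b a(1) _ \<open>0 \<le> v a\<close>]) (use a m neg[of m] in auto)
  moreover have "0 < - g (u m) * (b ^ k - a ^ k) / k"
    using neg[of m] m(1) a k2 by (intro divide_pos_pos mult_pos_pos) (auto intro!: power_strict_mono)
  ultimately have "0 < b ^ (k - 1) * v b" by linarith
  then show ?thesis using a by (simp add: zero_less_mult_iff)
qed

lemma v_nonneg:
  assumes b: "b \<in> radii R" and a: "0 \<le> a" "a \<le> b" and "0 \<le> v a"
    and neg: "\<And>t. a \<le> t \<Longrightarrow> t \<le> b \<Longrightarrow> g (u t) \<le> 0"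
  shows "0 \<le> v b"
proof (cases "b = 0")
  case True then show ?thesis using a \<open>0 \<le> v a\<close> by simp
next
  case False
  have "0 * (b ^ k - a ^ k) / k \<le> b ^ (k - 1) * v b"
    by (rule p_lower[OF b a \<open>0 \<le> v a\<close>]) (use neg in auto)
  moreover have "0 < b ^ (k - 1)" using a False by simp
  ultimately show ?thesis by (auto simp: zero_le_mult_iff)
qed

text \<open>Gronwall's argument applies to \<open>z - u\<close> because \<open>u' \<le> - r g(u) / k\<close> holds in both regimes.\<close>

lemma barrier:
  assumes b: "b \<in> radii R" and a: "0 \<le> a" "a \<le> b" and "g z = 0" "u a < z"
  shows "u b < z"
proof (rule ccontr)
  assume "\<not> u b < z"
  then obtain c where c: "a < c" "c \<le> b" "u c = z" "\<And>t. a \<le> t \<Longrightarrow> t < c \<Longrightarrow> u t < z"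
    using first_hit[OF continuous_u'[OF b a(1)] a(2) \<open>u a < z\<close>] by auto
  have cR: "c \<in> radii R" using c a b by (auto intro: radii_le)
  obtain N where N: "\<And>r. r \<in> {0..c} \<Longrightarrow> \<bar>u r\<bar> \<le> N"
    using evolves_bound[OF evolves_subset[OF k2 evolves], of c] radii_down[OF cR] by metis
  obtain L where L: "L > 0" "\<And>x y. x \<in> {-N..N} \<Longrightarrow> y \<in> {-N..N} \<Longrightarrow> \<bar>g x - g y\<bar> \<le> L * \<bar>x - y\<bar>"
    using loc_lip[of N] by blast
  define C where "C = c * L / k"
  have "(z - u a) * exp (C * a) \<le> (z - u c) * exp (C * c)"
  proof (rule mono_from_derivative[where f = "\<lambda>r. (z - u r) * exp (C * r)"])
    show "a \<le> c" using c by simp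
    show "continuous_on {a..c} (\<lambda>r. (z - u r) * exp (C * r))"
      by (intro continuous_intros continuous_u' cR a)
    fix r assume r: "a < r" "r < c"
    then have rR: "r \<in> radii R" "0 < r" using cR a by (auto intro: radii_le)
    show "((\<lambda>r. (z - u r) * exp (C * r)) has_real_derivative
        (- v r + C * (z - u r)) * exp (C * r)) (at r)"
      by (auto intro!: derivative_eq_intros u_deriv'[OF rR] simp: algebra_simps)
    have "\<bar>g (u r) - g z\<bar> \<le> L * \<bar>u r - z\<bar>"
      using N[of r] N[of c] r rR c by (intro L(2)) auto
    then have 1: "- g (u r) \<le> L * (z - u r)" using c(4)[of r] r a \<open>g z = 0\<close> by auto
    have "v r \<le> r * (- g (u r)) / k" using w_le[OF rR(1)] by simp
    also have "\<dots> \<le> r * (L * (z - u r)) / k"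
      using 1 rR(2) by (intro divide_right_mono mult_left_mono) auto
    also have "\<dots> \<le> c * (L * (z - u r)) / k"
      using c(4)[of r] r L(1) by (intro divide_right_mono mult_right_mono) auto
    finally show "0 \<le> (- v r + C * (z - u r)) * exp (C * r)" by (simp add: C_def)
  qed
  then have "(z - u a) * exp (C * a) \<le> 0" using c by simp
  then show False using \<open>u a < z\<close> by (simp add: mult_le_0_iff)
qed

text \<open>Near \<open>0\<close> the reaction is close to the constant \<open>g (u 0)\<close>,
  whose velocity is exactly \<open>- r * g (u 0) / k\<close>. This is the second derivative needed
  for the Hessian at the origin.\<close>

lemma v_deriv_0: "(v has_real_derivative (- g (u 0) / k)) (at 0 within radii R)"
proof -
  have 0: "0 \<in> radii R" using R_pos by (simp add: radii_def zero_ereal_def)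
  obtain b where b: "0 < b" "b \<in> radii R" using radii_extend[OF 0] .
  have "((\<lambda>r. (v r - v 0) / (r - 0)) \<longlongrightarrow> - g (u 0) / k) (at 0 within {0..b})"
    unfolding tendsto_iff eventually_at
  proof (intro allI impI)
    fix e :: real assume "0 < e"
    \<comment> \<open>\<open>vel_dist\<close> turns a reaction error \<open>e * k / 2\<close> into a
      velocity error \<open>r * e / 2\<close>, hence an error below \<open>e\<close> in the
      quotient.\<close>
    then have "0 < e * k / 2" using k_pos by simp
    then obtain d where d: "0 < d" "\<And>t. t \<in> {0..b} \<Longrightarrow> dist t 0 < d \<Longrightarrow> dist (g (u t)) (g (u 0)) < e * k / 2"
      using continuous_gu[OF b(2) order_refl, unfolded continuous_on_iff, rule_format, of 0 "e * k / 2"]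
        b(1) by auto
    have "dist ((v r - v 0) / (r - 0)) (- g (u 0) / k) < e"
      if "r \<in> {0..b}" "r \<noteq> 0" "dist r 0 < d" for r
    proof -
      have r: "0 < r" "r \<le> b" using that by auto
      have "\<bar>v r - vel k (\<lambda>t. g (u 0)) r\<bar> \<le> r * (e * k / 2) / k"
      proof (rule vel_dist[OF k2])
        fix t assume "0 \<le> t" "t \<le> r"
        then show "\<bar>g (u t) - g (u 0)\<bar> \<le> e * k / 2"
          using d(2)[of t] that by (auto simp: dist_real_def)
      qed (use r continuous_gu[OF radii_le[OF b(2)], of r 0] in auto)
      then have "\<bar>v r + r * g (u 0) / k\<bar> \<le> r * (e / 2)"
        using r k_pos by (simp add: vel_const[OF k2])
      then have "\<bar>v r + r * g (u 0) / k\<bar> / r \<le> e / 2" using r by (simp add: field_simps)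
      moreover have "\<bar>v r + r * g (u 0) / k\<bar> / r = \<bar>v r / r + g (u 0) / k\<bar>"
      proof -
        have "v r / r + g (u 0) / k = (v r + r * g (u 0) / k) / r"
          using r by (simp add: add_divide_distrib)
        then show ?thesis using r by (simp add: abs_divide)
      qed
      ultimately show ?thesis using \<open>0 < e\<close> by (simp add: dist_real_def vel_0[OF k2])
    qed
    then show "\<exists>d>0. \<forall>x\<in>{0..b}. x \<noteq> 0 \<and> dist x 0 < d \<longrightarrow>
        dist ((v x - v 0) / (x - 0)) (- g (u 0) / k) < e"
      using d(1) by blast
  qed
  then have "(v has_real_derivative (- g (u 0) / k)) (at 0 within {0..b})"
    by (simp add: has_field_derivative_iff)
  moreover have "at 0 within {0..b} = at 0 within radii R"
    by (rule at_within_nhd[of 0 "{..<b}"]) (use b radii_down[OF b(2)] in \<open>auto simp: radii_def\<close>)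
  ultimately show ?thesis by simp
qed

lemma F_deriv: "r \<in> radii R \<Longrightarrow> 0 < r \<Longrightarrow> (F has_real_derivative r ^ (k - 1) * g (u r)) (at r)"
proof -
  assume r: "r \<in> radii R" "0 < r"
  obtain b where b: "r < b" "b \<in> radii R" using radii_extend[OF r(1)] by blast
  have "(F has_real_derivative r ^ (k - 1) * g (u r)) (at r within {0..b})"
    by (rule flux_has_derivative[OF k2 continuous_gu[OF b(2)]]) (use b r in auto)
  moreover have "at r within {0..b} = at r"
    by (rule at_within_interior) (use r b in auto)
  ultimately show ?thesis by simp
qed

text \<open>On a free interval the infimum is a constant \<open>M a\<close>, so that
  \<open>v = (M a - F) / s ^ (k - 1)\<close> can be differentiated explicitly.\<close>

lemma v_deriv_free:
  assumes r: "r \<in> radii R" "0 < r" and "\<forall>\<^sub>F s in nhds r. w s < 0"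
  shows "(v has_real_derivative (- (real k - 1) * v r / r - g (u r))) (at r)"
proof -
  obtain d where d: "0 < d" "\<And>s. dist s r < d \<Longrightarrow> w s < 0"
    using assms(3) unfolding eventually_nhds_metric by blast
  obtain b where b: "r < b" "b \<in> radii R" using radii_extend[OF r(1)] by blast
  define a where "a = max (r / 2) (r - d / 2)"
  define c where "c = min b (r + d / 2)"
  have ac: "0 < a" "a < r" "r < c" "c \<in> radii R"
    using b d r radii_le[OF b(2)] by (auto simp: a_def c_def max_def min_def)
  have free: "w s < 0" if "a \<le> s" "s \<le> c" for s
    by (rule d(2)) (use that d in \<open>auto simp: a_def c_def dist_real_def max_def min_def split: if_splits\<close>)
  have eq: "v s = (M a - F s) / s ^ (k - 1)" if "s \<in> {a<..<c}" for s
  proof -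
    have "M s = M a" using that ac free by (intro p_eq_free) (auto intro: radii_le)
    then show ?thesis using p_eq[of s] that ac by (auto simp: field_simps)
  qed
  have "((\<lambda>s. (M a - F s) / s ^ (k - 1)) has_real_derivative
      (- (r ^ (k - 1) * g (u r)) * r ^ (k - 1) - (M a - F r) * (real (k - 1) * r ^ (k - 1 - 1)))
        / (r ^ (k - 1) * r ^ (k - 1))) (at r)"
    by (rule derivative_eq_intros F_deriv[OF r] refl | use r in simp)+
  moreover have "(- (r ^ (k - 1) * g (u r)) * r ^ (k - 1) - (M a - F r) * (real (k - 1) * r ^ (k - 1 - 1)))
        / (r ^ (k - 1) * r ^ (k - 1)) = - (real k - 1) * v r / r - g (u r)"
  proof -
    define q where "q = r ^ (k - 1 - 1)"
    have q: "0 < q" "r ^ (k - 1) = r * q"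
      using r k2 by (simp add: q_def, cases "k - 1") (auto simp: q_def)
    have Mv: "M a - F r = r * q * v r" using eq[of r] ac r q by simp
    have "real (k - 1) = real k - 1" using k2 by (simp add: of_nat_diff)
    then show ?thesis
      unfolding Mv q(2) q_def[symmetric] using r q(1) by (simp add: field_simps)
  qed
  ultimately have "((\<lambda>s. (M a - F s) / s ^ (k - 1)) has_real_derivative
      (- (real k - 1) * v r / r - g (u r))) (at r)" by simp
  then show ?thesis
    by (rule has_field_derivative_transform_within_open[of _ _ _ "{a<..<c}"]) (use ac eq in auto)
qed

end

section \<open>Persistence and loss of tightness for a differentiable reaction\<close>

locale smooth_trajectory = trajectory +
  fixes g' :: "real \<Rightarrow> real"
  assumes g': "\<And>x. (g has_real_derivative g' x) (at x)" and cont_g': "continuous_on UNIV g'"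
begin

lemma gu_deriv: "r \<in> radii R \<Longrightarrow> 0 < r \<Longrightarrow>
  ((\<lambda>t. g (u t)) has_real_derivative g' (u r) * v r) (at r)"
  using DERIV_chain2[OF g' u_deriv'] by blast

lemma \<phi>_deriv:
  assumes "r \<in> radii R" "0 < r"
  shows "(\<phi> has_real_derivative (- (r ^ k) * g' (u r) * v r / k)) (at r)"
  unfolding obstacle_def[abs_def]
  by (rule DERIV_cong[OF DERIV_diff[OF F_deriv[OF assms]
        DERIV_cdivide[OF DERIV_mult[OF DERIV_pow gu_deriv[OF assms]]]]])
    (use k_pos in \<open>simp add: field_simps\<close>)

lemma continuous_\<phi>: "b \<in> radii R \<Longrightarrow> 0 \<le> a \<Longrightarrow> continuous_on {a..b} \<phi>"
  by (rule continuous_on_subset[OF continuous_on_obstacle[OF k2 continuous_gu[of b 0]]]) auto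

text \<open>Under the sign condition \<phi> is nonincreasing on \<open>[a,b]\<close>, and its
  running infimum follows it.\<close>

lemma tight_persists:
  assumes b: "b \<in> radii R" and a: "0 \<le> a" "a \<le> b" and "M a = \<phi> a"
    and sgn: "\<And>r. a < r \<Longrightarrow> r < b \<Longrightarrow> 0 \<le> g' (u r) * v r"
  shows "M b = \<phi> b"
proof (rule antisym)
  show "M b \<le> \<phi> b" using M_le_\<phi>[OF b] a by auto
  have dec: "\<phi> b \<le> \<phi> s" if s: "a \<le> s" "s \<le> b" for s
  proof -
    have "- \<phi> s \<le> - \<phi> b"
    proof (rule mono_from_derivative[OF s(2)])
      show "continuous_on {s..b} (\<lambda>x. - \<phi> x)"
        using s a by (intro continuous_on_minus continuous_\<phi> b) auto
      fix r assume r: "s < r" "r < b"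
      then have "r \<in> radii R" "0 < r" using b a s by (auto intro: radii_le)
      then show "((\<lambda>x. - \<phi> x) has_real_derivative r ^ k * (g' (u r) * v r) / k) (at r)"
        using DERIV_minus[OF \<phi>_deriv] by (simp add: mult.assoc)
      show "0 \<le> r ^ k * (g' (u r) * v r) / k"
        using sgn[of r] r s \<open>0 < r\<close> by simp
    qed
    then show ?thesis by simp
  qed
  show "\<phi> b \<le> M b"
  proof (rule M_cases[OF b a])
    assume "M b = M a" then show ?thesis using dec[of a] a \<open>M a = \<phi> a\<close> by simp
  qed (use dec in auto)
qed

text \<open>Here \<phi> increases strictly and leaves its running infimum behind at once, even if
  the two touch at \<open>a\<close>.\<close>

lemma becomes_free:
  assumes b: "b \<in> radii R" and a: "0 \<le> a" "a < b"
    and sgn: "\<And>r. a < r \<Longrightarrow> r < b \<Longrightarrow> g' (u r) * v r < 0"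
  shows "M b < \<phi> b"
proof -
  have "\<phi> a < \<phi> b"
  proof (rule strict_mono_from_derivative[OF a(2)])
    show "continuous_on {a..b} \<phi>" using a by (intro continuous_\<phi> b) auto
    fix r assume r: "a < r" "r < b"
    then have rR: "r \<in> radii R" "0 < r" using b a by (auto intro: radii_le)
    then show "(\<phi> has_real_derivative (- (r ^ k) * g' (u r) * v r / k)) (at r)" by (rule \<phi>_deriv)
    have "0 < r ^ k * (- (g' (u r) * v r))" using sgn[OF r] rR by (intro mult_pos_pos) auto
    from divide_pos_pos[OF this k_pos] show "0 < - (r ^ k) * g' (u r) * v r / k"
      by (simp add: mult.assoc)
  qed
  then show ?thesis using M_le_\<phi>[OF b, of a] a by auto
qed

end

section \<open>Equivalence with the radial equation\<close>

lemma radial_equation_iff: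
  fixes x :: "real ^ 'n::finite"
  assumes "1 \<le> k" "k < CARD('n)" "x \<noteq> 0" "0 < e"
    and "\<And>r. \<bar>r - norm x\<bar> < e \<Longrightarrow> (u has_real_derivative v r) (at r)"
    and "(v has_real_derivative a) (at (norm x))"
  shows "truncated_laplacian k (\<lambda>y. u (norm y)) x
    = (real k - 1) * (v (norm x) / norm x) + max a (v (norm x) / norm x)"
  by (rule truncated_laplacian_diagonal_plus_rank_one[where y = "x /\<^sub>R norm x"])
    (use hessian_radial[OF assms(3-6)] assms in auto)

lemma truncated_laplacian_radial_0:
  assumes "1 \<le> k" "k < CARD('n::finite)" "0 < e"
    and "\<And>r. 0 < r \<Longrightarrow> r < e \<Longrightarrow> (u has_real_derivative v r) (at r)"
    and "(u has_real_derivative 0) (at 0 within {0..})"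
    and "(v has_real_derivative a) (at 0 within {0..})" and "v 0 = 0"
  shows "truncated_laplacian k (\<lambda>y. u (norm y)) (0 :: real ^ 'n) = real k * a"
proof -
  obtain y :: "real ^ 'n" where "norm y = 1" using vector_choose_size[of 1] by auto
  moreover have "hessian (\<lambda>y. u (norm y)) (0 :: real ^ 'n)
    = (\<chi> i j. (if i = j then a else 0) + (a - a) * (y $ i * y $ j))"
    using hessian_radial_0[OF assms(3-7)] by simp
  ultimately show ?thesis
    using truncated_laplacian_diagonal_plus_rank_one[OF _ assms(1,2)] by (fastforce simp: algebra_simps)
qed

section \<open>Every radial solution follows the velocity functional\<close>

lemma nonpos_of_cofinite:
  fixes f :: "real \<Rightarrow> real"
  assumes "continuous_on {0..b} f" "finite E" "\<And>r. 0 < r \<Longrightarrow> r < b \<Longrightarrow> r \<notin> E \<Longrightarrow> f r \<le> 0"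
    and "0 < r" "r \<le> b"
  shows "f r \<le> 0"
proof (rule tendsto_upperbound)
  have "(f \<longlongrightarrow> f r) (at r within {0..b})"
    using assms by (auto simp: continuous_on_def)
  moreover have "at_left r \<le> at r within {0..b}"
  proof -
    have "at_left r = at r within {0..r}"
      using at_within_Icc_at_left[of 0 r] assms by simp
    then show ?thesis using assms by (simp add: at_le)
  qed
  ultimately show "(f \<longlongrightarrow> f r) (at_left r)" by (rule tendsto_mono[rotated])
  have "\<forall>\<^sub>F s in at r. s \<notin> E"
    using islimpt_finite[OF assms(2)] by (simp add: islimpt_iff_eventually)
  then have "\<forall>\<^sub>F s in at_left r. s \<notin> E" by (simp add: eventually_at_split)
  moreover have "\<forall>\<^sub>F s in at_left r. s \<in> {0<..<r}" by (rule eventually_at_left_real) fact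
  ultimately show "\<forall>\<^sub>F s in at_left r. f s \<le> 0"
    by eventually_elim (use assms in auto)
qed auto

text \<open>The fundamental theorem of calculus with finitely many exceptional points, at which the
  integrand is set to \<open>0\<close>.\<close>

lemma decreasing_of_cofinite:
  fixes f :: "real \<Rightarrow> real"
  assumes "finite E" "a \<le> b" "continuous_on {a..b} f"
    and "\<And>r. a < r \<Longrightarrow> r < b \<Longrightarrow> r \<notin> E \<Longrightarrow> (f has_real_derivative f' r) (at r) \<and> f' r \<le> 0"
  shows "f b \<le> f a"
proof -
  let ?h = "\<lambda>r. if r \<in> E \<union> {a, b} then 0 else f' r"
  have "(?h has_integral (f b - f a)) {a..b}"
    by (rule fundamental_theorem_of_calculus_interior_strong[OF assms(1,2) _ assms(3)])
      (use assms(4) in \<open>auto simp flip: has_real_derivative_iff_has_vector_derivative\<close>)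
  moreover have "((\<lambda>r. 0) has_integral 0) {a..b}" by simp
  ultimately have "f b - f a \<le> 0"
    by (rule has_integral_le) (use assms(4) in auto)
  then show ?thesis by simp
qed

context reaction
begin

text \<open>A vanishing maximum means that both candidates are nonpositive, and that the first
  vanishes wherever the second is negative.\<close>

lemma radial_solution_ineq:
  fixes R :: ereal and u u' u'' :: "real \<Rightarrow> real"
  assumes kN: "k < CARD('n::finite)"
    and pc: "piecewise_C2 R E u u' u''"
    and eq: "\<And>x :: real ^ 'n. ereal (norm x) < R \<Longrightarrow> norm x \<notin> E \<Longrightarrow>
           truncated_laplacian k (\<lambda>y. u (norm y)) x + g (u (norm x)) = 0"
    and r: "r \<in> radii R" "0 < r" "r \<notin> E"
  shows "(u has_real_derivative u' r) (at r)" "(u' has_real_derivative u'' r) (at r)"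
    "real k * u' r + r * g (u r) \<le> 0" "u'' r + (real k - 1) * (u' r / r) + g (u r) \<le> 0"
    "real k * u' r + r * g (u r) < 0 \<Longrightarrow> u'' r + (real k - 1) * (u' r / r) + g (u r) = 0"
proof -
  obtain b where b: "r < b" "ereal b < R"
    using r ereal_dense2[of "ereal r" R] by (auto simp: radii_def)
  have sub: "{0<..<b} \<subseteq> radii R"
    using b by (auto simp: radii_def intro: less_trans[of "ereal _" "ereal b"])
  have at: "at s within radii R = at s" if "s \<in> {0<..<b}" for s
    by (rule at_within_open_subset[OF that _ sub]) auto
  have u: "(u has_real_derivative u' s) (at s)" if "s \<in> {0<..<b}" for s
  proof -
    have "(u has_real_derivative u' s) (at s within radii R)"
      using pc sub that unfolding piecewise_C2_def by blast
    then show ?thesis by (simp add: at[OF that])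
  qed
  then show "(u has_real_derivative u' r) (at r)" using b r by auto
  show u': "(u' has_real_derivative u'' r) (at r)"
  proof -
    have "(u' has_real_derivative u'' r) (at r within radii R)"
      using pc r unfolding piecewise_C2_def by blast
    then show ?thesis using at[of r] r b by simp
  qed
  obtain x :: "real ^ 'n" where x: "norm x = r" using vector_choose_size[of r] r by auto
  have "truncated_laplacian k (\<lambda>y. u (norm y)) x
    = (real k - 1) * (u' (norm x) / norm x) + max (u'' r) (u' (norm x) / norm x)"
  proof (rule radial_equation_iff[where e = "min r (b - r)"])
    fix s assume "\<bar>s - norm x\<bar> < min r (b - r)"
    then show "(u has_real_derivative u' s) (at s)" using x by (intro u) auto
  qed (use k2 kN x r b u' in auto)
  then have *: "(real k - 1) * (u' r / r) + max (u'' r) (u' r / r) + g (u r) = 0"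
    using eq[of x] x r b by (auto simp: radii_def)
  then show "u'' r + (real k - 1) * (u' r / r) + g (u r) \<le> 0" by linarith
  have "(real k * u' r + r * g (u r)) / r = (real k - 1) * (u' r / r) + u' r / r + g (u r)"
    using r by (simp add: field_simps)
  also have "\<dots> \<le> 0" using * by linarith
  finally show "real k * u' r + r * g (u r) \<le> 0" using r by (simp add: divide_le_0_iff)
  show "u'' r + (real k - 1) * (u' r / r) + g (u r) = 0" if "real k * u' r + r * g (u r) < 0"
  proof -
    have "(real k * u' r + r * g (u r)) / r < 0" using that r by (simp add: divide_less_0_iff)
    then have "(real k - 1) * (u' r / r) + u' r / r + g (u r) < 0"
      using r by (simp add: field_simps)
    then show ?thesis using * by linarith
  qed
qed

text \<open>\<open>q\<close> is \<open>p + flux\<close>. It is nonincreasing and below the obstacle,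
  hence at most the running infimum. Conversely it is constant after the last contact, and its value
  there is a value of the obstacle, hence at least the infimum. Contact at \<open>0\<close> is
  automatic, so a last contact exists.\<close>

lemma radial_solution_velocity:
  fixes R :: ereal and u u' u'' :: "real \<Rightarrow> real"
  assumes kN: "k < CARD('n::finite)"
    and pc: "piecewise_C2 R E u u' u''" and "u' 0 = 0"
    and eq: "\<And>x :: real ^ 'n. ereal (norm x) < R \<Longrightarrow> norm x \<notin> E \<Longrightarrow>
           truncated_laplacian k (\<lambda>y. u (norm y)) x + g (u (norm x)) = 0"
    and r: "r \<in> radii R"
  shows "u' r = vel k (\<lambda>t. g (u t)) r"
proof (cases "r = 0")
  case True
  then show ?thesis using \<open>u' 0 = 0\<close> by (simp add: vel_0[OF k2])
next
  case False
  then have r0: "0 < r" using r by (simp add: radii_def)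
  define E' where "E' = E \<inter> {0..r}"
  have E': "finite E'" using pc r unfolding piecewise_C2_def E'_def radii_def by auto
  have sub: "{0..r} \<subseteq> radii R" using radii_down[OF r] by simp
  have "continuous_on (radii R) u" "continuous_on (radii R) u'"
    using pc unfolding piecewise_C2_def by (auto intro: DERIV_continuous_on)
  then have cu: "continuous_on {0..r} u" and cu': "continuous_on {0..r} u'"
    using sub continuous_on_subset by blast+
  then have cg: "continuous_on {0..r} (\<lambda>t. g (u t))"
    by (intro continuous_on_compose2[OF g]) auto
  let ?F = "flux k (\<lambda>t. g (u t))"
  note ineq = radial_solution_ineq[OF kN pc eq]
  have cF: "continuous_on {0..r} ?F" by (rule continuous_on_flux[OF k2 cg])
  define q where "q = (\<lambda>s. s ^ (k - 1) * u' s + ?F s)"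
  have cq: "continuous_on {a..b} q" if "0 \<le> a" "b \<le> r" for a b
  proof (rule continuous_on_subset[of "{0..r}"])
    show "continuous_on {0..r} q" unfolding q_def by (intro continuous_intros cu' cF)
  qed (use that in auto)
  have power_k: "x ^ k = x ^ (k - 1) * x" for x :: real using k2 by (cases k) auto
  have q': "(q has_real_derivative s ^ (k - 1) * (u'' s + (real k - 1) * (u' s / s) + g (u s))) (at s)"
    if s: "0 < s" "s < r" "s \<notin> E'" for s
  proof -
    have sR: "s \<in> radii R" "0 < s" "s \<notin> E" using s sub by (auto simp: E'_def)
    have "(?F has_real_derivative s ^ (k - 1) * g (u s)) (at s within {0..r})"
      by (rule flux_has_derivative[OF k2 cg]) (use s in auto)
    then have F: "(?F has_real_derivative s ^ (k - 1) * g (u s)) (at s)"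
      using s at_within_interior[of s "{0..r}"] by simp
    have der: "(u' has_real_derivative u'' s) (at s)" by (rule ineq(2)) (use sR in auto)
    obtain m where m: "k = Suc (Suc m)" using k2 by (metis add_2_eq_Suc le_Suc_ex)
    show ?thesis
      unfolding q_def
      by (intro DERIV_cong[OF DERIV_add[OF DERIV_mult[OF DERIV_pow der] F]])
        (use s in \<open>simp add: m field_simps\<close>)
  qed
  have H: "real k * u' s + s * g (u s) \<le> 0" if s: "0 \<le> s" "s \<le> r" for s
  proof (cases "s = 0")
    case False
    show ?thesis
    proof (rule nonpos_of_cofinite[where f = "\<lambda>s. real k * u' s + s * g (u s)", OF _ E'])
      show "continuous_on {0..r} (\<lambda>s. real k * u' s + s * g (u s))" by (intro continuous_intros cu' cg)
      show "real k * u' t + t * g (u t) \<le> 0" if "0 < t" "t < r" "t \<notin> E'" for t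
        by (rule ineq(3)) (use that sub in \<open>auto simp: E'_def\<close>)
    qed (use False s in auto)
  qed (use \<open>u' 0 = 0\<close> in simp)
  have q_le: "q s \<le> obstacle k (\<lambda>t. g (u t)) s" if s: "0 \<le> s" "s \<le> r" for s
  proof -
    have "s ^ (k - 1) * (real k * u' s + s * g (u s)) \<le> 0"
      using H[OF s] s by (intro mult_nonneg_nonpos) auto
    then have "s ^ (k - 1) * u' s \<le> - (s ^ k * g (u s)) / k"
      using k2 by (simp add: power_k field_simps)
    then show ?thesis by (simp add: q_def obstacle_def)
  qed
  have q_dec: "q r \<le> q s" if s: "0 \<le> s" "s \<le> r" for s
  proof (rule decreasing_of_cofinite[OF E' s(2)])
    show "continuous_on {s..r} q" using s by (intro cq) auto
    fix t assume t: "s < t" "t < r" "t \<notin> E'"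
    then have "u'' t + (real k - 1) * (u' t / t) + g (u t) \<le> 0"
      using s sub by (intro ineq(4)) (auto simp: E'_def)
    then show "(q has_real_derivative t ^ (k - 1) * (u'' t + (real k - 1) * (u' t / t) + g (u t))) (at t)
        \<and> t ^ (k - 1) * (u'' t + (real k - 1) * (u' t / t) + g (u t)) \<le> 0"
      using q' t s by (auto intro!: mult_nonneg_nonpos)
  qed
  have "q r \<le> run_inf k (\<lambda>t. g (u t)) r"
    unfolding run_inf_def
  proof (rule cINF_greatest)
    fix s assume "s \<in> {0..r}"
    then show "q r \<le> obstacle k (\<lambda>t. g (u t)) s" using q_dec[of s] q_le[of s] by simp
  qed (use r0 in auto)
  moreover have "run_inf k (\<lambda>t. g (u t)) r \<le> q r"
  proof -
    \<comment> \<open>after the last contact with the obstacle, \<open>q\<close> is constant\<close>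
    define S where "S = {s \<in> {0..r}. real k * u' s + s * g (u s) = 0}"
    have "closed ({0..r} \<inter> (\<lambda>s. real k * u' s + s * g (u s)) -` {0})"
      by (intro continuous_closed_preimage continuous_intros cu' cg)
    then have "compact ({0..r} \<inter> ({0..r} \<inter> (\<lambda>s. real k * u' s + s * g (u s)) -` {0}))"
      by (intro compact_Int_closed) auto
    moreover have "{0..r} \<inter> ({0..r} \<inter> (\<lambda>s. real k * u' s + s * g (u s)) -` {0}) = S" by (auto simp: S_def)
    ultimately have "compact S" by simp
    moreover have "0 \<in> S" using r0 \<open>u' 0 = 0\<close> by (simp add: S_def)
    ultimately obtain s where s: "s \<in> S" "\<And>t. t \<in> S \<Longrightarrow> t \<le> s"
      using compact_attains_sup[of S] by blast
    have sr: "0 \<le> s" "s \<le> r" using s by (auto simp: S_def)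
    have "- q r \<le> - q s"
    proof (rule decreasing_of_cofinite[OF E' sr(2)])
      show "continuous_on {s..r} (\<lambda>x. - q x)" using sr by (intro continuous_on_minus cq) auto
      fix t assume t: "s < t" "t < r" "t \<notin> E'"
      have "t \<notin> S" using s(2)[of t] t by auto
      then have "real k * u' t + t * g (u t) < 0" using H[of t] t sr by (auto simp: S_def less_le)
      then have "u'' t + (real k - 1) * (u' t / t) + g (u t) = 0"
        using t sr sub by (intro ineq(5)) (auto simp: E'_def)
      moreover have "(q has_real_derivative t ^ (k - 1) * (u'' t + (real k - 1) * (u' t / t) + g (u t))) (at t)"
        by (rule q') (use t sr in auto)
      ultimately show "((\<lambda>x. - q x) has_real_derivative 0) (at t) \<and> 0 \<le> (0::real)"
        using DERIV_minus[of q 0 t UNIV] by simp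
    qed
    moreover have "q s = obstacle k (\<lambda>t. g (u t)) s"
    proof -
      have "real k * u' s = - (s * g (u s))" using s(1) by (auto simp: S_def)
      then have "u' s = - (s * g (u s)) / k" using k2 by (simp add: field_simps)
      then show ?thesis by (simp add: q_def obstacle_def power_k)
    qed
    moreover have "run_inf k (\<lambda>t. g (u t)) r \<le> obstacle k (\<lambda>t. g (u t)) s"
      by (rule run_inf_le[OF k2 cg sr])
    ultimately show ?thesis by linarith
  qed
  ultimately have "q r = run_inf k (\<lambda>t. g (u t)) r" by simp
  then have "r ^ (k - 1) * u' r = r ^ (k - 1) * vel k (\<lambda>t. g (u t)) r"
    using vel_eq[OF k2, of r "\<lambda>t. g (u t)"] r0 by (simp add: q_def)
  then show ?thesis using r0 by simp
qed

text \<open>If \<open>u\<close> were bounded up to a finite \<open>R\<close>, comparison with the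
  zero reaction would bound \<open>u'\<close> as well, contrary to the divergence of
  \<open>\<bar>u\<bar> + \<bar>u'\<bar>\<close>.\<close>

lemma radial_solution_max_solution:
  assumes kN: "k < CARD('n::finite)" and rs: "radial_solution TYPE('n) k g R u"
  shows "max_solution k g R u"
proof -
  obtain E u' u'' where pc: "piecewise_C2 R E u u' u''" and "u' 0 = 0"
    and eq: "\<And>x :: real ^ 'n. ereal (norm x) < R \<Longrightarrow> norm x \<notin> E \<Longrightarrow>
           truncated_laplacian k (\<lambda>y. u (norm y)) x + g (u (norm x)) = 0"
    and mx: "R \<noteq> \<infinity> \<Longrightarrow> filterlim (\<lambda>r. \<bar>u r\<bar> + \<bar>u' r\<bar>) at_top (at_left (real_of_ereal R))"
    and "0 < R"
    using rs unfolding radial_solution_def by blast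
  have v: "u' r = vel k (\<lambda>t. g (u t)) r" if "r \<in> radii R" for r
    by (rule radial_solution_velocity[OF kN pc \<open>u' 0 = 0\<close> _ that]) (rule eq)
  have ev: "evolves k g (radii R) u"
    unfolding evolves_def using pc v unfolding piecewise_C2_def by metis
  have "\<not> bounded (u ` radii R)" if R: "R \<noteq> \<infinity>"
  proof (rule notI)
    assume "bounded (u ` radii R)"
    then obtain N where N: "\<And>r. r \<in> radii R \<Longrightarrow> \<bar>u r\<bar> \<le> N" by (auto simp: bounded_iff)
    obtain b where b: "R = ereal b" "0 < b" using R \<open>0 < R\<close> by (cases R) auto
    obtain L where L: "L > 0" "\<And>x y. x \<in> {-N..N} \<Longrightarrow> y \<in> {-N..N} \<Longrightarrow> \<bar>g x - g y\<bar> \<le> L * \<bar>x - y\<bar>"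
      using loc_lip[of N] by blast
    define C where "C = \<bar>g (u 0)\<bar> + L * (2 * N)"
    have 0: "0 \<in> radii R" using b by (simp add: radii_def)
    have gC: "\<bar>g (u t)\<bar> \<le> C" if "t \<in> radii R" for t
    proof -
      have "\<bar>g (u t) - g (u 0)\<bar> \<le> L * \<bar>u t - u 0\<bar>"
        using N[OF that] N[OF 0] by (intro L(2)) auto
      also have "\<dots> \<le> L * (2 * N)" using N[OF that] N[OF 0] L(1) by (intro mult_left_mono) auto
      finally show ?thesis by (auto simp: C_def)
    qed
    have bd: "\<bar>u r\<bar> + \<bar>u' r\<bar> \<le> N + b * C / k" if "r \<in> radii R" for r
    proof -
      have r: "0 \<le> r" "r < b" using that b by (auto simp: radii_def)
      have cont: "continuous_on {0..r} (\<lambda>t. g (u t))"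
        using evolves_continuous_on[OF k2 ev] radii_down[OF that]
        by (intro continuous_on_compose2[OF g]) (auto intro: continuous_on_subset)
      have "\<bar>vel k (\<lambda>t. g (u t)) r - vel k (\<lambda>_. 0) r\<bar> \<le> r * C / k"
        by (rule vel_dist[OF k2 cont _ r(1)]) (use gC radii_down[OF that] in auto)
      also have "\<dots> \<le> b * C / k" using r gC[OF 0] by (intro divide_right_mono mult_right_mono) auto
      finally show ?thesis using N[OF that] v[OF that] r by (simp add: vel_const[OF k2])
    qed
    have "\<forall>\<^sub>F r in at_left b. N + b * C / k + 1 \<le> \<bar>u r\<bar> + \<bar>u' r\<bar>"
      using mx[OF R] b unfolding filterlim_at_top by simp
    moreover have "\<forall>\<^sub>F r in at_left b. r \<in> {0<..<b}" by (rule eventually_at_left_real) (use b in auto)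
    ultimately have "\<forall>\<^sub>F r in at_left b. False"
    proof eventually_elim
      case (elim r)
      then have "r \<in> radii R" using b by (simp add: radii_def)
      then show ?case using bd[of r] elim by auto
    qed
    then show False by simp
  qed
  then show ?thesis using ev \<open>0 < R\<close> by (simp add: max_solution_def)
qed

end

section \<open>Solutions with at most two switches are radial solutions\<close>

context smooth_trajectory
begin

text \<open>The motion is successively tight, free and tight; each of the three phases may be empty. This
  covers all solutions of the bistable problem.\<close>

definition switching :: bool where
  "switching \<longleftrightarrow> (\<exists>a b :: ereal. a \<le> b \<and> (\<forall>r. r \<in> radii R \<and> 0 < r \<longrightarrow>
    (r < a \<longrightarrow> w r = 0) \<and> (a < r \<and> r < b \<longrightarrow> w r < 0) \<and> (b < r \<longrightarrow> w r = 0)))"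

text \<open>The derivative of the tight velocity \<open>- r * g (u r) / k\<close>.\<close>

definition accel_tight :: "real \<Rightarrow> real" where
  "accel_tight r = - g (u r) / k - r * (g' (u r) * v r) / k"

definition accel_free :: "real \<Rightarrow> real" where
  "accel_free r = - (real k - 1) * (v r / r) - g (u r)"

lemma isCont_accel:
  assumes "r \<in> radii R" "0 < r" shows "isCont accel_tight r" "isCont accel_free r"
proof -
  have gu: "isCont (\<lambda>r. g (u r)) r" using DERIV_isCont[OF gu_deriv[OF assms]] .
  have "isCont g' (u r)" using cont_g' by (simp add: continuous_on_eq_continuous_at)
  then have g'u: "isCont (\<lambda>r. g' (u r)) r" by (rule isCont_o2[OF isCont_u[OF assms]])
  show "isCont accel_tight r" unfolding accel_tight_def[abs_def]
    using k_pos by (intro continuous_intros gu g'u isCont_v assms) auto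
  show "isCont accel_free r" unfolding accel_free_def[abs_def]
    using assms by (intro continuous_intros gu isCont_v) auto
qed

text \<open>Tightness on a neighbourhood makes \<phi> coincide there with a nonincreasing function,
  so \<open>\<phi>' \<le> 0\<close>, that is \<open>g' (u r) * v r \<ge> 0\<close>. This is what
  puts \<open>u''\<close> below \<open>u'/r\<close> and lets the maximum select
  \<open>u'/r\<close>.\<close>

lemma v_deriv_tight:
  assumes r: "r \<in> radii R" "0 < r" and t: "\<forall>\<^sub>F s in nhds r. w s = 0"
  shows "(v has_real_derivative accel_tight r) (at r)" "accel_tight r \<le> v r / r"
proof -
  have "((\<lambda>s. - (s * g (u s) / k)) has_real_derivative accel_tight r) (at r)"
    by (rule DERIV_cong[OF DERIV_minus[OF DERIV_cdivide[OF DERIV_mult[OF DERIV_ident gu_deriv[OF r]]]]])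
      (simp add: accel_tight_def add_divide_distrib mult.commute)
  moreover have "\<forall>\<^sub>F s in nhds r. - (s * g (u s) / k) = v s"
    using t by eventually_elim simp
  ultimately show "(v has_real_derivative accel_tight r) (at r)"
    using DERIV_cong_ev[OF refl, of "\<lambda>s. - (s * g (u s) / k)" v r, OF _ refl] by blast
  have "0 \<le> g' (u r) * v r"
  proof (rule ccontr)
    assume "\<not> 0 \<le> g' (u r) * v r"
    then have "0 < r ^ k * (- (g' (u r) * v r))" using r by (intro mult_pos_pos) auto
    then have "0 < - (r ^ k) * g' (u r) * v r / k" using k_pos by (simp add: mult.assoc divide_less_0_iff)
    from DERIV_pos_inc_right[OF \<phi>_deriv[OF r] this] obtain d where
      d: "0 < d" "\<And>h. 0 < h \<Longrightarrow> h < d \<Longrightarrow> \<phi> r < \<phi> (r + h)" by blast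
    obtain d' where d': "0 < d'" "\<And>s. dist s r < d' \<Longrightarrow> w s = 0"
      using t unfolding eventually_nhds_metric by blast
    obtain b where b: "r < b" "b \<in> radii R" using radii_extend[OF r(1)] by blast
    define h where "h = Min {d / 2, d' / 2, b - r}"
    have h: "0 < h" "h < d" "h < d'" "h \<le> b - r" using d d' b by (auto simp: h_def)
    then have rh: "r + h \<in> radii R" using r by (intro radii_le[OF b(2)]) auto
    have "w (r + h) = 0" "w r = 0" using h d' by (auto intro!: d'(2) simp: dist_real_def)
    then have "M (r + h) = \<phi> (r + h)" "M r = \<phi> r" using w_zero_iff[of r] w_zero_iff[of "r + h"] r h by auto
    then show False using d(2)[OF h(1,2)] M_antimono[OF rh, of r] r h by auto
  qed
  moreover have "w r = 0" using t by (rule eventually_nhds_x_imp_x)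
  then have "v r / r = - g (u r) / k" using r by (simp add: field_simps)
  ultimately show "accel_tight r \<le> v r / r" using r k_pos by (simp add: accel_tight_def)
qed

text \<open>Only the two switching radii can be exceptional. On either side of each of them one
  regime holds throughout a one-sided neighbourhood, which gives the one-sided limits of
  \<open>u''\<close>.\<close>

lemma switching_radial_solution:
  assumes kN: "k < CARD('n::finite)" and sw: switching
    and blow: "R \<noteq> \<infinity> \<Longrightarrow> filterlim (\<lambda>r. \<bar>u r\<bar>) at_top (at_left (real_of_ereal R))"
  shows "radial_solution TYPE('n) k g R u"
proof -
  obtain a b :: ereal where ab: "a \<le> b" 
    and tight1: "\<And>r. r \<in> radii R \<Longrightarrow> 0 < r \<Longrightarrow> ereal r < a \<Longrightarrow> w r = 0"
    and free: "\<And>r. r \<in> radii R \<Longrightarrow> 0 < r \<Longrightarrow> a < ereal r \<Longrightarrow> ereal r < b \<Longrightarrow> w r < 0"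
    and tight2: "\<And>r. r \<in> radii R \<Longrightarrow> 0 < r \<Longrightarrow> b < ereal r \<Longrightarrow> w r = 0"
    using sw unfolding switching_def by blast
  define E where "E = {r \<in> radii R. 0 < r \<and> (ereal r = a \<or> ereal r = b)}"
  have "E \<subseteq> {real_of_ereal a, real_of_ereal b}" by (auto simp: E_def)
  then have finE: "finite E" using finite_subset by blast
  have 0: "0 \<in> radii R" using R_pos by (simp add: radii_def zero_ereal_def)
  define a2 where "a2 = (\<lambda>r. if r = 0 then - g (u 0) / k else if w r < 0 then accel_free r else accel_tight r)"
  have inside: "\<forall>\<^sub>F s in nhds r. s \<in> radii R \<and> 0 < s" if r: "r \<in> radii R" "0 < r" for r
  proof -
    obtain c where c: "r < c" "c \<in> radii R" using radii_extend[OF r(1)] by blast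
    have "\<forall>\<^sub>F s in nhds r. s \<in> {0<..<c}" using r c by (intro eventually_nhds_in_open) auto
    then show ?thesis by eventually_elim (auto intro: radii_le[OF c(2)])
  qed
  have ev_less: "\<forall>\<^sub>F s in nhds r. c < ereal s" if "c < ereal r" for c r
    using order_tendstoD(1)[OF tendsto_ereal[OF tendsto_ident_at[of r UNIV]] that] that
    by (simp add: eventually_nhds_conv_at)
  have ev_gr: "\<forall>\<^sub>F s in nhds r. ereal s < c" if "ereal r < c" for c r
    using order_tendstoD(2)[OF tendsto_ereal[OF tendsto_ident_at[of r UNIV]] that] that
    by (simp add: eventually_nhds_conv_at)
  have alt: "(\<forall>\<^sub>F s in nhds r. w s = 0) \<or> (\<forall>\<^sub>F s in nhds r. w s < 0)"
    if r: "r \<in> radii R" "0 < r" "r \<notin> E" for r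
  proof -
    consider "ereal r < a" | "a < ereal r" "ereal r < b" | "b < ereal r"
      using r by (fastforce simp: E_def)
    then show ?thesis
    proof cases
      case 1
      have "\<forall>\<^sub>F s in nhds r. w s = 0"
        using inside[OF r(1,2)] ev_gr[OF 1] by eventually_elim (auto intro: tight1)
      then show ?thesis ..
    next
      case 2
      have "\<forall>\<^sub>F s in nhds r. w s < 0"
        using inside[OF r(1,2)] ev_less[OF 2(1)] ev_gr[OF 2(2)] by eventually_elim (auto intro: free)
      then show ?thesis ..
    next
      case 3
      have "\<forall>\<^sub>F s in nhds r. w s = 0"
        using inside[OF r(1,2)] ev_less[OF 3] by eventually_elim (auto intro: tight2)
      then show ?thesis ..
    qed
  qed
  have left: "(\<forall>\<^sub>F s in at_left r. w s = 0) \<or> (\<forall>\<^sub>F s in at_left r. w s < 0)"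
    if r: "r \<in> radii R" "0 < r" for r
  proof -
    have i: "\<forall>\<^sub>F s in at_left r. s \<in> radii R \<and> 0 < s"
      using inside[OF r] by (simp add: eventually_at_filter eventually_mono)
    have l: "\<forall>\<^sub>F s in at_left r. s < r" by (simp add: eventually_at_filter)
    consider "ereal r \<le> a" | "a < ereal r" "ereal r \<le> b" | "b < ereal r" by fastforce
    then show ?thesis
    proof cases
      case 1
      have "\<forall>\<^sub>F s in at_left r. w s = 0"
        using i l by eventually_elim (use 1 in \<open>auto intro!: tight1 intro: less_le_trans[of "ereal _" "ereal r"]\<close>)
      then show ?thesis ..
    next
      case 2
      have "\<forall>\<^sub>F s in at_left r. a < ereal s"
        using ev_less[OF 2(1)] by (simp add: eventually_at_filter eventually_mono)
      then have "\<forall>\<^sub>F s in at_left r. w s < 0"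
        using i l by eventually_elim (use 2 in \<open>auto intro!: free intro: less_le_trans[of "ereal _" "ereal r"]\<close>)
      then show ?thesis ..
    next
      case 3
      have "\<forall>\<^sub>F s in at_left r. b < ereal s"
        using ev_less[OF 3] by (simp add: eventually_at_filter eventually_mono)
      then have "\<forall>\<^sub>F s in at_left r. w s = 0"
        using i l by eventually_elim (auto intro!: tight2)
      then show ?thesis ..
    qed
  qed
  have right: "(\<forall>\<^sub>F s in at_right r. w s = 0) \<or> (\<forall>\<^sub>F s in at_right r. w s < 0)"
    if r: "r \<in> radii R" for r
  proof -
    obtain c where c: "r < c" "c \<in> radii R" using radii_extend[OF r] by blast
    have "\<forall>\<^sub>F s in at_right r. s \<in> {r<..<c}" by (rule eventually_at_right_real[OF c(1)])
    then have i: "\<forall>\<^sub>F s in at_right r. s \<in> radii R \<and> 0 < s"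
      by eventually_elim (use radii_down[OF r] in \<open>auto intro!: radii_le[OF c(2)]\<close>)
    have l: "\<forall>\<^sub>F s in at_right r. r < s" by (simp add: eventually_at_filter)
    consider "ereal r < a" | "a \<le> ereal r" "ereal r < b" | "b \<le> ereal r" by fastforce
    then show ?thesis
    proof cases
      case 1
      have "\<forall>\<^sub>F s in at_right r. ereal s < a"
        using ev_gr[OF 1] by (simp add: eventually_at_filter eventually_mono)
      then have "\<forall>\<^sub>F s in at_right r. w s = 0"
        using i l by eventually_elim (auto intro!: tight1)
      then show ?thesis ..
    next
      case 2
      have "\<forall>\<^sub>F s in at_right r. ereal s < b"
        using ev_gr[OF 2(2)] by (simp add: eventually_at_filter eventually_mono)
      then have "\<forall>\<^sub>F s in at_right r. w s < 0"
        using i l by eventually_elim (use 2 in \<open>auto intro!: free intro: le_less_trans[of _ "ereal r"]\<close>)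
      then show ?thesis ..
    next
      case 3
      have "\<forall>\<^sub>F s in at_right r. w s = 0"
        using i l by eventually_elim (use 3 in \<open>auto intro!: tight2 intro: le_less_trans[of _ "ereal r"]\<close>)
      then show ?thesis ..
    qed
  qed
  have a2_free: "(\<forall>\<^sub>F s in f. w s < 0) \<Longrightarrow> (\<forall>\<^sub>F s in f. 0 < s) \<Longrightarrow> \<forall>\<^sub>F s in f. accel_free s = a2 s" for f
    by (erule (1) eventually_elim2) (simp add: a2_def)
  have a2_tight: "(\<forall>\<^sub>F s in f. w s = 0) \<Longrightarrow> (\<forall>\<^sub>F s in f. 0 < s) \<Longrightarrow> \<forall>\<^sub>F s in f. accel_tight s = a2 s" for f
    by (erule (1) eventually_elim2) (simp add: a2_def)
  have pos: "\<forall>\<^sub>F s in nhds r. 0 < s" if "0 < r" for r :: real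
    using that eventually_nhds_in_open[of "{0<..}" r] by auto
  have deriv: "(v has_real_derivative a2 r) (at r)" "accel_free r = a2 r \<and> w r < 0 \<or> (w r = 0 \<and> a2 r \<le> v r / r)"
    if r: "r \<in> radii R" "0 < r" "r \<notin> E" for r
  proof -
    have "(v has_real_derivative a2 r) (at r) \<and> (accel_free r = a2 r \<and> w r < 0 \<or> (w r = 0 \<and> a2 r \<le> v r / r))"
      using alt[OF r]
    proof
      assume t: "\<forall>\<^sub>F s in nhds r. w s = 0"
      then have "w r = 0" by (rule eventually_nhds_x_imp_x)
      then show ?thesis using v_deriv_tight[OF r(1,2) t] r by (simp add: a2_def)
    next
      assume t: "\<forall>\<^sub>F s in nhds r. w s < 0"
      then have "w r < 0" by (rule eventually_nhds_x_imp_x)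
      then show ?thesis using v_deriv_free[OF r(1,2) t] r by (simp add: a2_def accel_free_def)
    qed
    then show "(v has_real_derivative a2 r) (at r)" "accel_free r = a2 r \<and> w r < 0 \<or> (w r = 0 \<and> a2 r \<le> v r / r)"
      by auto
  qed
  have cont_a2: "isCont a2 r" if r: "r \<in> radii R" "0 < r" "r \<notin> E" for r
    using alt[OF r]
  proof
    assume t: "\<forall>\<^sub>F s in nhds r. w s = 0"
    show ?thesis using isCont_cong[OF a2_tight[OF t pos[OF r(2)]]] isCont_accel[OF r(1,2)] by simp
  next
    assume t: "\<forall>\<^sub>F s in nhds r. w s < 0"
    show ?thesis using isCont_cong[OF a2_free[OF t pos[OF r(2)]]] isCont_accel[OF r(1,2)] by simp
  qed
  have at0: "at 0 within radii R = at_right 0"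
    unfolding at_0_radii by (simp add: at_within_def atLeast_def greaterThan_def insert_Diff_if 
      flip: Diff_insert, rule arg_cong[where f = "\<lambda>A. inf (nhds 0) (principal A)"]) auto
  have lim_u0: "(u \<longlongrightarrow> u 0) (at_right 0)" and lim_v0: "(v \<longlongrightarrow> v 0) (at_right 0)"
    using continuous_u continuous_v 0 unfolding continuous_on_def at0[symmetric] by auto
  have isg: "isCont g x" "isCont g' x" for x
    using g cont_g' by (auto simp: continuous_on_eq_continuous_at)
  have lim_g: "((\<lambda>r. g (u r)) \<longlongrightarrow> g (u 0)) (at_right 0)" "((\<lambda>r. g' (u r)) \<longlongrightarrow> g' (u 0)) (at_right 0)"
    using isCont_tendsto_compose[OF isg(1) lim_u0] isCont_tendsto_compose[OF isg(2) lim_u0] by auto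
  have "((\<lambda>r. (v r - v 0) / (r - 0)) \<longlongrightarrow> - g (u 0) / k) (at_right 0)"
    using v_deriv_0 unfolding has_field_derivative_iff at0 by simp
  then have lim_vr: "((\<lambda>r. v r / r) \<longlongrightarrow> - g (u 0) / k) (at_right 0)" by (simp add: vel_0[OF k2])
  have "(accel_tight \<longlongrightarrow> - g (u 0) / k - 0 * (g' (u 0) * v 0) / k) (at_right 0)"
    unfolding accel_tight_def[abs_def] using k_pos
    by (intro tendsto_diff tendsto_divide tendsto_minus tendsto_mult tendsto_const lim_g lim_v0 tendsto_ident_at) auto
  then have lim_tight: "(accel_tight \<longlongrightarrow> - g (u 0) / k) (at_right 0)" by simp
  have "(accel_free \<longlongrightarrow> - (real k - 1) * (- g (u 0) / k) - g (u 0)) (at_right 0)"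
    unfolding accel_free_def[abs_def]
    by (intro tendsto_diff tendsto_mult tendsto_const lim_g lim_vr)
  \<comment> \<open>The two accelerations have the same limit at \<open>0\<close>, so
    \<open>u''\<close> is continuous there whichever regime holds first.\<close>
  moreover have "- (real k - 1) * (- g (u 0) / k) - g (u 0) = - g (u 0) / k"
    using k_pos by (simp add: field_simps)
  ultimately have lim_free: "(accel_free \<longlongrightarrow> - g (u 0) / k) (at_right 0)" by simp
  have pos0: "\<forall>\<^sub>F s in at_right 0. (0::real) < s" by (simp add: eventually_at_filter)
  have lim_a2: "(a2 \<longlongrightarrow> a2 0) (at_right 0)"
    using right[OF 0]
  proof
    assume t: "\<forall>\<^sub>F s in at_right 0. w s = 0"
    show ?thesis using Lim_transform_eventually[OF lim_tight a2_tight[OF t pos0]] by (simp add: a2_def)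
  next
    assume t: "\<forall>\<^sub>F s in at_right 0. w s < 0"
    show ?thesis using Lim_transform_eventually[OF lim_free a2_free[OF t pos0]] by (simp add: a2_def)
  qed
  have "piecewise_C2 R E u v a2"
    unfolding piecewise_C2_def
  proof (intro conjI allI impI ballI)
    show "E \<subseteq> radii R - {0}" by (auto simp: E_def)
    show "finite (E \<inter> {0..\<rho>})" for \<rho> using finE by simp
    show "(u has_real_derivative v r) (at r within radii R)" if "r \<in> radii R" for r
      by (rule u_deriv[OF that])
    show "continuous_on (radii R) v" by (rule continuous_v)
    show "(v has_real_derivative a2 r) (at r within radii R)" if r: "r \<in> radii R - E" for r
    proof (cases "r = 0")
      case True then show ?thesis using v_deriv_0 by (simp add: a2_def)
    next
      case False
      then have "0 < r" using r by (simp add: radii_def)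
      then show ?thesis using deriv(1)[of r] r by (simp add: has_field_derivative_at_within)
    qed
    show "continuous_on (radii R - E) a2"
      unfolding continuous_on_def
    proof
      fix r assume r: "r \<in> radii R - E"
      show "(a2 \<longlongrightarrow> a2 r) (at r within radii R - E)"
      proof (cases "r = 0")
        case True
        have "at r within radii R - E \<le> at_right 0" unfolding True at0[symmetric] by (rule at_le) auto
        then show ?thesis using tendsto_mono[OF _ lim_a2] True by blast
      next
        case False
        then have "0 < r" using r by (simp add: radii_def)
        then show ?thesis using cont_a2[of r] r tendsto_within_subset[of a2 _ r UNIV] by (auto simp: isCont_def)
      qed
    qed
    fix e assume "e \<in> E"
    then have e: "e \<in> radii R" "0 < e" by (auto simp: E_def)
    have lim: "(accel_tight \<longlongrightarrow> accel_tight e) (at e within S)" "(accel_free \<longlongrightarrow> accel_free e) (at e within S)" for S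
      using isCont_accel[OF e] tendsto_within_subset[of _ _ e UNIV] unfolding isCont_def by auto
    have pe: "\<forall>\<^sub>F s in at e within S. 0 < s" for S
      using pos[OF e(2)] by (simp add: eventually_at_filter eventually_mono)
    show "\<exists>l. (a2 \<longlongrightarrow> l) (at_left e)"
      using left[OF e]
    proof
      assume t: "\<forall>\<^sub>F s in at_left e. w s = 0"
      show ?thesis using Lim_transform_eventually[OF lim(1) a2_tight[OF t pe]] by blast
    next
      assume t: "\<forall>\<^sub>F s in at_left e. w s < 0"
      show ?thesis using Lim_transform_eventually[OF lim(2) a2_free[OF t pe]] by blast
    qed
    show "\<exists>l. (a2 \<longlongrightarrow> l) (at_right e)"
      using right[OF e(1)]
    proof
      assume t: "\<forall>\<^sub>F s in at_right e. w s = 0"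
      show ?thesis using Lim_transform_eventually[OF lim(1) a2_tight[OF t pe]] by blast
    next
      assume t: "\<forall>\<^sub>F s in at_right e. w s < 0"
      show ?thesis using Lim_transform_eventually[OF lim(2) a2_free[OF t pe]] by blast
    qed
  qed
  moreover have "truncated_laplacian k (\<lambda>y. u (norm y)) x + g (u (norm x)) = 0"
    if x: "ereal (norm x) < R" "norm x \<notin> E" for x :: "real ^ 'n"
  proof -
    have xR: "norm x \<in> radii R" using x by (simp add: radii_def)
    obtain c where c: "norm x < c" "c \<in> radii R" using radii_extend[OF xR] by blast
    have uc: "(u has_real_derivative v s) (at s)" if "0 < s" "s < c" for s
      by (rule u_deriv'[OF radii_le[OF c(2)]]) (use that in auto)
    show ?thesis
    proof (cases "x = 0")
      case True
      have "truncated_laplacian k (\<lambda>y. u (norm y)) (0 :: real ^ 'n) = real k * (- g (u 0) / k)"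
      proof (rule truncated_laplacian_radial_0[where e = c and v = v])
        show "(u has_real_derivative 0) (at 0 within {0..})"
          using u_deriv[OF 0] by (simp add: at_0_radii vel_0[OF k2])
        show "(v has_real_derivative - g (u 0) / k) (at 0 within {0..})"
          using v_deriv_0 by (simp add: at_0_radii)
      qed (use k2 kN c True uc in \<open>auto simp: vel_0[OF k2]\<close>)
      then show ?thesis using True k_pos by simp
    next
      case False
      then have r: "0 < norm x" by simp
      have tl: "truncated_laplacian k (\<lambda>y. u (norm y)) x
          = (real k - 1) * (v (norm x) / norm x) + max (a2 (norm x)) (v (norm x) / norm x)"
      proof (rule radial_equation_iff[where e = "min (norm x) (c - norm x)"])
        fix s assume "\<bar>s - norm x\<bar> < min (norm x) (c - norm x)"
        then show "(u has_real_derivative v s) (at s)" by (intro uc) auto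
      qed (use k2 kN False c deriv(1)[OF xR r x(2)] in auto)
      show ?thesis using deriv(2)[OF xR r x(2)]
      proof
        assume *: "accel_free (norm x) = a2 (norm x) \<and> w (norm x) < 0"
        define X where "X = v (norm x) / norm x"
        \<comment> \<open>\<open>w < 0\<close> means \<open>k * X < - g(u)\<close>, which is the
          same as \<open>X < - (k - 1) * X - g(u)\<close>: in the free regime the maximum selects
          \<open>u''\<close>.\<close>
        have "real k * X < - g (u (norm x))"
          using * r k_pos by (simp add: X_def field_simps)
        then have "X \<le> accel_free (norm x)"
          by (simp add: accel_free_def algebra_simps flip: X_def)
        then have "v (norm x) / norm x \<le> accel_free (norm x)" by (simp add: X_def)
        then have "truncated_laplacian k (\<lambda>y. u (norm y)) x = (real k - 1) * X + accel_free (norm x)"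
          using tl * by (simp add: X_def)
        then show ?thesis by (simp add: accel_free_def algebra_simps flip: X_def)
      next
        assume *: "w (norm x) = 0 \<and> a2 (norm x) \<le> v (norm x) / norm x"
        define X where "X = v (norm x) / norm x"
        have "real k * X = - g (u (norm x))"
          using * r k_pos by (simp add: X_def field_simps)
        moreover have "truncated_laplacian k (\<lambda>y. u (norm y)) x = (real k - 1) * X + X"
          using tl * by (simp add: X_def)
        ultimately show ?thesis by (simp add: algebra_simps)
      qed
    qed
  qed
  moreover have "filterlim (\<lambda>r. \<bar>u r\<bar> + \<bar>v r\<bar>) at_top (at_left (real_of_ereal R))" if "R \<noteq> \<infinity>"
    by (rule filterlim_at_top_mono[OF blow[OF that]]) simp
  ultimately show ?thesis
    unfolding radial_solution_def using R_pos vel_0[OF k2] by blast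
qed

end

section \<open>Bistable nonlinearities\<close>

lemma decreasing_limit:
  fixes f :: "real \<Rightarrow> real"
  assumes "\<And>x y. c \<le> x \<Longrightarrow> x \<le> y \<Longrightarrow> f y \<le> f x" "\<And>x. c \<le> x \<Longrightarrow> B \<le> f x"
  obtains l where "B \<le> l" "(f \<longlongrightarrow> l) at_top" "\<And>x. c \<le> x \<Longrightarrow> l \<le> f x"
proof
  let ?l = "INF x\<in>{c..}. f x"
  have bdd: "bdd_below (f ` {c..})" using assms(2) by (auto simp: bdd_below_def)
  show "B \<le> ?l" by (rule cINF_greatest) (use assms(2) in auto)
  show le: "?l \<le> f x" if "c \<le> x" for x by (rule cINF_lower[OF bdd]) (use that in auto)
  show "(f \<longlongrightarrow> ?l) at_top"
  proof (rule order_tendstoI)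
    fix y assume "y < ?l"
    then show "\<forall>\<^sub>F x in at_top. y < f x"
      using le by (auto intro!: eventually_at_top_linorderI[of c] intro: less_le_trans)
  next
    fix y assume "?l < y"
    then obtain z where z: "c \<le> z" "f z < y" using cINF_less_iff[OF _ bdd, of y] by auto
    then show "\<forall>\<^sub>F x in at_top. f x < y"
      using assms(1) by (intro eventually_at_top_linorderI[of z]) (meson le_less_trans)
  qed
qed

text \<open>Composition with \<open>real_of_ereal\<close> lets the single filter
  \<open>at_left R\<close> serve for finite and infinite \<open>R\<close>.\<close>

lemma filterlim_at_bot_at_left_ereal:
  fixes f :: "real \<Rightarrow> real"
  assumes "\<And>x y. c \<le> x \<Longrightarrow> x \<le> y \<Longrightarrow> y \<in> radii R \<Longrightarrow> f y \<le> f x"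
    and "\<And>N. \<exists>r\<in>radii R. c \<le> r \<and> f r \<le> N"
  shows "filterlim (f \<circ> real_of_ereal) at_bot (at_left R)"
  unfolding filterlim_at_bot
proof
  fix Z
  obtain r where r: "r \<in> radii R" "c \<le> r" "f r \<le> Z" using assms(2) by blast
  have "ereal r < R" using r by (simp add: radii_def)
  moreover have "(f \<circ> real_of_ereal) y \<le> Z" if "ereal r < y" "y < R" for y
  proof -
    obtain s where s: "y = ereal s" "r < s" using \<open>ereal r < y\<close> \<open>y < R\<close> by (cases y) auto
    have "s \<in> radii R" using s that r by (auto simp: radii_def)
    then show ?thesis using assms(1)[of r s] r s by auto
  qed
  ultimately show "\<forall>\<^sub>F x in at_left R. (f \<circ> real_of_ereal) x \<le> Z"
    unfolding eventually_at_left[OF \<open>ereal r < R\<close>] by blast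
qed

lemma filterlim_at_top_at_left_ereal:
  fixes f :: "real \<Rightarrow> real"
  assumes "\<And>x y. c \<le> x \<Longrightarrow> x \<le> y \<Longrightarrow> y \<in> radii R \<Longrightarrow> f x \<le> f y"
    and "\<And>N. \<exists>r\<in>radii R. c \<le> r \<and> N \<le> f r"
  shows "filterlim (f \<circ> real_of_ereal) at_top (at_left R)"
proof -
  have "filterlim ((\<lambda>x. - f x) \<circ> real_of_ereal) at_bot (at_left R)"
  proof (rule filterlim_at_bot_at_left_ereal[of c])
    show "\<exists>r\<in>radii R. c \<le> r \<and> - f r \<le> N" for N
      using assms(2)[of "- N"] by (auto simp: minus_le_iff)
  qed (use assms(1) in auto)
  then show ?thesis by (subst filterlim_uminus_at_top) (simp add: comp_def)
qed

section \<open>Shape of the bistable nonlinearity\<close>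

locale bistable_reaction =
  fixes k :: nat and \<alpha> \<beta> :: real and g :: "real \<Rightarrow> real"
  assumes k2': "2 \<le> k" and bistable: "bistable \<alpha> \<beta> g"
begin

lemma \<beta>_pos: "0 < \<beta>" and \<beta>_less: "\<beta> < \<alpha>" and \<alpha>_pos: "0 < \<alpha>"
  using bistable by (auto simp: bistable_def)

lemma g_odd: "g (- s) = - g s"
  using bistable by (simp add: bistable_def)

lemma g_deriv: "(g has_real_derivative deriv g x) (at x)"
proof -
  have "g differentiable at x"
    using bistable by (auto simp: bistable_def C1_differentiable_on_eq)
  then show ?thesis by (simp add: DERIV_deriv_iff_real_differentiable)
qed

lemma continuous_deriv: "continuous_on UNIV (deriv g)"
proof -
  have "vector_derivative g (at x) = deriv g x" for x
    using g_deriv by (intro vector_derivative_at) (simp flip: has_real_derivative_iff_has_vector_derivative)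
  then show ?thesis using bistable by (simp add: bistable_def C1_differentiable_on_eq)
qed

lemma continuous_g: "continuous_on S g"
  using g_deriv DERIV_continuous_on by (metis has_field_derivative_at_within)

lemma deriv_even: "deriv g (- s) = deriv g s"
proof -
  have "((\<lambda>x. g (- x)) has_real_derivative deriv g (- s) * (- 1)) (at s)"
    by (rule DERIV_chain2[OF g_deriv]) (auto intro!: derivative_eq_intros)
  moreover have "(\<lambda>x. g (- x)) = (\<lambda>x. - g x)" using g_odd by auto
  ultimately have "((\<lambda>x. - g x) has_real_derivative - deriv g (- s)) (at s)" by simp
  from DERIV_unique[OF this DERIV_minus[OF g_deriv]] show ?thesis by simp
qed

lemma g_0 [simp]: "g 0 = 0"
  using g_odd[of 0] by simp

lemma g_pos: "0 < s \<Longrightarrow> s < \<alpha> \<Longrightarrow> 0 < g s" and g_neg: "\<alpha> < s \<Longrightarrow> g s < 0"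
  using bistable by (auto simp: bistable_def)

lemma g_\<alpha> [simp]: "g \<alpha> = 0"
proof (rule antisym)
  have c: "(g \<longlongrightarrow> g \<alpha>) (at \<alpha>)" using g_deriv DERIV_isCont isCont_def by blast
  then have "(g \<longlongrightarrow> g \<alpha>) (at_left \<alpha>)" "(g \<longlongrightarrow> g \<alpha>) (at_right \<alpha>)"
    by (simp_all add: filterlim_at_split)
  moreover have "\<forall>\<^sub>F x in at_left \<alpha>. 0 \<le> g x"
    using eventually_at_left_real[OF \<alpha>_pos] by eventually_elim (use g_pos in \<open>auto intro: less_imp_le\<close>)
  moreover have "\<forall>\<^sub>F x in at_right \<alpha>. g x \<le> 0"
    using eventually_at_right_real[of \<alpha> "\<alpha> + 1"] by (auto elim!: eventually_mono intro!: less_imp_le g_neg)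
  ultimately show "g \<alpha> \<le> 0" "0 \<le> g \<alpha>"
    using tendsto_upperbound[of g "g \<alpha>" "at_right \<alpha>" 0] tendsto_lowerbound[of g "g \<alpha>" "at_left \<alpha>" 0] by auto
qed

lemma g_m\<alpha> [simp]: "g (- \<alpha>) = 0"
  by (simp add: g_odd)

lemma g_neg': "- \<alpha> < s \<Longrightarrow> s < 0 \<Longrightarrow> g s < 0" and g_pos': "s < - \<alpha> \<Longrightarrow> 0 < g s"
  using g_pos[of "- s"] g_neg[of "- s"] g_odd[of s] by auto

lemma g_nonneg: "0 \<le> s \<Longrightarrow> s \<le> \<alpha> \<Longrightarrow> 0 \<le> g s"
  using g_pos[of s] by (cases "s = 0 \<or> s = \<alpha>") (auto simp: less_le)

lemma g_nonpos: "- \<alpha> \<le> s \<Longrightarrow> s \<le> 0 \<Longrightarrow> g s \<le> 0"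
  using g_nonneg[of "- s"] g_odd[of s] by auto

lemma deriv_pos: "- \<beta> < s \<Longrightarrow> s < \<beta> \<Longrightarrow> 0 < deriv g s"
proof -
  have "0 < deriv g s" if "0 \<le> s" "s < \<beta>" for s
    using bistable that by (auto simp: bistable_def)
  from this[of s] this[of "- s"] show "- \<beta> < s \<Longrightarrow> s < \<beta> \<Longrightarrow> 0 < deriv g s"
    by (cases "0 \<le> s") (auto simp: deriv_even)
qed

lemma deriv_neg: "\<beta> < \<bar>s\<bar> \<Longrightarrow> deriv g s < 0"
proof -
  have "deriv g s < 0" if "\<beta> < s" for s
    using bistable that by (auto simp: bistable_def)
  from this[of s] this[of "- s"] show "\<beta> < \<bar>s\<bar> \<Longrightarrow> deriv g s < 0"
    by (cases "0 \<le> s") (auto simp: deriv_even)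
qed

lemma g_le_\<beta>: "0 \<le> s \<Longrightarrow> g s \<le> g \<beta>"
proof -
  assume "0 \<le> s"
  show ?thesis
  proof (cases "s \<le> \<beta>")
    case True
    show ?thesis
      by (rule mono_from_derivative[OF True continuous_g g_deriv])
        (use deriv_pos \<open>0 \<le> s\<close> \<beta>_pos in \<open>auto intro: less_imp_le\<close>)
  next
    case False
    have "- g \<beta> \<le> - g s"
      by (rule mono_from_derivative[where f = "\<lambda>x. - g x" and f' = "\<lambda>x. - deriv g x"])
        (use False deriv_neg \<beta>_pos in \<open>auto intro!: continuous_intros continuous_g DERIV_minus g_deriv less_imp_le\<close>)
    then show ?thesis by simp
  qed
qed

lemma g_ge_m\<beta>: "- \<alpha> \<le> s \<Longrightarrow> s \<le> \<alpha> \<Longrightarrow> - g \<beta> \<le> g s"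
  using g_le_\<beta>[of "- s"] g_odd[of s] g_nonneg[of s] g_le_\<beta>[of 0] by (cases "0 \<le> s") auto

lemma g_min:
  assumes "a \<le> b" obtains m where "m \<in> {a..b}" "\<And>t. t \<in> {a..b} \<Longrightarrow> g m \<le> g t"
  using continuous_attains_inf[OF compact_Icc _ continuous_g, of a b] assms by auto

lemma g_max:
  assumes "a \<le> b" obtains m where "m \<in> {a..b}" "\<And>t. t \<in> {a..b} \<Longrightarrow> g t \<le> g m"
  using continuous_attains_sup[OF compact_Icc _ continuous_g, of a b] assms by auto

sublocale reaction k g
proof
  show "2 \<le> k" by (rule k2')
  show "continuous_on UNIV g" by (rule continuous_g)
  fix M :: real
  show "\<exists>L>0. \<forall>x\<in>{-M..M}. \<forall>y\<in>{-M..M}. \<bar>g x - g y\<bar> \<le> L * \<bar>x - y\<bar>"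
  proof -
    have "bounded (deriv g ` {-M..M})"
      by (intro compact_imp_bounded compact_continuous_image continuous_on_subset[OF continuous_deriv]) auto
    then obtain L where L: "0 < L" "\<forall>y\<in>deriv g ` {-M..M}. norm y \<le> L" unfolding bounded_pos by blast
    have "norm (g x - g y) \<le> L * norm (x - y)" if "x \<in> {-M..M}" "y \<in> {-M..M}" for x y
      by (rule field_differentiable_bound[of "{-M..M}"])
        (use that L in \<open>auto intro: has_field_derivative_at_within g_deriv\<close>)
    then show ?thesis using L(1) by auto
  qed
qed

lemma constant_max_solution:
  assumes "g z = 0" shows "max_solution k g \<infinity> (\<lambda>_. z)"
proof -
  have "evolves k g (radii \<infinity>) (\<lambda>_. z)"
    unfolding evolves_def using assms by (auto simp: vel_const[OF k2'] radii_def)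
  then show ?thesis by (simp add: max_solution_def)
qed

end

section \<open>Solutions starting below or above the zeros of \<open>g\<close>, and recovery from
  negative values\<close>

locale bistable_trajectory = bistable_reaction +
  fixes R :: ereal and u :: "real \<Rightarrow> real"
  assumes max_sol: "max_solution k g R u"
begin

sublocale smooth_trajectory k g R u "deriv g"
  by unfold_locales (use max_solutionD[OF max_sol] g_deriv continuous_deriv in auto)

lemma zero_radii: "0 \<in> radii R"
  using R_pos by (simp add: radii_def zero_ereal_def)

lemma radii_infinity: "R = \<infinity> \<Longrightarrow> r \<in> radii R \<longleftrightarrow> 0 \<le> r"
  by (auto simp: radii_def)

lemma deriv_u: "r \<in> radii R \<Longrightarrow> 0 < r \<Longrightarrow> deriv u r = v r"
  by (rule DERIV_imp_deriv[OF u_deriv'])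

lemma u_slope_le:
  assumes "b \<in> radii R" "0 \<le> a" "a \<le> b" "\<And>r. a < r \<Longrightarrow> r < b \<Longrightarrow> v r \<le> s"
  shows "u b \<le> u a + s * (b - a)"
proof -
  have "s * a - u a \<le> s * b - u b"
  proof (rule mono_from_derivative[where f = "\<lambda>x. s * x - u x"])
    show "continuous_on {a..b} (\<lambda>x. s * x - u x)"
      by (intro continuous_intros continuous_u' assms)
    show "((\<lambda>x. s * x - u x) has_real_derivative s - v r) (at r)" if "a < r" "r < b" for r
      using that assms by (auto intro!: derivative_eq_intros u_deriv' intro: radii_le)
  qed (use assms in auto)
  then show ?thesis by (simp add: algebra_simps)
qed

lemma u_slope_ge:
  assumes "b \<in> radii R" "0 \<le> a" "a \<le> b" "\<And>r. a < r \<Longrightarrow> r < b \<Longrightarrow> s \<le> v r"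
  shows "u a + s * (b - a) \<le> u b"
proof -
  have "u a - s * a \<le> u b - s * b"
  proof (rule mono_from_derivative[where f = "\<lambda>x. u x - s * x"])
    show "continuous_on {a..b} (\<lambda>x. u x - s * x)"
      by (intro continuous_intros continuous_u' assms)
    show "((\<lambda>x. u x - s * x) has_real_derivative v r - s) (at r)" if "a < r" "r < b" for r
      using that assms by (auto intro!: derivative_eq_intros u_deriv' intro: radii_le)
  qed (use assms in auto)
  then show ?thesis by (simp add: algebra_simps)
qed

lemma u_strict_dec:
  assumes "b \<in> radii R" "0 \<le> a" "a < b" "\<And>r. a < r \<Longrightarrow> r < b \<Longrightarrow> v r < 0"
  shows "u b < u a"
proof -
  have "- u a < - u b"
  proof (rule strict_mono_from_derivative[where f = "\<lambda>x. - u x", OF assms(3)])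
    show "continuous_on {a..b} (\<lambda>x. - u x)"
      by (intro continuous_intros continuous_u' assms)
    show "((\<lambda>x. - u x) has_real_derivative - v r) (at r)" if "a < r" "r < b" for r
      using that assms by (auto intro!: derivative_eq_intros u_deriv' intro: radii_le)
  qed (use assms in auto)
  then show ?thesis by simp
qed

lemma bounded_imp_global:
  assumes "c \<in> radii R" "\<And>r. r \<in> radii R \<Longrightarrow> c \<le> r \<Longrightarrow> \<bar>u r\<bar> \<le> N"
  shows "R = \<infinity>"
proof (rule ccontr)
  assume "R \<noteq> \<infinity>"
  obtain N' where N': "\<And>r. r \<in> {0..c} \<Longrightarrow> \<bar>u r\<bar> \<le> N'"
    using evolves_bound[OF evolves_subset[OF k2 evolves], of c] radii_down[OF assms(1)] by metis
  have "\<bar>u r\<bar> \<le> max N N'" if "r \<in> radii R" for r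
    using assms(2)[OF that] N'[of r] radii_down[OF that] by (cases "c \<le> r") auto
  then have "bounded (u ` radii R)" by (auto simp: bounded_iff)
  then show False using max_solutionD(3)[OF max_sol] \<open>R \<noteq> \<infinity>\<close> by blast
qed

lemma v_neg_of_pos: "r \<in> radii R \<Longrightarrow> 0 < r \<Longrightarrow> 0 < g (u r) \<Longrightarrow> v r < 0"
  using w_le[of r] k_pos by (smt (verit) divide_pos_pos mult_pos_pos)

text \<open>Tight motion under a nonpositive reaction has \<open>v = - r * g(u) / k \<ge> 0\<close>,
  so a descending one must be free.\<close>

lemma w_neg_of_neg: "r \<in> radii R \<Longrightarrow> 0 < r \<Longrightarrow> v r < 0 \<Longrightarrow> g (u r) \<le> 0 \<Longrightarrow> w r < 0"
  using k_pos by (smt (verit) divide_nonpos_pos mult_nonneg_nonpos)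

lemma tight_0: "M 0 = \<phi> 0"
  using w_eq[of 0] k2 by simp

text \<open>Beyond \<open>c\<close> the sign condition makes tightness permanent, so
  \<open>b\<close> is the infimum of all contact radii from \<open>c\<close> on. If there is no
  contact, the infimum of the empty set is \<infinity> and the motion stays free.\<close>

lemma phase_tail:
  fixes a c :: real
  assumes "a \<le> c" "0 \<le> a"
    and free: "\<And>r. r \<in> radii R \<Longrightarrow> a < r \<Longrightarrow> r \<le> c \<Longrightarrow> w r < 0"
    and sgn: "\<And>r. r \<in> radii R \<Longrightarrow> c < r \<Longrightarrow> 0 \<le> deriv g (u r) * v r"
  obtains b :: ereal where "a \<le> b" "\<And>r. r \<in> radii R \<Longrightarrow> a < r \<Longrightarrow> r < b \<Longrightarrow> w r < 0"
    "\<And>r. r \<in> radii R \<Longrightarrow> b < r \<Longrightarrow> w r = 0"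
proof
  define S where "S = {r \<in> radii R. c \<le> r \<and> M r = \<phi> r}"
  let ?b = "INF r\<in>S. ereal r"
  show "ereal a \<le> ?b" by (rule INF_greatest) (use \<open>a \<le> c\<close> in \<open>auto simp: S_def\<close>)
  show "w r < 0" if "r \<in> radii R" "a < r" "r < ?b" for r
  proof (cases "r \<le> c")
    case False
    have "r \<notin> S"
    proof
      assume "r \<in> S"
      then have "?b \<le> ereal r" by (rule INF_lower)
      then show False using that by simp
    qed
    then have "M r \<noteq> \<phi> r" using that False by (auto simp: S_def)
    then show ?thesis using w_zero_iff[of r] w_le[OF that(1)] that \<open>0 \<le> a\<close> by auto
  qed (use free that in auto)
  show "w r = 0" if r: "r \<in> radii R" "?b < r" for r
  proof -
    obtain s where s: "s \<in> S" "s < r" using r(2) unfolding INF_less_iff by auto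
    have "M r = \<phi> r"
      by (rule tight_persists[OF r(1), of s])
        (use s \<open>0 \<le> a\<close> \<open>a \<le> c\<close> r(1) in \<open>auto simp: S_def intro!: sgn intro: radii_le\<close>)
    then show ?thesis using w_zero_iff[of r] s \<open>0 \<le> a\<close> \<open>a \<le> c\<close> by (auto simp: S_def)
  qed
qed

text \<open>The barrier keeps \<open>u\<close> below \<open>- \<alpha>\<close>, where
  \<open>g > 0\<close> forces \<open>v < 0\<close>. If \<open>u\<close> stayed above some
  \<open>N\<close>, then it would be global and \<open>g(u)\<close> bounded below by a positive
  constant, so that \<open>u\<close> would fall at least linearly.\<close>

lemma descent:
  assumes a: "a \<in> radii R" "u a < - \<alpha>"
  shows "\<And>r. r \<in> radii R \<Longrightarrow> a \<le> r \<Longrightarrow> u r < - \<alpha>"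
    and "\<And>r. r \<in> radii R \<Longrightarrow> a \<le> r \<Longrightarrow> 0 < r \<Longrightarrow> v r < 0"
    and "filterlim (u \<circ> real_of_ereal) at_bot (at_left R)"
proof -
  have a0: "0 \<le> a" using a by (simp add: radii_def)
  show below: "u r < - \<alpha>" if "r \<in> radii R" "a \<le> r" for r
    using barrier[OF that(1) a0 that(2) g_m\<alpha> a(2)] .
  show neg: "v r < 0" if "r \<in> radii R" "a \<le> r" "0 < r" for r
    using v_neg_of_pos[OF that(1,3)] below[OF that(1,2)] g_pos' by blast
  have dec: "u y \<le> u x" if "a \<le> x" "x \<le> y" "y \<in> radii R" for x y
  proof -
    have "v r \<le> 0" if "x < r" "r < y" for r
      using neg[of r] radii_le[OF \<open>y \<in> radii R\<close>, of r] that \<open>a \<le> x\<close> a0 by auto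
    then show ?thesis using u_slope_le[of y x 0] that a0 by auto
  qed
  have "\<exists>r\<in>radii R. a \<le> r \<and> u r \<le> N" for N
  proof (rule ccontr)
    assume "\<not> (\<exists>r\<in>radii R. a \<le> r \<and> u r \<le> N)"
    then have N: "N < u r" if "r \<in> radii R" "a \<le> r" for r using that by force
    have "R = \<infinity>"
    proof (rule bounded_imp_global[OF a(1)])
      fix r assume "r \<in> radii R" "a \<le> r"
      then show "\<bar>u r\<bar> \<le> \<bar>N\<bar> + \<bar>u a\<bar>" using N[of r] dec[of a r] by auto
    qed
    note inR = radii_infinity[OF this]
    have "N \<le> u a" using N[of a] a by simp
    obtain m where m: "m \<in> {N..u a}" "\<And>t. t \<in> {N..u a} \<Longrightarrow> g m \<le> g t"
      using g_min[OF \<open>N \<le> u a\<close>] by blast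
    have "0 < g m" using m(1) a(2) by (intro g_pos') auto
    \<comment> \<open>Radii beyond \<open>1\<close> allow the factor \<open>r\<close> in
      \<open>v \<le> - r * g(u) / k\<close> to be dropped.\<close>
    define b where "b = max a 1"
    have "v r \<le> - g m / k" if "b < r" for r
    proof -
      have r: "r \<in> radii R" "a \<le> r" "1 \<le> r" using that a0 by (auto simp: inR b_def)
      have "g m \<le> g (u r)" using N[OF r(1,2)] dec[of a r] r by (intro m(2)) auto
      then have "1 * g m \<le> r * g (u r)" using r \<open>0 < g m\<close> by (intro mult_mono) auto
      then have "g m / k \<le> r * g (u r) / k" by (intro divide_right_mono) auto
      then show ?thesis using w_le[OF r(1)] by simp
    qed
    then have slope: "u r \<le> u b + (- g m / k) * (r - b)" if "b \<le> r" for r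
      using that by (intro u_slope_le) (auto simp: inR b_def)
    define r where "r = b + (u b - N) * k / g m"
    have "N < u b" by (rule N) (auto simp: inR b_def)
    then have "b \<le> r" using \<open>0 < g m\<close> by (simp add: r_def)
    have "u r \<le> N" using slope[OF \<open>b \<le> r\<close>] \<open>0 < g m\<close> k_pos by (simp add: r_def)
    then show False using N[of r] \<open>b \<le> r\<close> by (auto simp: inR b_def)
  qed
  then show "filterlim (u \<circ> real_of_ereal) at_bot (at_left R)"
    by (intro filterlim_at_bot_at_left_ereal[of a] dec)
qed

lemma at_bot_abs_at_top:
  assumes "filterlim (u \<circ> real_of_ereal) at_bot (at_left R)" "R \<noteq> \<infinity>"
  shows "filterlim (\<lambda>r. \<bar>u r\<bar>) at_top (at_left (real_of_ereal R))"
proof -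
  obtain b where b: "R = ereal b" using assms(2) R_pos by (cases R) auto
  have "filterlim u at_bot (at_left b)"
    using assms(1) unfolding b at_left_ereal filterlim_filtermap by (simp add: comp_def)
  then have "filterlim (\<lambda>r. - u r) at_top (at_left b)"
    by (simp add: filterlim_uminus_at_bot)
  then show ?thesis unfolding b
    by (auto elim!: filterlim_at_top_mono intro!: always_eventually)
qed

lemma at_top_abs_at_top:
  assumes "filterlim (u \<circ> real_of_ereal) at_top (at_left R)" "R \<noteq> \<infinity>"
  shows "filterlim (\<lambda>r. \<bar>u r\<bar>) at_top (at_left (real_of_ereal R))"
proof -
  obtain b where b: "R = ereal b" using assms(2) R_pos by (cases R) auto
  have "filterlim u at_top (at_left b)"
    using assms(1) unfolding b at_left_ereal filterlim_filtermap by (simp add: comp_def)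
  then show ?thesis unfolding b
    by (auto elim!: filterlim_at_top_mono intro!: always_eventually)
qed

lemma below_minus_\<alpha>:
  assumes "u 0 < - \<alpha>"
  shows "\<And>r. r \<in> radii R \<Longrightarrow> 0 < r \<Longrightarrow> v r < 0"
    and "filterlim (u \<circ> real_of_ereal) at_bot (at_left R)" and switching
proof -
  note d = descent[OF zero_radii assms]
  show neg: "\<And>r. r \<in> radii R \<Longrightarrow> 0 < r \<Longrightarrow> v r < 0" using d(2) by auto
  show "filterlim (u \<circ> real_of_ereal) at_bot (at_left R)" by (rule d(3))
  obtain b :: ereal where "ereal 0 \<le> b" "\<And>r. r \<in> radii R \<Longrightarrow> 0 < r \<Longrightarrow> r < b \<Longrightarrow> w r < 0"
    "\<And>r. r \<in> radii R \<Longrightarrow> b < r \<Longrightarrow> w r = 0"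
  proof (rule phase_tail[of 0 0])
    fix r assume r: "r \<in> radii R" "0 < r"
    then have "deriv g (u r) < 0" using d(1)[of r] \<beta>_less \<beta>_pos by (intro deriv_neg) auto
    then show "0 \<le> deriv g (u r) * v r" using neg[OF r] by (simp add: mult_nonpos_nonpos)
  qed auto
  then show switching unfolding switching_def
    by (intro exI[of _ "ereal 0"] exI[of _ b]) auto
qed

text \<open>The pointwise bound on \<open>v\<close> is only an upper one, so growth is obtained from
  the momentum. As \<open>g'(u) < 0 < u'\<close>, the motion is free from the start.\<close>

lemma above_\<alpha>:
  assumes "\<alpha> < u 0"
  shows "\<And>r. r \<in> radii R \<Longrightarrow> 0 < r \<Longrightarrow> 0 < v r"
    and "filterlim (u \<circ> real_of_ereal) at_top (at_left R)" and switching
proof -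
  have above: "\<alpha> < u r" if r: "r \<in> radii R" for r
  proof (rule ccontr)
    assume le: "\<not> \<alpha> < u r"
    have "continuous_on {0..r} (\<lambda>t. - u t)"
      by (intro continuous_on_minus continuous_u' r order_refl)
    from first_hit[OF this, of "- \<alpha>"] le assms radii_down[OF r]
    obtain c where c: "0 < c" "c \<le> r" "- u c = - \<alpha>" "\<And>t. 0 \<le> t \<Longrightarrow> t < c \<Longrightarrow> - u t < - \<alpha>"
      by (metis neg_less_iff_less neg_le_iff_le not_less)
    have cR: "c \<in> radii R" using radii_le[OF r] c by auto
    have g: "g (u t) \<le> 0" if "0 \<le> t" "t \<le> c" for t
      using c(3) c(4)[of t] that g_neg[of "u t"] by (cases "t = c") auto
    have "0 \<le> v t" if "0 < t" "t < c" for t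
      by (rule v_nonneg[OF radii_le[OF cR] order_refl]) (use that g vel_0[OF k2] in auto)
    then have "u 0 + 0 * (c - 0) \<le> u c" using c cR by (intro u_slope_ge) auto
    then show False using assms c by simp
  qed
  show pos: "0 < v r" if r: "r \<in> radii R" "0 < r" for r
    by (rule v_pos[OF r(1) order_refl r(2)])
      (use r vel_0[OF k2] above in \<open>auto intro!: g_neg intro: radii_le\<close>)
  have inc: "u x \<le> u y" if "0 \<le> x" "x \<le> y" "y \<in> radii R" for x y
  proof -
    have "0 \<le> v r" if "x < r" "r < y" for r
      using pos[of r] radii_le[OF \<open>y \<in> radii R\<close>, of r] that \<open>0 \<le> x\<close> by auto
    then show ?thesis using u_slope_ge[of y x 0] that by auto
  qed
  have "\<exists>r\<in>radii R. 0 \<le> r \<and> N \<le> u r" for N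
  proof (rule ccontr)
    assume "\<not> (\<exists>r\<in>radii R. 0 \<le> r \<and> N \<le> u r)"
    then have N: "u r < N" if "r \<in> radii R" for r using that by (force simp: radii_def)
    have "R = \<infinity>"
      by (rule bounded_imp_global[OF zero_radii, of N]) (use above N \<alpha>_pos in \<open>force simp: abs_le_iff\<close>)
    note inR = radii_infinity[OF this]
    obtain m where m: "m \<in> {u 0..N}" "\<And>t. t \<in> {u 0..N} \<Longrightarrow> g t \<le> g m"
      using g_max[OF less_imp_le[OF N[OF zero_radii]]] by blast
    have "g m < 0" using m(1) assms by (intro g_neg) auto
    have "- g m / k \<le> v r" if "1 < r" for r
    proof -
      have "- g m * (r ^ k - 0 ^ k) / k \<le> r ^ (k - 1) * v r"
      proof (rule p_lower)
        fix t assume t: "0 \<le> t" "t \<le> r"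
        show "g (u t) \<le> - (- g m)" using m(2)[of "u t"] inc[of 0 t] N[of t] t inR by auto
      qed (use that inR vel_0[OF k2] \<open>g m < 0\<close> in auto)
      then have "r ^ (k - 1) * (r * (- g m / k)) \<le> r ^ (k - 1) * v r"
        using k2 by (simp add: power_k zero_power mult_ac)
      moreover have "0 < r ^ (k - 1)" using that by simp
      ultimately have "r * (- g m / k) \<le> v r" using mult_le_cancel_left_pos by blast
      moreover have "1 * (- g m / k) \<le> r * (- g m / k)"
        using that \<open>g m < 0\<close> k_pos by (intro mult_right_mono divide_nonneg_pos) auto
      ultimately show ?thesis by simp
    qed
    then have slope: "u 1 + (- g m / k) * (r - 1) \<le> u r" if "1 \<le> r" for r
      using that by (intro u_slope_ge) (auto simp: inR)
    define r where "r = 1 + (N - u 1) * k / (- g m)"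
    have "0 \<le> (N - u 1) * k / (- g m)"
      using N[of 1] \<open>g m < 0\<close> by (intro divide_nonneg_pos) (auto simp: inR)
    then have "1 \<le> r" by (simp add: r_def)
    have "N \<le> u r" using slope[OF \<open>1 \<le> r\<close>] \<open>g m < 0\<close> k_pos by (simp add: r_def)
    then show False using N[of r] \<open>1 \<le> r\<close> by (auto simp: inR)
  qed
  then show "filterlim (u \<circ> real_of_ereal) at_top (at_left R)"
    by (intro filterlim_at_top_at_left_ereal[of 0] inc)
  have "w r < 0" if r: "r \<in> radii R" "0 < r" for r
  proof -
    have "M r < \<phi> r"
    proof (rule becomes_free[OF r(1) order_refl r(2)])
      fix s assume s: "0 < s" "s < r"
      then have sR: "s \<in> radii R" using radii_le[OF r(1)] by auto
      have "deriv g (u s) < 0" using above[OF sR] \<beta>_less \<beta>_pos by (intro deriv_neg) auto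
      then show "deriv g (u s) * v s < 0" using pos[OF sR s(1)] by (simp add: mult_neg_pos)
    qed
    then show ?thesis using w_neg_iff[OF r(2)] by simp
  qed
  then show switching unfolding switching_def
    by (intro exI[of _ "ereal 0"] exI[of _ \<infinity>]) auto
qed

text \<open>Covers both starts in \<open>(- \<alpha>, 0)\<close>, with \<open>a = 0\<close>, and
  solutions that have turned. The barrier at \<open>0\<close> bounds \<open>u\<close> from above;
  the negative reaction keeps \<open>v\<close> nonnegative, so \<open>u\<close> cannot sink to
  \<open>- \<alpha>\<close>. A limit below \<open>0\<close> would leave a permanent upward push. The
  motion is free while \<open>u < - \<beta>\<close>, and above \<open>- \<beta>\<close> the first
  contact is final.\<close>

lemma recovery:
  assumes a: "a \<in> radii R" "- \<alpha> < u a" "u a < 0" "0 \<le> v a"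
  shows "R = \<infinity>" and "\<And>r. a \<le> r \<Longrightarrow> - \<alpha> < u r \<and> u r < 0" and "\<And>r. a < r \<Longrightarrow> 0 < v r"
    and "(u \<longlongrightarrow> 0) at_top"
    and "\<exists>b::ereal. a \<le> b \<and> (\<forall>r. a < r \<and> r < b \<longrightarrow> w r < 0) \<and> (\<forall>r. 0 \<le> r \<and> b < r \<longrightarrow> w r = 0)"
proof -
  have a0: "0 \<le> a" using a by (simp add: radii_def)
  have neg: "u r < 0" if "r \<in> radii R" "a \<le> r" for r
    using barrier[OF that(1) a0 that(2) g_0 a(3)] .
  have low: "- \<alpha> < u r" if r: "r \<in> radii R" "a \<le> r" for r
  proof (rule ccontr)
    assume "\<not> - \<alpha> < u r"
    then obtain c where c: "a < c" "c \<le> r" "- u c = \<alpha>" "\<And>t. a \<le> t \<Longrightarrow> t < c \<Longrightarrow> - u t < \<alpha>"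
      using first_hit[of a r "\<lambda>t. - u t" \<alpha>] r a a0
      by (auto intro!: continuous_intros continuous_u')
    have cR: "c \<in> radii R" using radii_le[OF r(1)] c a0 by auto
    have g: "g (u t) \<le> 0" if t: "a \<le> t" "t \<le> c" for t
    proof (rule g_nonpos)
      show "- \<alpha> \<le> u t" using c(3) c(4)[of t] t by (cases "t = c") auto
      have "t \<in> radii R" using radii_le[OF cR] t a0 by auto
      then show "u t \<le> 0" using neg[of t] t by simp
    qed
    have "0 \<le> v t" if "a < t" "t < c" for t
      by (rule v_nonneg[OF radii_le[OF cR] a0 _ a(4)]) (use that g a0 in auto)
    then have "u a + 0 * (c - a) \<le> u c" using c cR a0 by (intro u_slope_ge) auto
    then show False using a c by simp
  qed
  have pos: "0 < v r" if r: "r \<in> radii R" "a < r" for r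
  proof (rule v_pos[OF r(1) a0 r(2) a(4)])
    fix t assume "a \<le> t" "t \<le> r"
    then show "g (u t) < 0"
      using radii_le[OF r(1), of t] a0 low[of t] neg[of t] by (intro g_neg') auto
  qed
  show Rinf: "R = \<infinity>"
    by (rule bounded_imp_global[OF a(1), of \<alpha>]) (use low neg in \<open>force simp: abs_le_iff\<close>)
  note inR = radii_infinity[OF this]
  show range: "\<And>r. a \<le> r \<Longrightarrow> - \<alpha> < u r \<and> u r < 0" using low neg a0 by (auto simp: inR)
  show pos': "\<And>r. a < r \<Longrightarrow> 0 < v r" using pos a0 by (auto simp: inR)
  have inc: "u x \<le> u y" if "a \<le> x" "x \<le> y" for x y
  proof -
    have "0 \<le> v r" if "x < r" "r < y" for r
      using pos'[of r] that \<open>a \<le> x\<close> by auto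
    then show ?thesis using u_slope_ge[of y x 0] that a0 inR by auto
  qed
  obtain l where l: "0 \<le> l" "((\<lambda>x. - u x) \<longlongrightarrow> l) at_top" "\<And>x. a \<le> x \<Longrightarrow> l \<le> - u x"
    by (rule decreasing_limit[of a "\<lambda>x. - u x" 0]) (use inc range in \<open>auto intro: less_imp_le\<close>)
  have "l = 0"
  proof (rule ccontr)
    assume "l \<noteq> 0"
    then have "0 < l" using l(1) by simp
    have "u a \<le> - l" using l(3)[of a] by simp
    obtain m where m: "m \<in> {u a..- l}" "\<And>t. t \<in> {u a..- l} \<Longrightarrow> g t \<le> g m"
      using g_max[OF \<open>u a \<le> - l\<close>] by blast
    have "g m < 0" using m(1) a \<open>0 < l\<close> by (intro g_neg') auto
    have "- g m / k \<le> v r" if "a + 1 < r" for r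
    proof -
      have r: "0 < r" "a \<le> r" using that a0 by auto
      have "- g m * (r ^ k - a ^ k) / k \<le> r ^ (k - 1) * v r"
      proof (rule p_lower)
        fix t assume t: "a \<le> t" "t \<le> r"
        show "g (u t) \<le> - (- g m)" using m(2)[of "u t"] inc[of a t] l(3)[of t] t by auto
      qed (use that inR a0 a(4) \<open>g m < 0\<close> in auto)
      \<comment> \<open>The distance \<open>r - a > 1\<close> absorbs the initial term
        \<open>a ^ k\<close>, so that the velocity bound no longer depends on
        \<open>r\<close>.\<close>
      moreover have "r ^ (k - 1) * 1 \<le> r ^ k - a ^ k"
      proof -
        have "a ^ (k - 1) * a \<le> r ^ (k - 1) * a" using r a0 by (intro mult_right_mono power_mono) auto
        moreover have "r ^ (k - 1) * 1 \<le> r ^ (k - 1) * (r - a)"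
          using that r by (intro mult_left_mono) auto
        ultimately show ?thesis unfolding power_k right_diff_distrib by linarith
      qed
      then have "r ^ (k - 1) * 1 * (- g m / k) \<le> (r ^ k - a ^ k) * (- g m / k)"
        using \<open>g m < 0\<close> k_pos by (intro mult_right_mono divide_nonneg_pos) auto
      ultimately have "r ^ (k - 1) * (- g m / k) \<le> r ^ (k - 1) * v r" by (simp add: mult.commute)
      moreover have "0 < r ^ (k - 1)" using r by simp
      ultimately show ?thesis using mult_le_cancel_left_pos by blast
    qed
    then have slope: "u (a + 1) + (- g m / k) * (r - (a + 1)) \<le> u r" if "a + 1 \<le> r" for r
      using that a0 by (intro u_slope_ge) (auto simp: inR)
    define r where "r = a + 1 + (- u (a + 1)) * k / (- g m)"
    have "0 \<le> (- u (a + 1)) * k / (- g m)"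
      using range[of "a + 1"] \<open>g m < 0\<close> by (intro divide_nonneg_pos mult_nonneg_nonneg) auto
    then have "a + 1 \<le> r" by (simp add: r_def)
    have "0 \<le> u r" using slope[OF \<open>a + 1 \<le> r\<close>] \<open>g m < 0\<close> k_pos by (simp add: r_def)
    then show False using range[of r] \<open>a + 1 \<le> r\<close> by auto
  qed
  then show lim: "(u \<longlongrightarrow> 0) at_top" using tendsto_minus[OF l(2)] by simp
  have "\<forall>\<^sub>F r in at_top. - \<beta> < u r" using order_tendstoD(1)[OF lim] \<beta>_pos by auto
  then obtain s where s: "\<And>r. s \<le> r \<Longrightarrow> - \<beta> < u r" unfolding eventually_at_top_linorder by blast
  \<comment> \<open>The radius at which \<open>u\<close> enters \<open>[- \<beta>, 0)\<close>; it is
    \<open>a\<close> itself if \<open>u a\<close> lies there already.\<close>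
  have "\<exists>c\<ge>a. - \<beta> \<le> u c \<and> (\<forall>t. a \<le> t \<and> t < c \<longrightarrow> u t < - \<beta>)"
  proof (cases "- \<beta> \<le> u a")
    case False
    have "u (max a s) \<ge> - \<beta>" using s[of "max a s"] by simp
    moreover have "continuous_on {a..max a s} u" using a0 by (intro continuous_u') (auto simp: inR)
    ultimately obtain c where "a < c" "u c = - \<beta>" "\<And>t. a \<le> t \<Longrightarrow> t < c \<Longrightarrow> u t < - \<beta>"
      using first_hit[of a "max a s" u "- \<beta>"] False by (metis max.cobounded1 not_le)
    then show ?thesis by (intro exI[of _ c]) auto
  qed auto
  then obtain c where c: "a \<le> c" "- \<beta> \<le> u c" "\<And>t. a \<le> t \<Longrightarrow> t < c \<Longrightarrow> u t < - \<beta>" by blast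
  have "\<exists>b::ereal. a \<le> b \<and> (\<forall>r. r \<in> radii R \<and> a < r \<and> r < b \<longrightarrow> w r < 0) \<and> (\<forall>r. r \<in> radii R \<and> b < r \<longrightarrow> w r = 0)"
  proof (rule phase_tail[OF c(1) a0])
    fix r assume r: "r \<in> radii R" "a < r" "r \<le> c"
    have "M r < \<phi> r"
    proof (rule becomes_free[OF r(1) a0 r(2)])
      fix t assume t: "a < t" "t < r"
      have "deriv g (u t) < 0" using c(3)[of t] t r \<beta>_pos by (intro deriv_neg) auto
      then show "deriv g (u t) * v t < 0" using pos'[OF t(1)] by (simp add: mult_neg_pos)
    qed
    then show "w r < 0" using w_neg_iff[of r] r a0 by simp
  next
    fix r assume r: "r \<in> radii R" "c < r"
    have "- \<beta> \<le> u r" using inc[of c r] c r by auto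
    moreover have "u c < u r"
    proof (rule strict_mono_from_derivative[OF r(2)])
      show "continuous_on {c..r} u" using r c a0 by (intro continuous_u') auto
      fix x assume "c < x" "x < r"
      then show "(u has_real_derivative v x) (at x)" "0 < v x"
        using c a0 by (auto intro!: u_deriv' pos' simp: inR)
    qed
    ultimately have "0 < deriv g (u r)" using c range[of r] r \<beta>_pos by (intro deriv_pos) auto
    then show "0 \<le> deriv g (u r) * v r" using pos'[of r] r c by simp
  qed blast
  then show "\<exists>b::ereal. a \<le> b \<and> (\<forall>r. a < r \<and> r < b \<longrightarrow> w r < 0) \<and> (\<forall>r. 0 \<le> r \<and> b < r \<longrightarrow> w r = 0)"
    using a0 by (auto simp: inR)
qed

end

section \<open>Positive starting values below the largest zero\<close>

locale positive_trajectory = bistable_trajectory +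
  assumes start: "0 < u 0" "u 0 < \<alpha>"
begin

lemma u_less_\<alpha>: "r \<in> radii R \<Longrightarrow> u r < \<alpha>"
  using barrier[of r 0 \<alpha>] start by (auto simp: radii_def)

lemma F_diff_ge:
  assumes b: "b \<in> radii R" and a: "0 \<le> a" "a \<le> b" and c: "\<And>t. a \<le> t \<Longrightarrow> t \<le> b \<Longrightarrow> - c \<le> g (u t)"
  shows "- c * (b ^ k - a ^ k) / k \<le> F b - F a"
proof -
  have "F a + c * a ^ k / k \<le> F b + c * b ^ k / k"
  proof (rule mono_from_derivative[OF a(2), where f = "\<lambda>t. F t + c * t ^ k / k"])
    show "continuous_on {a..b} (\<lambda>t. F t + c * t ^ k / k)"
      by (intro continuous_intros continuous_on_subset[OF continuous_on_flux[OF k2 continuous_gu[OF b order_refl]]])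
        (use a k2 in auto)
    fix t assume t: "a < t" "t < b"
    then have tR: "t \<in> radii R" "0 < t" using a by (auto intro: radii_le[OF b])
    have "((\<lambda>t. F t + c * t ^ k / k) has_real_derivative
        t ^ (k - 1) * g (u t) + c * (real k * t ^ (k - Suc 0)) / k) (at t)"
      by (intro DERIV_add F_deriv tR DERIV_cdivide DERIV_cmult DERIV_pow)
    then show "((\<lambda>t. F t + c * t ^ k / k) has_real_derivative t ^ (k - 1) * (g (u t) + c)) (at t)"
      using k_pos by (simp add: algebra_simps)
    show "0 \<le> t ^ (k - 1) * (g (u t) + c)" using c[of t] t tR by auto
  qed
  then show ?thesis by (simp add: right_diff_distrib diff_divide_distrib)
qed

lemma F_mono:
  assumes "b \<in> radii R" "0 \<le> a" "a \<le> b" "\<And>t. a \<le> t \<Longrightarrow> t \<le> b \<Longrightarrow> 0 \<le> g (u t)"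
  shows "F a \<le> F b"
  using F_diff_ge[OF assms(1-3), of 0] assms(4) by simp

lemma v_neg_early: "r \<in> radii R \<Longrightarrow> 0 < r \<Longrightarrow> 0 < u r \<Longrightarrow> v r < 0"
  using v_neg_of_pos g_pos u_less_\<alpha> by blast

lemma positive_early:
  obtains r where "r \<in> radii R" "0 < r" "\<And>t. 0 \<le> t \<Longrightarrow> t \<le> r \<Longrightarrow> 0 < u t"
proof -
  obtain b where b: "0 < b" "b \<in> radii R" using radii_extend[OF zero_radii] .
  obtain d where d: "0 < d" "\<And>t. t \<in> {0..b} \<Longrightarrow> dist t 0 < d \<Longrightarrow> dist (u t) (u 0) < u 0"
    using continuous_u'[OF b(2) order_refl, unfolded continuous_on_iff, rule_format, of 0 "u 0"] b start
    by auto
  define r where "r = min b (d / 2)"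
  have r: "0 < r" "r \<le> b" "r < d" using b d by (auto simp: r_def)
  have "0 < u t" if "0 \<le> t" "t \<le> r" for t
    using d(2)[of t] that r by (auto simp: dist_real_def)
  then show ?thesis using that[of r] r radii_le[OF b(2)] by auto
qed

text \<open>If \<open>u\<close> stayed nonnegative it would decrease to \<open>0\<close>, faster than any power of \<open>r\<close> since
  \<open>u' \<le> - r g(u) / k\<close>; but \<open>r ^ (k - 1) * u'\<close> is nonincreasing and negative, so that
  \<open>(r ^ k * u)' \<le> k r ^ (k - 1) u - c r\<close> eventually drives \<open>r ^ k * u\<close> below \<open>0\<close>.\<close>

lemma becomes_negative: "\<exists>z\<in>radii R. u z < 0"
proof (rule ccontr)
  assume "\<not> (\<exists>z\<in>radii R. u z < 0)"
  then have nn: "0 \<le> u r" if "r \<in> radii R" for r using that by force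
  have Rinf: "R = \<infinity>"
    by (rule bounded_imp_global[OF zero_radii, of \<alpha>]) (use nn u_less_\<alpha> in \<open>force simp: abs_le_iff\<close>)
  note inR = radii_infinity[OF this]
  have gnn: "0 \<le> g (u r)" if "0 \<le> r" for r
    using that nn[of r] u_less_\<alpha>[of r] by (intro g_nonneg) (auto simp: inR)
  have vnp: "v r \<le> 0" if "0 \<le> r" for r
  proof -
    have "0 \<le> r * g (u r) / k" using gnn[OF that] that by simp
    then show ?thesis using w_le[of r] that by (simp add: inR)
  qed
  have dec: "u y \<le> u x" if "0 \<le> x" "x \<le> y" for x y
    using u_slope_le[of y x 0] vnp that by (simp add: inR)
  obtain l where l: "0 \<le> l" "(u \<longlongrightarrow> l) at_top" "\<And>x. 0 \<le> x \<Longrightarrow> l \<le> u x"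
    by (rule decreasing_limit[of 0 u 0]) (use dec nn in \<open>auto simp: inR\<close>)
  show False
  proof (cases "l = 0")
    case False
    then have "0 < l" using l(1) by simp
    have "l \<le> u 0" using l(3)[of 0] by simp
    obtain m where m: "m \<in> {l..u 0}" "\<And>t. t \<in> {l..u 0} \<Longrightarrow> g m \<le> g t"
      using g_min[OF \<open>l \<le> u 0\<close>] by blast
    have "0 < g m" using m(1) start \<open>0 < l\<close> by (intro g_pos) auto
    have "v r \<le> - g m / k" if "1 < r" for r
    proof -
      have "g m \<le> g (u r)" using l(3)[of r] dec[of 0 r] that by (intro m(2)) auto
      then have "1 * g m \<le> r * g (u r)" using that \<open>0 < g m\<close> by (intro mult_mono) auto
      then have "g m / k \<le> r * g (u r) / k" by (intro divide_right_mono) auto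
      then show ?thesis using w_le[of r] that by (simp add: inR)
    qed
    then have slope: "u r \<le> u 1 + (- g m / k) * (r - 1)" if "1 \<le> r" for r
      using that by (intro u_slope_le) (auto simp: inR)
    define r where "r = 1 + u 1 * k / g m"
    have "0 \<le> u 1 * k / g m" using nn[of 1] \<open>0 < g m\<close> by (simp add: inR)
    then have "1 \<le> r" by (simp add: r_def)
    have "u r \<le> 0" using slope[OF \<open>1 \<le> r\<close>] \<open>0 < g m\<close> k_pos by (simp add: r_def)
    then show False using l(3)[of r] \<open>1 \<le> r\<close> \<open>0 < l\<close> by auto
  next
    case True
    obtain r1 where r1: "0 < r1" "\<And>t. 0 \<le> t \<Longrightarrow> t \<le> r1 \<Longrightarrow> 0 < u t"
      using positive_early by blast
    \<comment> \<open>The size of the downward momentum at \<open>r1\<close>. It cannot diminish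
      while \<open>g(u)\<close> is nonnegative.\<close>
    define c where "c = - (r1 ^ (k - 1) * v r1)"
    have "v r1 < 0" using r1 by (intro v_neg_early) (auto simp: inR)
    then have c: "0 < c" using r1 by (simp add: c_def mult_pos_neg)
    have p: "r ^ (k - 1) * v r \<le> - c" if "r1 \<le> r" for r
    proof -
      have "F r1 \<le> F r" using r1 that gnn by (intro F_mono) (auto simp: inR)
      then show ?thesis using p_le[of r r1] r1 that by (simp add: inR c_def)
    qed
    \<comment> \<open>A slope below \<open>g'(0)\<close>, so that \<open>m * x \<le> g x\<close> for
      small nonnegative \<open>x\<close>.\<close>
    define m where "m = deriv g 0 / 2"
    have m: "0 < m" "m < deriv g 0" using deriv_pos[of 0] \<beta>_pos by (auto simp: m_def)
    have "isCont (deriv g) 0" using continuous_deriv by (simp add: continuous_on_eq_continuous_at)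
    then have "\<forall>\<^sub>F x in at 0. m < deriv g x"
      using m order_tendstoD(1) unfolding isCont_def by blast
    then obtain d where d: "0 < d" "\<And>x. x \<noteq> 0 \<Longrightarrow> \<bar>x\<bar> < d \<Longrightarrow> m < deriv g x"
      unfolding eventually_at by (auto simp: dist_real_def)
    have gm: "m * x \<le> g x" if "0 \<le> x" "x < d" for x
    proof -
      have "g 0 - m * 0 \<le> g x - m * x"
      proof (rule mono_from_derivative[OF that(1), where f = "\<lambda>x. g x - m * x" and f' = "\<lambda>x. deriv g x - m"])
        show "continuous_on {0..x} (\<lambda>x. g x - m * x)" by (intro continuous_intros continuous_g)
        show "((\<lambda>x. g x - m * x) has_real_derivative deriv g y - m) (at y)" for y
          by (auto intro!: derivative_eq_intros g_deriv)
        show "0 \<le> deriv g y - m" if "0 < y" "y < x" for y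
          using d(2)[of y] that \<open>x < d\<close> by auto
      qed
      then show ?thesis by simp
    qed
    have "\<forall>\<^sub>F r in at_top. u r < d" using order_tendstoD(2)[OF l(2)] True d(1) by auto
    then obtain s where s: "\<And>r. s \<le> r \<Longrightarrow> u r < d" unfolding eventually_at_top_linorder by blast
    \<comment> \<open>From \<open>s\<close> on \<open>u\<close> is small enough for the linear
      bound, from \<open>r1\<close> on the momentum bound holds, and
      \<open>x * x \<ge> k ^ 2 / m\<close> makes \<open>x ^ k * u x\<close> nonincreasing.\<close>
    define r2 where "r2 = Max {s, r1, 1, real k ^ 2 / m}"
    have r2: "s \<le> r2" "r1 \<le> r2" "1 \<le> r2" "real k ^ 2 / m \<le> r2" by (auto simp: r2_def)
    define h where "h = (\<lambda>r. r ^ k * u r)"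
    have h': "(h has_real_derivative (real k * (r ^ (k - 1)) * u r + v r * r ^ k)) (at r)"
      if "0 < r" for r
      unfolding h_def using that
      by (intro DERIV_cong[OF DERIV_mult[OF DERIV_pow u_deriv']]) (auto simp: inR)
    have ch: "continuous_on {a..b} h" if "0 \<le> a" "0 \<le> b" for a b
      unfolding h_def using that by (intro continuous_intros continuous_u') (auto simp: inR)
    have hdec: "h r \<le> h r2" if "r2 \<le> r" for r
    proof -
      have "- h r2 \<le> - h r"
      proof (rule mono_from_derivative[OF that, where f = "\<lambda>x. - h x"])
        show "continuous_on {r2..r} (\<lambda>x. - h x)" using r2 that by (intro continuous_on_minus ch) auto
        fix x assume x: "r2 < x" "x < r"
        then have x1: "1 < x" using r2 by auto
        then show "((\<lambda>x. - h x) has_real_derivative - (real k * (x ^ (k - 1)) * u x + v x * x ^ k)) (at x)"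
          by (intro DERIV_minus h') auto
        have ux: "0 \<le> u x" "u x < d" using nn[of x] s[of x] x r2 x1 by (auto simp: inR)
        have "v x \<le> - x * g (u x) / k" using w_le[of x] x1 by (simp add: inR)
        also have "\<dots> \<le> - x * (m * u x) / k"
          using gm[OF ux] x1 by (intro divide_right_mono) auto
        finally have "v x * x \<le> - (x * (m * u x) / k) * x"
          using x1 by (intro mult_right_mono) auto
        moreover have "k ^ 2 / m \<le> x * x"
        proof -
          have "k ^ 2 / m \<le> 1 * x" using r2 x by auto
          also have "\<dots> \<le> x * x" using x1 by (intro mult_right_mono) auto
          finally show ?thesis .
        qed
        then have "k * u x \<le> (x * (m * u x) / k) * x"
        proof -
          assume "k ^ 2 / m \<le> x * x"
          then have "real k * real k \<le> x * x * m" using m(1) by (simp add: field_simps power2_eq_square)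
          then have "(real k * real k) * u x \<le> (x * x * m) * u x" using ux by (intro mult_right_mono)
          then show ?thesis using k_pos by (simp add: field_simps)
        qed
        ultimately have "k * u x + v x * x \<le> 0" by linarith
        then have "x ^ (k - 1) * (k * u x + v x * x) \<le> 0" using x1 by (intro mult_nonneg_nonpos) auto
        then show "0 \<le> - (real k * (x ^ (k - 1)) * u x + v x * x ^ k)"
          unfolding power_k by (simp add: algebra_simps)
      qed
      then show ?thesis by simp
    qed
    have hnn: "0 \<le> h r" if "0 \<le> r" for r using nn[of r] that by (simp add: h_def inR)
    \<comment> \<open>Beyond \<open>r4\<close> the derivative of \<open>h\<close> is at most
      \<open>k * h r2 - c * x \<le> - 1\<close>; after a further distance \<open>h r4 + 1\<close>
      this brings \<open>h\<close> down to \<open>- 1\<close>.\<close>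
    define r4 where "r4 = max r2 ((k * h r2 + 1) / c)"
    have r4: "r2 \<le> r4" "(k * h r2 + 1) / c \<le> r4" by (auto simp: r4_def)
    define r where "r = r4 + h r4 + 1"
    have r: "r4 < r" using hnn[of r4] r4 r2 by (simp add: r_def)
    have "- h r4 - r4 \<le> - h r - r"
    proof (rule mono_from_derivative[where f = "\<lambda>x. - h x - x"])
      show "continuous_on {r4..r} (\<lambda>x. - h x - x)"
        using r4 r2 r by (intro continuous_intros ch) auto
      fix x assume x: "r4 < x" "x < r"
      then have x1: "1 < x" using r4 r2 by auto
      then show "((\<lambda>x. - h x - x) has_real_derivative - (real k * (x ^ (k - 1)) * u x + v x * x ^ k) - 1) (at x)"
        by (intro DERIV_diff DERIV_minus h' DERIV_ident) auto
      have "real k * (x ^ (k - 1)) * u x = k * h x / x" using x1 by (simp add: h_def power_k)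
      also have "\<dots> \<le> k * h x / 1"
        using x1 hnn[of x] by (intro divide_left_mono) auto
      also have "\<dots> \<le> k * h r2" using hdec[of x] x r4 by (simp add: mult_left_mono)
      finally have 1: "real k * (x ^ (k - 1)) * u x \<le> k * h r2" .
      have "v x * x ^ k = (x ^ (k - 1) * v x) * x" by (simp add: power_k)
      also have "\<dots> \<le> - c * x" using p[of x] x x1 r4 r2 by (intro mult_right_mono) auto
      also have "\<dots> \<le> - (k * h r2 + 1)"
        using r4(2) x c by (simp add: pos_divide_le_eq) (smt (verit) mult.commute mult_left_mono)
      finally show "0 \<le> - (real k * (x ^ (k - 1)) * u x + v x * x ^ k) - 1" using 1 by linarith
    qed (use r in auto)
    then have "h r \<le> - 1" by (simp add: r_def)
    then show False using hnn[of r] r r4 r2 by auto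
  qed
qed

lemma first_zero:
  obtains z where "z \<in> radii R" "0 < z" "u z = 0" "\<And>t. 0 \<le> t \<Longrightarrow> t < z \<Longrightarrow> 0 < u t"
    "\<And>t. 0 < t \<Longrightarrow> t \<le> z \<Longrightarrow> v t < 0" "\<And>t. t \<in> radii R \<Longrightarrow> z < t \<Longrightarrow> u t < 0"
proof -
  obtain y where y: "y \<in> radii R" "u y < 0" using becomes_negative by blast
  have "continuous_on {0..y} (\<lambda>t. - u t)" by (intro continuous_on_minus continuous_u' y order_refl)
  from first_hit[OF this, of 0] y start
  obtain z where z: "0 < z" "z \<le> y" "- u z = 0" "\<And>t. 0 \<le> t \<Longrightarrow> t < z \<Longrightarrow> - u t < 0"
    by (auto simp: radii_def)
  have zR: "z \<in> radii R" using radii_le[OF y(1)] z by auto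
  have pos: "0 < u t" if "0 \<le> t" "t < z" for t using z(4)[OF that] by simp
  have neg: "v t < 0" if "0 < t" "t < z" for t
    using that pos[of t] by (intro v_neg_early radii_le[OF zR]) auto
  \<comment> \<open>Since \<open>g (u z) = 0\<close>, the pointwise bound yields only
    \<open>v z \<le> 0\<close>. Strictness comes from the momentum, which is negative before
    \<open>z\<close> and cannot increase while \<open>g(u)\<close> is nonnegative.\<close>
  have "v z < 0"
  proof -
    define r where "r = z / 2"
    have r: "0 < r" "r < z" using z by (auto simp: r_def)
    have "0 \<le> g (u t)" if "r \<le> t" "t \<le> z" for t
      using pos[of t] z(3) that r u_less_\<alpha>[OF radii_le[OF zR], of t]
      by (intro g_nonneg) (cases "t = z"; auto)+
    then have "F r \<le> F z" using r by (intro F_mono[OF zR]) auto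
    then have "z ^ (k - 1) * v z \<le> r ^ (k - 1) * v r" using p_le[OF zR, of r] r by simp
    also have "\<dots> < 0" using neg[OF r] r by (simp add: mult_pos_neg)
    finally show ?thesis using z by (simp add: mult_less_0_iff)
  qed
  moreover have "u t < 0" if t: "t \<in> radii R" "z < t" for t
  proof -
    \<comment> \<open>The barrier at \<open>0\<close> needs a strictly negative value to start from,
      found just after \<open>z\<close>.\<close>
    obtain d where d: "0 < d" "\<And>h. 0 < h \<Longrightarrow> h < d \<Longrightarrow> u (z + h) < u z"
      using DERIV_neg_dec_right[OF u_deriv'[OF zR z(1)] \<open>v z < 0\<close>] by blast
    define s where "s = z + min (d / 2) (t - z)"
    have s: "z < s" "s \<le> t" using d t by (auto simp: s_def)
    have "u s < 0" using d(2)[of "min (d / 2) (t - z)"] d(1) t z by (simp add: s_def)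
    then show ?thesis using barrier[OF t(1), of s 0] s z by auto
  qed
  ultimately show ?thesis
    using that[OF zR z(1) _ pos] neg z(3) by (metis less_eq_real_def minus_equation_iff minus_zero)
qed

text \<open>During the descent \<open>g'(u) u'\<close> is positive above \<beta> and negative
  between \<beta> and \<open>0\<close>; \<open>c\<close> is the radius at which \<open>u\<close>
  reaches \<beta>, or \<open>0\<close> if it starts no higher.\<close>

lemma opening_phase:
  assumes z: "z \<in> radii R" "0 < z" "u z = 0" and neg': "\<forall>t\<in>{0<..z}. v t < 0"
  shows "\<exists>c\<ge>0. c < z \<and> (\<forall>r. 0 < r \<and> r < c \<longrightarrow> w r = 0) \<and> (\<forall>r. c < r \<and> r \<le> z \<longrightarrow> w r < 0)
    \<and> (u 0 \<le> \<beta> \<longrightarrow> c = 0)"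
proof -
  have neg: "v t < 0" if "0 < t" "t \<le> z" for t using neg' that by simp
  have sdec: "u y < u x" if "0 \<le> x" "x < y" "y \<le> z" for x y
    using that neg by (intro u_strict_dec radii_le[OF z(1)]) auto
  have "\<exists>c. 0 \<le> c \<and> c < z \<and> u c \<le> \<beta> \<and> (\<forall>t. 0 \<le> t \<and> t < c \<longrightarrow> \<beta> < u t) \<and> (u 0 \<le> \<beta> \<longrightarrow> c = 0)"
  proof (cases "u 0 \<le> \<beta>")
    case False
    have "continuous_on {0..z} (\<lambda>t. - u t)" by (intro continuous_on_minus continuous_u' z order_refl)
    from first_hit[OF this, of "- \<beta>"] z False \<beta>_pos
    obtain c where c: "0 < c" "c \<le> z" "- u c = - \<beta>" "\<And>t. 0 \<le> t \<Longrightarrow> t < c \<Longrightarrow> - u t < - \<beta>"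
      by auto
    moreover have "c \<noteq> z" using c z \<beta>_pos by auto
    ultimately show ?thesis using False by (intro exI[of _ c]) auto
  qed (use z in \<open>auto intro!: exI[of _ 0]\<close>)
  then obtain c where c: "0 \<le> c" "c < z" "u c \<le> \<beta>" "\<And>t. 0 \<le> t \<Longrightarrow> t < c \<Longrightarrow> \<beta> < u t"
    "u 0 \<le> \<beta> \<Longrightarrow> c = 0" by blast
  have tight: "w r = 0" if r: "0 < r" "r < c" for r
  proof -
    have rR: "r \<in> radii R" using radii_le[OF z(1)] r c by auto
    have "M r = \<phi> r"
    proof (rule tight_persists[OF rR order_refl _ tight_0])
      fix t assume t: "0 < t" "t < r"
      have "deriv g (u t) < 0" using c(4)[of t] t r \<beta>_pos by (intro deriv_neg) auto
      then show "0 \<le> deriv g (u t) * v t" using neg[of t] t r c by (simp add: mult_nonpos_nonpos)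
    qed (use r in auto)
    then show ?thesis using w_zero_iff r by simp
  qed
  have free: "w r < 0" if r: "c < r" "r \<le> z" for r
  proof -
    have rR: "r \<in> radii R" using radii_le[OF z(1)] r c by auto
    have "M r < \<phi> r"
    proof (rule becomes_free[OF rR c(1) r(1)])
      fix t assume t: "c < t" "t < r"
      have "u t < \<beta>" "0 < u t" using sdec[of c t] sdec[of t z] c t r z by auto
      then have "0 < deriv g (u t)" using \<beta>_pos by (intro deriv_pos) auto
      then show "deriv g (u t) * v t < 0" using neg[of t] t r c by (simp add: mult_pos_neg)
    qed
    then show ?thesis using w_neg_iff r c by simp
  qed
  show ?thesis using c(1,2,5) tight free by blast
qed

text \<open>Backward uniqueness for the free equation: \<open>(u + \<alpha>)\<^sup>2 + u'\<^sup>2\<close> decays at most exponentially.\<close>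

lemma not_stop_at_minus_\<alpha>:
  assumes c: "c \<in> radii R" and z: "0 < z" "z < c" and neg: "\<And>t. z \<le> t \<Longrightarrow> t < c \<Longrightarrow> v t < 0"
    and nonpos: "\<And>t. z \<le> t \<Longrightarrow> t \<le> c \<Longrightarrow> u t \<le> 0" and "u c = - \<alpha>"
  shows "v c < 0"
proof (rule ccontr)
  assume "\<not> v c < 0"
  then have vc: "v c = 0" using w_le[OF c] \<open>u c = - \<alpha>\<close> by simp
  have above: "- \<alpha> < u t" if "z \<le> t" "t < c" for t
    using u_strict_dec[OF c, of t] neg that z \<open>u c = - \<alpha>\<close> by auto
  obtain L where L: "L > 0" "\<And>x y. x \<in> {-\<alpha>..\<alpha>} \<Longrightarrow> y \<in> {-\<alpha>..\<alpha>} \<Longrightarrow> \<bar>g x - g y\<bar> \<le> L * \<bar>x - y\<bar>"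
    using loc_lip[of \<alpha>] by blast
  \<comment> \<open>The three summands absorb \<open>2 * X * Y\<close>, the reaction term and the
    damping term of the derivative of \<open>X\<^sup>2 + Y\<^sup>2\<close>, for
    \<open>X = u + \<alpha>\<close> and \<open>Y = v\<close>.\<close>
  define C where "C = 1 + L + 2 * (real k - 1) / z"
  define e where "e = (\<lambda>r. ((u r + \<alpha>)\<^sup>2 + (v r)\<^sup>2) * exp (C * r))"
  have "e z \<le> e c"
  proof (rule mono_from_derivative[where f = e])
    show "z \<le> c" using z by simp
    show "continuous_on {z..c} e" unfolding e_def
      using z by (intro continuous_intros continuous_u' continuous_v' c) auto
    fix r assume r: "z < r" "r < c"
    then have rR: "r \<in> radii R" "0 < r" using radii_le[OF c] z by auto
    have free: "w s < 0" if "z < s" "s < c" for s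
      using that neg[of s] above[of s] nonpos[of s] z
      by (intro w_neg_of_neg radii_le[OF c] g_nonpos) auto
    have "\<forall>\<^sub>F s in nhds r. s \<in> {z<..<c}" using r by (intro eventually_nhds_in_open) auto
    then have "\<forall>\<^sub>F s in nhds r. w s < 0" by eventually_elim (use free in auto)
    note dv = v_deriv_free[OF rR this]
    define X where "X = u r + \<alpha>"
    define Y where "Y = v r"
    define dY where "dY = - (real k - 1) * v r / r - g (u r)"
    show "(e has_real_derivative (2 * X * Y + 2 * Y * dY + C * (X\<^sup>2 + Y\<^sup>2)) * exp (C * r)) (at r)"
      unfolding e_def X_def Y_def dY_def
      by (auto intro!: derivative_eq_intros u_deriv'[OF rR] dv simp: algebra_simps)
    have "\<bar>g (u r)\<bar> \<le> L * \<bar>X\<bar>"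
      using L(2)[of "u r" "- \<alpha>"] above[of r] nonpos[of r] r \<alpha>_pos by (auto simp: X_def)
    then have "\<bar>Y\<bar> * \<bar>g (u r)\<bar> \<le> \<bar>Y\<bar> * (L * \<bar>X\<bar>)" by (intro mult_left_mono) auto
    then have "Y * g (u r) \<le> L * (\<bar>X\<bar> * \<bar>Y\<bar>)"
      by (metis abs_ge_self abs_mult mult.assoc mult.commute order_trans)
    moreover have "2 * (\<bar>X\<bar> * \<bar>Y\<bar>) \<le> X\<^sup>2 + Y\<^sup>2"
      using zero_le_power2[of "\<bar>X\<bar> - \<bar>Y\<bar>"] by (simp add: power2_diff)
    then have "L * (2 * (\<bar>X\<bar> * \<bar>Y\<bar>)) \<le> L * (X\<^sup>2 + Y\<^sup>2)" using L(1) by (intro mult_left_mono) auto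
    ultimately have 1: "2 * (Y * g (u r)) \<le> L * (X\<^sup>2 + Y\<^sup>2)" by linarith
    have 2: "- (X\<^sup>2 + Y\<^sup>2) \<le> 2 * X * Y"
      using zero_le_power2[of "X + Y"] by (simp add: power2_sum)
    have "(real k - 1) / r * Y\<^sup>2 \<le> (real k - 1) / z * (X\<^sup>2 + Y\<^sup>2)"
      using r z k2 by (intro mult_mono divide_left_mono) auto
    moreover have "2 * (Y * (K * Y / r)) \<le> 2 * K / z * Z" if "K / r * Y\<^sup>2 \<le> K / z * Z" for K Z
    proof -
      have "2 * (Y * (K * Y / r)) = 2 * (K / r * Y\<^sup>2)" by (simp add: power2_eq_square)
      also have "\<dots> \<le> 2 * (K / z * Z)" using that by simp
      finally show ?thesis by simp
    qed
    ultimately have 3: "2 * (Y * ((real k - 1) * Y / r)) \<le> 2 * (real k - 1) / z * (X\<^sup>2 + Y\<^sup>2)"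
      by blast
    have "2 * Y * dY = - 2 * (Y * ((real k - 1) * Y / r)) - 2 * (Y * g (u r))"
      by (simp add: dY_def Y_def algebra_simps)
    moreover have "C * (X\<^sup>2 + Y\<^sup>2) = (X\<^sup>2 + Y\<^sup>2) + L * (X\<^sup>2 + Y\<^sup>2) + 2 * (real k - 1) / z * (X\<^sup>2 + Y\<^sup>2)"
      unfolding C_def distrib_right by simp
    ultimately have "0 \<le> 2 * X * Y + 2 * Y * dY + C * (X\<^sup>2 + Y\<^sup>2)" using 1 2 3 by linarith
    then show "0 \<le> (2 * X * Y + 2 * Y * dY + C * (X\<^sup>2 + Y\<^sup>2)) * exp (C * r)" by simp
  qed
  also have "e c = 0" using vc \<open>u c = - \<alpha>\<close> by (simp add: e_def)
  finally have "(u z + \<alpha>)\<^sup>2 + (v z)\<^sup>2 \<le> 0" by (simp add: e_def mult_le_0_iff)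
  then have "v z = 0" by (smt (verit) zero_le_power2 power2_eq_iff_nonneg zero_power2 power_eq_0_iff)
  then show False using neg[of z] z by simp
qed

text \<open>At the first zero \<open>b\<close> of \<open>u'\<close>,
  \<open>0 = v b \<le> - b * g (u b) / k\<close> forces \<open>u b \<ge> - \<alpha>\<close>, and
  equality is excluded by \<open>not_stop_at_minus_\<alpha>\<close>. From \<open>b\<close> on
  \<open>recovery\<close> applies.\<close>

lemma turning:
  assumes r: "r \<in> radii R" "0 < r" "0 \<le> v r"
  shows "R = \<infinity>" and "\<exists>b>0. (\<forall>r. 0 < r \<and> r < b \<longrightarrow> v r < 0) \<and> u b < 0 \<and> (\<forall>r>b. 0 < v r)"
    and "(u \<longlongrightarrow> 0) at_top" and "\<And>r. r \<in> radii R \<Longrightarrow> - \<alpha> < u r" and switching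
proof -
  obtain z where z: "z \<in> radii R" "0 < z" "u z = 0" "\<And>t. 0 \<le> t \<Longrightarrow> t < z \<Longrightarrow> 0 < u t"
    "\<And>t. 0 < t \<Longrightarrow> t \<le> z \<Longrightarrow> v t < 0" "\<And>t. t \<in> radii R \<Longrightarrow> z < t \<Longrightarrow> u t < 0"
    using first_zero by blast
  have vz: "\<forall>t\<in>{0<..z}. v t < 0" using z(5) by simp
  have zr: "z < r" using z(5)[of r] r by force
  have "continuous_on {z..r} v" using z by (intro continuous_v' r) auto
  then obtain b where b: "z < b" "b \<le> r" "v b = 0" "\<And>t. z \<le> t \<Longrightarrow> t < b \<Longrightarrow> v t < 0"
    using first_hit[of z r v 0] zr z r by (metis less_eq_real_def)
  have bR: "b \<in> radii R" "0 < b" using radii_le[OF r(1)] b z by auto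
  have neg: "v t < 0" if "0 < t" "t < b" for t using that z(5)[of t] b(4)[of t] by (cases "t \<le> z") auto
  have "b * g (u b) / k \<le> 0" using w_le[OF bR(1)] b(3) by simp
  then have "g (u b) \<le> 0" using bR k_pos by (simp add: divide_le_0_iff mult_le_0_iff)
  have ub: "u b < 0" using z(6)[OF bR(1) b(1)] .
  have "- \<alpha> \<le> u b" using \<open>g (u b) \<le> 0\<close> g_pos'[of "u b"] by force
  moreover have "u b \<noteq> - \<alpha>"
  proof
    assume "u b = - \<alpha>"
    have "v b < 0"
    proof (rule not_stop_at_minus_\<alpha>[OF bR(1) z(2) b(1) b(4) _ \<open>u b = - \<alpha>\<close>])
      fix t assume "z \<le> t" "t \<le> b"
      then show "u t \<le> 0" using z(3) z(6)[of t] radii_le[OF bR(1), of t] z(2) by (cases "t = z") auto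
    qed auto
    then show False using b(3) by simp
  qed
  ultimately have low: "- \<alpha> < u b" by simp
  note rec = recovery[OF bR(1) low ub]
  have v0: "0 \<le> v b" using b(3) by simp
  show Rinf: "R = \<infinity>" using rec(1)[OF v0] .
  note inR = radii_infinity[OF this]
  show "\<exists>b>0. (\<forall>r. 0 < r \<and> r < b \<longrightarrow> v r < 0) \<and> u b < 0 \<and> (\<forall>r>b. 0 < v r)"
    using bR neg ub rec(3)[OF v0] by blast
  show "(u \<longlongrightarrow> 0) at_top" using rec(4)[OF v0] .
  show above: "- \<alpha> < u r" if "r \<in> radii R" for r
  proof (cases "r < b")
    case True
    then have "u b < u r" using that neg by (intro u_strict_dec bR) (auto simp: radii_def)
    then show ?thesis using low by simp
  next
    case False
    then show ?thesis using rec(2)[OF v0, of r] by simp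
  qed
  obtain c where c: "0 \<le> c" "c < z" "\<And>r. 0 < r \<Longrightarrow> r < c \<Longrightarrow> w r = 0" "\<And>r. c < r \<Longrightarrow> r \<le> z \<Longrightarrow> w r < 0"
    using opening_phase[OF z(1-3) vz] by blast
  obtain b' :: ereal where b': "b \<le> b'" "\<And>r. b < r \<Longrightarrow> r < b' \<Longrightarrow> w r < 0" "\<And>r. 0 \<le> r \<Longrightarrow> b' < r \<Longrightarrow> w r = 0"
    using rec(5)[OF v0] by blast
  \<comment> \<open>The turning point itself is free, so the free phases before and after it merge
    and no further switch arises.\<close>
  have "w b < 0"
  proof -
    have "g (u b) < 0" using low ub by (intro g_neg')
    then have "b * g (u b) / k < 0" using bR k_pos by (simp add: divide_less_0_iff mult_less_0_iff)
    then show ?thesis using b(3) by simp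
  qed
  have "w r < 0" if "0 < r" "c < r" "r < b'" for r
  proof -
    consider "r \<le> z" | "z < r" "r < b" | "r = b" | "b < r" by linarith
    then show ?thesis
    proof cases
      case 2
      have rR: "r \<in> radii R" using that by (simp add: inR)
      show ?thesis
        using above[OF rR] z(6)[OF rR 2(1)] neg[of r] 2 that by (intro w_neg_of_neg rR g_nonpos) auto
    qed (use c b' that \<open>w b < 0\<close> in auto)
  qed
  moreover have "ereal c \<le> b'" using b'(1) c(2) b(1) by (metis ereal_less_eq(3) less_imp_le less_trans order_trans)
  ultimately show switching unfolding switching_def
    using c(3) b'(3) by (intro exI[of _ "ereal c"] exI[of _ b']) auto
qed

text \<open>While falling with \<open>- \<alpha> \<le> u \<le> 0\<close> the motion is free. A limit
  above \<open>- \<alpha>\<close> would leave the reaction below a negative constant and finally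
  reverse the momentum; after passing \<open>- \<alpha>\<close> the sign of \<open>g'(u) u'\<close>
  makes contact permanent.\<close>

lemma monotone_case:
  assumes neg: "\<And>r. r \<in> radii R \<Longrightarrow> 0 < r \<Longrightarrow> v r < 0"
  shows switching and "(\<And>r. r \<in> radii R \<Longrightarrow> - \<alpha> \<le> u r) \<Longrightarrow> R = \<infinity> \<and> (u \<longlongrightarrow> - \<alpha>) at_top"
proof -
  obtain z where z: "z \<in> radii R" "0 < z" "u z = 0" "\<And>t. 0 \<le> t \<Longrightarrow> t < z \<Longrightarrow> 0 < u t"
    "\<And>t. 0 < t \<Longrightarrow> t \<le> z \<Longrightarrow> v t < 0" "\<And>t. t \<in> radii R \<Longrightarrow> z < t \<Longrightarrow> u t < 0"
    using first_zero by blast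
  have vz: "\<forall>t\<in>{0<..z}. v t < 0" using z(5) by simp
  have sdec: "u y < u x" if "0 \<le> x" "x < y" "y \<in> radii R" for x y
    using that neg radii_le[OF that(3)] by (intro u_strict_dec) auto
  obtain c where c: "0 \<le> c" "c < z" "\<And>r. 0 < r \<Longrightarrow> r < c \<Longrightarrow> w r = 0" "\<And>r. c < r \<Longrightarrow> r \<le> z \<Longrightarrow> w r < 0"
    using opening_phase[OF z(1-3) vz] by blast
  have free: "w r < 0" if r: "r \<in> radii R" "c < r" "- \<alpha> \<le> u r" for r
  proof (cases "r \<le> z")
    case False
    then show ?thesis
      using r z(6)[of r] neg[of r] z(2) by (intro w_neg_of_neg g_nonpos) auto
  qed (use c r in auto)
  show switching
  proof (cases "\<exists>r\<in>radii R. u r < - \<alpha>")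
    case True
    then obtain y where y: "y \<in> radii R" "u y < - \<alpha>" by blast
    have "continuous_on {0..y} (\<lambda>t. - u t)" by (intro continuous_on_minus continuous_u' y order_refl)
    from first_hit[OF this, of \<alpha>] y start \<alpha>_pos
    obtain d where d: "0 < d" "d \<le> y" "- u d = \<alpha>" "\<And>t. 0 \<le> t \<Longrightarrow> t < d \<Longrightarrow> - u t < \<alpha>"
      by (auto simp: radii_def)
    have "c < d"
    proof (rule ccontr)
      assume "\<not> c < d"
      then have "0 < u d" using z(4)[of d] c d by auto
      then show False using d(3) \<alpha>_pos by simp
    qed
    have free': "w r < 0" if "r \<in> radii R" "c < r" "r \<le> d" for r
      using free[OF that(1,2)] d(3) d(4)[of r] that c by (cases "r = d") auto
    obtain b :: ereal where b: "d \<le> b" "\<And>r. r \<in> radii R \<Longrightarrow> d < r \<Longrightarrow> r < b \<Longrightarrow> w r < 0"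
      "\<And>r. r \<in> radii R \<Longrightarrow> b < r \<Longrightarrow> w r = 0"
    proof (rule phase_tail[of d d])
      fix r assume r: "r \<in> radii R" "d < r"
      have "u r < - \<alpha>" using sdec[of d r] d r by simp
      then have "deriv g (u r) < 0" using \<beta>_less \<beta>_pos by (intro deriv_neg) auto
      then show "0 \<le> deriv g (u r) * v r" using neg[OF r(1)] r d by (simp add: mult_nonpos_nonpos)
    qed (use d in auto)
    have "w r < 0" if "r \<in> radii R" "c < r" "r < b" for r
      using free'[of r] b(2)[of r] that by (cases "r \<le> d") auto
    moreover have "ereal c \<le> b" using b(1) \<open>c < d\<close> by (metis ereal_less_eq(3) less_imp_le order_trans)
    ultimately show ?thesis unfolding switching_def
      using c(3) b(3) by (intro exI[of _ "ereal c"] exI[of _ b]) auto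
  next
    case False
    then have "w r < 0" if "r \<in> radii R" "c < r" for r using free[of r] that by force
    then show ?thesis unfolding switching_def
      using c(3) by (intro exI[of _ "ereal c"] exI[of _ \<infinity>]) auto
  qed
  assume above: "\<And>r. r \<in> radii R \<Longrightarrow> - \<alpha> \<le> u r"
  have Rinf: "R = \<infinity>"
    by (rule bounded_imp_global[OF zero_radii, of \<alpha>]) (use above u_less_\<alpha> in \<open>force simp: abs_le_iff\<close>)
  note inR = radii_infinity[OF this]
  obtain l where l: "- \<alpha> \<le> l" "(u \<longlongrightarrow> l) at_top" "\<And>x. 0 \<le> x \<Longrightarrow> l \<le> u x"
  proof (rule decreasing_limit[of 0 u "- \<alpha>"])
    show "u y \<le> u x" if "0 \<le> x" "x \<le> y" for x y
      using sdec[of x y] that by (cases "x = y") (auto simp: inR intro: less_imp_le)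
  qed (use above in \<open>auto simp: inR\<close>)
  have "l = - \<alpha>"
  proof (rule ccontr)
    assume "l \<noteq> - \<alpha>"
    then have "- \<alpha> < l" using l(1) by simp
    \<comment> \<open>Strictly past the zero, so that \<open>g\<close> has a negative maximum on
      \<open>[l, u s]\<close>.\<close>
    define s where "s = z + 1"
    have s: "0 < s" "u s < 0" "l \<le> u s" using z(2) z(6)[of s] l(3)[of s] by (auto simp: s_def inR)
    obtain m where m: "m \<in> {l..u s}" "\<And>t. t \<in> {l..u s} \<Longrightarrow> g t \<le> g m"
      using g_max[OF s(3)] by blast
    have gm: "g m < 0" using m(1) s \<open>- \<alpha> < l\<close> by (intro g_neg') auto
    define p0 where "p0 = s ^ (k - 1) * v s"
    have "p0 < 0" using s neg[of s] by (simp add: p0_def mult_pos_neg inR)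
    \<comment> \<open>By this radius the gain of momentum exceeds \<open>- p0\<close> by at least
      \<open>- g m / k\<close>.\<close>
    define y where "y = s + 1 + (- p0) * k / (- g m) "
    have "0 \<le> (- p0) * k / (- g m)"
      using \<open>p0 < 0\<close> gm by (intro divide_nonneg_pos mult_nonneg_nonneg) auto
    then have y: "s + 1 \<le> y" by (simp add: y_def)
    have "w t < 0" if "s < t" "t \<le> y" for t
      using that free[of t] above[of t] c s by (auto simp: inR s_def)
    then have eq: "y ^ (k - 1) * v y = p0 - (F y - F s)"
      unfolding p0_def using s y by (intro p_eq_free) (auto simp: inR)
    have "F y - F s \<le> g m * (y ^ k - s ^ k) / k"
    proof (rule F_diff_le)
      fix t assume t: "s \<le> t" "t \<le> y"
      have "u t \<le> u s" using sdec[of s t] t s by (cases "s = t") (auto simp: inR intro: less_imp_le)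
      then show "g (u t) \<le> g m" using l(3)[of t] t s by (intro m(2)) auto
    qed (use s y in \<open>auto simp: inR\<close>)
    moreover have "y - s \<le> y ^ k - s ^ k"
    proof -
      have y1: "1 \<le> y" "s \<le> y" using y s by auto
      have "s ^ (k - 1) * s \<le> y ^ (k - 1) * s" using y1 s by (intro mult_right_mono power_mono) auto
      moreover have "1 * (y - s) \<le> y ^ (k - 1) * (y - s)"
        using y1 by (intro mult_right_mono one_le_power) auto
      ultimately show ?thesis unfolding power_k right_diff_distrib by linarith
    qed
    then have "g m * (y ^ k - s ^ k) / k \<le> g m * (y - s) / k"
      using gm by (intro divide_right_mono mult_left_mono_neg) auto
    moreover have "g m * (y - s) / k = g m / k + p0"
      using gm k_pos by (simp add: y_def field_simps)
    moreover have "g m / k < 0" using gm k_pos by (simp add: divide_neg_pos)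
    ultimately have "0 < y ^ (k - 1) * v y" using eq by linarith
    then show False using neg[of y] y s by (simp add: inR zero_less_mult_iff)
  qed
  then show "R = \<infinity> \<and> (u \<longlongrightarrow> - \<alpha>) at_top" using Rinf l(2) by simp
qed

text \<open>For \<open>u 0 \<le> \<beta>\<close> the motion is free from the start and dissipates the energy \<open>u'\<^sup>2/2 + G(u)\<close>,
  \<open>G' = g\<close>, so it cannot climb the even potential \<open>G\<close> up to its maximum at \<open>- \<alpha>\<close>.\<close>

lemma turning_of_small_start:
  assumes "u 0 \<le> \<beta>" shows "\<exists>r\<in>radii R. 0 < r \<and> 0 \<le> v r"
proof (rule ccontr)
  assume "\<not> (\<exists>r\<in>radii R. 0 < r \<and> 0 \<le> v r)"
  then have neg: "v r < 0" if "r \<in> radii R" "0 < r" for r using that by force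
  obtain z where z: "z \<in> radii R" "0 < z" "u z = 0" "\<And>t. 0 \<le> t \<Longrightarrow> t < z \<Longrightarrow> 0 < u t"
    "\<And>t. 0 < t \<Longrightarrow> t \<le> z \<Longrightarrow> v t < 0" "\<And>t. t \<in> radii R \<Longrightarrow> z < t \<Longrightarrow> u t < 0"
    using first_zero by blast
  have vz: "\<forall>t\<in>{0<..z}. v t < 0" using z(5) by simp
  have free0: "\<And>r. 0 < r \<Longrightarrow> r \<le> z \<Longrightarrow> w r < 0"
    using opening_phase[OF z(1-3) vz] assms by metis
  \<comment> \<open>A level between \<beta> and \<alpha>: \<open>- x\<close> is reached at a finite
    radius even if \<open>u\<close> merely converges to \<open>- \<alpha>\<close>, while its
    potential still exceeds that of \<beta>.\<close>
  define x where "x = (\<alpha> + \<beta>) / 2"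
  have x: "\<beta> < x" "x < \<alpha>" "0 < x" using \<beta>_less \<beta>_pos by (auto simp: x_def)
  have "\<exists>r\<in>radii R. u r \<le> - x"
  proof (cases "\<exists>r\<in>radii R. u r < - \<alpha>")
    case False
    then have above: "\<And>r. r \<in> radii R \<Longrightarrow> - \<alpha> \<le> u r" by force
    have *: "R = \<infinity>" "(u \<longlongrightarrow> - \<alpha>) at_top" using monotone_case(2)[OF neg above] by auto
    have "\<forall>\<^sub>F r in at_top. u r < - x" using order_tendstoD(2)[OF *(2)] x by auto
    then have "\<forall>\<^sub>F r in at_top. u r < - x \<and> 0 \<le> r"
      using eventually_ge_at_top[of 0] by eventually_elim auto
    then obtain r where "u r < - x" "0 \<le> r" unfolding eventually_at_top_linorder by blast
    then show ?thesis using radii_infinity[OF *(1), of r] by (auto intro!: bexI[of _ r])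
  qed (use x in force)
  then obtain y where y: "y \<in> radii R" "u y \<le> - x" by blast
  have "continuous_on {0..y} (\<lambda>t. - u t)" by (intro continuous_on_minus continuous_u' y order_refl)
  from first_hit[OF this, of x] y start x
  obtain d where d: "0 < d" "d \<le> y" "- u d = x" "\<And>t. 0 \<le> t \<Longrightarrow> t < d \<Longrightarrow> - u t < x"
    by (auto simp: radii_def)
  have dR: "d \<in> radii R" using radii_le[OF y(1)] d by auto
  define G where "G = (\<lambda>s. integral {-\<alpha>..s} g)"
  have G: "(G has_real_derivative g s) (at s)" if "- \<alpha> < s" "s < \<alpha>" for s
  proof -
    have "(G has_real_derivative g s) (at s within {-\<alpha>..\<alpha>})"
      unfolding G_def by (rule integral_has_real_derivative[OF continuous_g]) (use that in auto)
    then show ?thesis using at_within_interior[of s "{-\<alpha>..\<alpha>}"] that by simp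
  qed
  have contG: "continuous_on {a..b} G" if "- \<alpha> < a" "b < \<alpha>" for a b
  proof (intro continuous_at_imp_continuous_on ballI)
    fix s assume "s \<in> {a..b}"
    then show "isCont G s" by (intro DERIV_isCont[OF G]) (use that in auto)
  qed
  have Gmono: "G a \<le> G b" if "0 \<le> a" "a \<le> b" "b < \<alpha>" for a b
    by (rule mono_from_derivative[OF that(2) contG G])
      (use that \<alpha>_pos in \<open>auto intro: g_nonneg\<close>)
  have "G (u 0) \<le> G \<beta>" using assms start \<beta>_less by (intro Gmono) auto
  also have "G \<beta> < G x"
    by (rule strict_mono_from_derivative[OF x(1) contG G])
      (use x \<beta>_pos \<alpha>_pos in \<open>auto intro!: g_pos\<close>)
  also have "G x = G (- x)"
  proof -
    have "G 0 - G (- 0) = G x - G (- x)"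
    proof (rule DERIV_isconst_end[OF x(3), symmetric])
      have "continuous_on {0..x} (\<lambda>s. G (- s))"
        by (rule continuous_on_compose2[OF contG[of "- x" 0]])
          (use x \<alpha>_pos in \<open>auto intro!: continuous_intros\<close>)
      then show "continuous_on {0..x} (\<lambda>s. G s - G (- s))"
        using x \<alpha>_pos by (intro continuous_on_diff contG) auto
      fix s assume s: "0 < s" "s < x"
      have "((\<lambda>s. G (- s)) has_real_derivative g (- s) * (- 1)) (at s)"
        by (rule DERIV_chain2[OF G]) (use s x in \<open>auto intro!: derivative_eq_intros\<close>)
      moreover have "(G has_real_derivative g s) (at s)" by (rule G) (use s x in auto)
      ultimately show "((\<lambda>s. G s - G (- s)) has_real_derivative 0) (at s)"
        using DERIV_diff[of G "g s" s UNIV "\<lambda>s. G (- s)" "g (- s) * (- 1)"] by (simp add: g_odd)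
    qed
    then show ?thesis by simp
  qed
  also have "G (- x) \<le> (v d)\<^sup>2 / 2 + G (u d)" using d(3) by auto
  also have "\<dots> \<le> (v 0)\<^sup>2 / 2 + G (u 0)"
  proof -
    have range: "u t \<in> {- x..u 0}" if "0 \<le> t" "t \<le> d" for t
    proof -
      have "- x \<le> u t" using d(3) d(4)[of t] that by (cases "t = d") auto
      moreover have "u t \<le> u 0"
        using u_strict_dec[OF radii_le[OF dR], of t 0] neg radii_le[OF dR] that by (cases "t = 0") (auto intro: less_imp_le)
      ultimately show ?thesis by simp
    qed
    have "- ((v 0)\<^sup>2 / 2 + G (u 0)) \<le> - ((v d)\<^sup>2 / 2 + G (u d))"
    proof (rule mono_from_derivative[where f = "\<lambda>r. - ((v r)\<^sup>2 / 2 + G (u r))"])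
      have "continuous_on {0..d} (\<lambda>r. G (u r))"
        by (rule continuous_on_compose2[OF contG[of "- x" "u 0"]])
          (use x start range in \<open>auto intro!: continuous_u' dR\<close>)
      then show "continuous_on {0..d} (\<lambda>r. - ((v r)\<^sup>2 / 2 + G (u r)))"
        by (intro continuous_intros continuous_v' dR) auto
      fix r assume r: "0 < r" "r < d"
      then have rR: "r \<in> radii R" using radii_le[OF dR] by auto
      have free: "w s < 0" if "0 < s" "s < d" for s
      proof (cases "s \<le> z")
        case False
        have sR: "s \<in> radii R" using radii_le[OF dR] that by auto
        show ?thesis using range[of s] that z(6)[OF sR] False neg[OF sR] x
          by (intro w_neg_of_neg sR g_nonpos) auto
      qed (use free0 that in auto)
      have "\<forall>\<^sub>F s in nhds r. s \<in> {0<..<d}" using r by (intro eventually_nhds_in_open) auto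
      then have "\<forall>\<^sub>F s in nhds r. w s < 0" by eventually_elim (use free in auto)
      note dv = v_deriv_free[OF rR r(1) this]
      have "((\<lambda>r. G (u r)) has_real_derivative g (u r) * v r) (at r)"
        by (rule DERIV_chain2[OF G u_deriv'[OF rR r(1)]]) (use range[of r] r x start in auto)
      moreover define D where "D = - (real k - 1) * v r / r - g (u r)"
      have "(v has_real_derivative D) (at r)" using dv by (simp add: D_def)
      ultimately have "((\<lambda>r. - ((v r)\<^sup>2 / 2 + G (u r))) has_real_derivative - (v r * D + g (u r) * v r)) (at r)"
        by (auto intro!: derivative_eq_intros)
      moreover have "- (v r * D + g (u r) * v r) = (real k - 1) * (v r)\<^sup>2 / r"
        using r by (simp add: D_def field_simps power2_eq_square)
      ultimately show "((\<lambda>r. - ((v r)\<^sup>2 / 2 + G (u r))) has_real_derivative (real k - 1) * (v r)\<^sup>2 / r) (at r)"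
        by simp
      show "0 \<le> (real k - 1) * (v r)\<^sup>2 / r" using k2 r by simp
    qed (use d in auto)
    then show ?thesis by simp
  qed
  also have "\<dots> = G (u 0)" by (simp add: vel_0[OF k2])
  finally show False by simp
qed

text \<open>The speed at \<open>u a = \<beta>\<close> is at least \<open>a g(\<beta>) / k\<close>. Up to the radius \<open>c a\<close> the reaction term
  removes at most half of the momentum \<open>r ^ (k - 1) * u'\<close>, and for large \<open>a\<close> this suffices to pass
  \<open>- \<alpha>\<close> before that radius.\<close>

lemma late_crossing:
  fixes c :: real
  assumes c: "1 < c" "c ^ k = 3 / 2" and a: "a \<in> radii R" "u a = \<beta>" "1 \<le> a" "6 * k * \<alpha> / (g \<beta> * (c - 1)) < a"
  shows "\<exists>r\<in>radii R. u r < - \<alpha>"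
proof (rule ccontr)
  assume "\<not> (\<exists>r\<in>radii R. u r < - \<alpha>)"
  then have above: "- \<alpha> \<le> u r" if "r \<in> radii R" for r using that by force
  have Rinf: "R = \<infinity>"
    by (rule bounded_imp_global[OF zero_radii, of \<alpha>]) (use above u_less_\<alpha> in \<open>force simp: abs_le_iff\<close>)
  note inR = radii_infinity[OF this]
  have g\<beta>: "0 < g \<beta>" using \<beta>_pos \<beta>_less by (intro g_pos)
  have a0: "0 < a" using a by simp
  have "a ^ (k - 1) * v a \<le> - (g \<beta> * a ^ k / k)"
  proof -
    have "v a \<le> - (a * g \<beta> / k)" using w_le[OF a(1)] a(2) by simp
    then have "a ^ (k - 1) * v a \<le> a ^ (k - 1) * (- (a * g \<beta> / k))"
      using a0 by (intro mult_left_mono) auto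
    then show ?thesis by (simp add: power_k mult_ac)
  qed
  \<comment> \<open>The remaining momentum is at least \<open>g \<beta> * a ^ k / (2 * k)\<close> in
    size, and \<open>r ^ (k - 1)\<close> is at most \<open>3 / 2 * a ^ (k - 1)\<close>; the quotient
    gives the factor \<open>1 / 3\<close>.\<close>
  have "v r \<le> - (g \<beta> * a / (3 * k))" if r: "a < r" "r < c * a" for r
  proof -
    have rR: "r \<in> radii R" "0 < r" using r a0 by (auto simp: inR)
    have "- g \<beta> * (r ^ k - a ^ k) / k \<le> F r - F a"
    proof (rule F_diff_ge[OF rR(1)])
      fix t assume t: "a \<le> t" "t \<le> r"
      then show "- g \<beta> \<le> g (u t)"
        using above[of t] u_less_\<alpha>[of t] a0 by (intro g_ge_m\<beta>) (auto simp: inR)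
    qed (use a0 r in auto)
    moreover have "r ^ (k - 1) * v r \<le> a ^ (k - 1) * v a - (F r - F a)"
      using r a0 by (intro p_le rR) auto
    ultimately have "r ^ (k - 1) * v r \<le> - (g \<beta> * a ^ k / k) + g \<beta> * (r ^ k - a ^ k) / k"
      using \<open>a ^ (k - 1) * v a \<le> - (g \<beta> * a ^ k / k)\<close> by simp
    also have "\<dots> = g \<beta> * (r ^ k - 2 * a ^ k) / k"
      by (simp add: add_divide_distrib diff_divide_distrib algebra_simps)
    also have "\<dots> \<le> g \<beta> * (- (a ^ k / 2)) / k"
    proof (intro divide_right_mono mult_left_mono)
      have "r ^ k \<le> (c * a) ^ k" using r rR by (intro power_mono) auto
      also have "\<dots> = 3 / 2 * a ^ k" using c by (simp add: power_mult_distrib)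
      finally show "r ^ k - 2 * a ^ k \<le> - (a ^ k / 2)" by simp
    qed (use g\<beta> in auto)
    finally have 1: "r ^ (k - 1) * v r \<le> - (g \<beta> * a / (3 * k) * (3 / 2 * a ^ (k - 1)))"
      by (simp add: power_k mult_ac)
    have "r ^ (k - 1) \<le> (c * a) ^ (k - 1)" using r rR by (intro power_mono) auto
    also have "\<dots> = c ^ (k - 1) * a ^ (k - 1)" by (simp add: power_mult_distrib)
    also have "\<dots> \<le> c ^ k * a ^ (k - 1)"
      using c(1) a0 by (intro mult_right_mono power_increasing) auto
    finally have "r ^ (k - 1) \<le> 3 / 2 * a ^ (k - 1)" using c by simp
    then have "g \<beta> * a / (3 * k) * r ^ (k - 1) \<le> g \<beta> * a / (3 * k) * (3 / 2 * a ^ (k - 1))"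
      using g\<beta> a0 by (intro mult_left_mono) auto
    then have "r ^ (k - 1) * v r \<le> r ^ (k - 1) * (- (g \<beta> * a / (3 * k)))" using 1 by (simp add: mult_ac)
    moreover have "0 < r ^ (k - 1)" using rR by simp
    ultimately show ?thesis using mult_le_cancel_left_pos by blast
  qed
  moreover have ca: "a \<le> c * a" "c * a \<in> radii R" using c a0 by (auto simp: inR)
  ultimately have "u (c * a) \<le> u a + - (g \<beta> * a / (3 * k)) * (c * a - a)"
    using a0 by (intro u_slope_le) auto
  also have "\<dots> < \<beta> - 2 * \<alpha>"
  proof -
    \<comment> \<open>The fall over \<open>[a, c * a]\<close> must exceed
      \<open>2 * \<alpha>\<close>; with the rate \<open>g \<beta> * a / (3 * k)\<close> this
      accounts for the \<open>6\<close>. One factor \<open>a\<close> is dropped because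
      \<open>a \<ge> 1\<close>.\<close>
    have "6 * k * \<alpha> < a * (g \<beta> * (c - 1))"
      using a(4) g\<beta> c(1) by (simp add: pos_divide_less_eq)
    also have "\<dots> \<le> a * (a * (g \<beta> * (c - 1)))"
      using a(3) g\<beta> c(1) a0 by (intro mult_left_mono) (auto intro!: mult_le_cancel_right1[THEN iffD2])
    finally have "2 * \<alpha> < a * (a * (g \<beta> * (c - 1))) / (3 * k)"
      using k_pos by (simp add: pos_less_divide_eq algebra_simps)
    also have "\<dots> = (g \<beta> * a / (3 * k)) * (c * a - a)" by (simp add: algebra_simps)
    finally show ?thesis using a(2) by simp
  qed
  finally show False using above[OF ca(2)] \<beta>_less by simp
qed

end

section \<open>Critical starting values\<close>

context bistable_reaction
begin

lemma trajectory_of: "max_solution k g R u \<Longrightarrow> bistable_trajectory k \<alpha> \<beta> g R u"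
  by unfold_locales

lemma positive_trajectory_of:
  "max_solution k g R u \<Longrightarrow> 0 < u 0 \<Longrightarrow> u 0 < \<alpha> \<Longrightarrow> positive_trajectory k \<alpha> \<beta> g R u"
  by unfold_locales

lemma stationary:
  assumes "max_solution k g R u" "g (u 0) = 0"
  shows "R = \<infinity>" "\<And>r. 0 \<le> r \<Longrightarrow> u r = u 0"
proof -
  note un = max_solution_unique[OF constant_max_solution[OF assms(2)] assms(1) refl]
  show "R = \<infinity>" using un(1) by simp
  show "u r = u 0" if "0 \<le> r" for r
    by (rule un(2)[symmetric]) (use that in \<open>simp add: radii_def\<close>)
qed

text \<open>The existence half of the equivalence. In each range of the starting value the
  qualitative analysis yields \<open>switching\<close>; for a finite \<open>R\<close> it also turns
  unboundedness of \<open>u\<close> into divergence.\<close>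

lemma max_solution_radial:
  assumes kN: "k < CARD('n::finite)" and ms: "max_solution k g R u"
  shows "radial_solution TYPE('n) k g R u"
proof -
  interpret bistable_trajectory k \<alpha> \<beta> g R u by (rule trajectory_of[OF ms])
  have "switching \<and> (R \<noteq> \<infinity> \<longrightarrow> filterlim (\<lambda>r. \<bar>u r\<bar>) at_top (at_left (real_of_ereal R)))"
  proof -
    consider "u 0 < - \<alpha>" | "g (u 0) = 0" | "- \<alpha> < u 0" "u 0 < 0" | "0 < u 0" "u 0 < \<alpha>" | "\<alpha> < u 0"
      using g_0 g_\<alpha> g_m\<alpha> by (metis linorder_neqE_linordered_idom)
    then show ?thesis
    proof cases
      case 1
      then show ?thesis using below_minus_\<alpha> at_bot_abs_at_top by blast
    next
      case 2
      note s = stationary[OF ms 2]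
      have "w r = 0" if r: "r \<in> radii R" "0 < r" for r
      proof -
        have "v r = vel k (\<lambda>_. 0) r"
        proof (rule vel_cong[OF k2 continuous_gu[OF r(1) order_refl]])
          show "g (u t) = 0" if "0 \<le> t" for t using s(2)[OF that] 2 by metis
        qed (use r in simp)
        then show ?thesis using s(2)[of r] r 2 by (simp add: vel_const[OF k2])
      qed
      then have switching unfolding switching_def by (intro exI[of _ "0::ereal"]) auto
      then show ?thesis using s(1) by simp
    next
      case 3
      have v0: "0 \<le> v 0" by (simp add: vel_0[OF k2])
      note rec = recovery[OF zero_radii 3 v0]
      obtain b :: ereal where b: "0 \<le> b" "\<And>r. 0 < r \<Longrightarrow> r < b \<Longrightarrow> w r < 0" "\<And>r. 0 \<le> r \<Longrightarrow> b < r \<Longrightarrow> w r = 0"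
        using rec(5) by (auto simp: zero_ereal_def)
      have switching unfolding switching_def
        using b by (intro exI[of _ "0::ereal"] exI[of _ b]) (auto simp: zero_ereal_def)
      then show ?thesis using rec(1) by simp
    next
      case 4
      interpret positive_trajectory k \<alpha> \<beta> g R u by (rule positive_trajectory_of[OF ms 4])
      show ?thesis
      proof (cases "\<exists>r\<in>radii R. 0 < r \<and> 0 \<le> v r")
        case True
        then obtain r where "r \<in> radii R" "0 < r" "0 \<le> v r" by blast
        from turning(1,5)[OF this] show ?thesis by simp
      next
        case False
        then have neg: "v r < 0" if "r \<in> radii R" "0 < r" for r using that by force
        have "R \<noteq> \<infinity> \<longrightarrow> filterlim (\<lambda>r. \<bar>u r\<bar>) at_top (at_left (real_of_ereal R))"
        proof (cases "\<exists>r\<in>radii R. u r < - \<alpha>")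
          case True
          then show ?thesis using descent(3) at_bot_abs_at_top by blast
        next
          case False
          then show ?thesis using monotone_case(2)[OF neg] by force
        qed
        then show ?thesis using monotone_case(1)[OF neg] by blast
      qed
    next
      case 5
      then show ?thesis using above_\<alpha> at_top_abs_at_top by blast
    qed
  qed
  then show ?thesis using switching_radial_solution[OF kN] by blast
qed

text \<open>The existential makes this a predicate of the starting value alone; by uniqueness any
  maximal solution decides it. The weak inequality is chosen so that the negation says
  \<open>u' < 0\<close> at every positive radius.\<close>

definition turns :: "real \<Rightarrow> bool" where
  "turns \<xi> \<longleftrightarrow> (\<exists>R u. max_solution k g R u \<and> u 0 = \<xi> \<and> (\<exists>r\<in>radii R. 0 < r \<and> 0 \<le> vel k (\<lambda>t. g (u t)) r))"

definition falls :: "real \<Rightarrow> bool" where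
  "falls \<xi> \<longleftrightarrow> (\<exists>R u. max_solution k g R u \<and> u 0 = \<xi> \<and> (\<exists>r\<in>radii R. u r < - \<alpha>))"

lemma turns_iff:
  assumes "max_solution k g R u"
  shows "turns (u 0) \<longleftrightarrow> (\<exists>r\<in>radii R. 0 < r \<and> 0 \<le> vel k (\<lambda>t. g (u t)) r)"
proof
  assume "turns (u 0)"
  then obtain R' u' r where *: "max_solution k g R' u'" "u' 0 = u 0" "r \<in> radii R'" "0 < r"
    "0 \<le> vel k (\<lambda>t. g (u' t)) r" unfolding turns_def by blast
  interpret T: bistable_trajectory k \<alpha> \<beta> g R' u' by (rule trajectory_of[OF *(1)])
  note un = max_solution_unique[OF *(1) assms *(2)]
  have "vel k (\<lambda>t. g (u' t)) r = vel k (\<lambda>t. g (u t)) r"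
    by (rule vel_cong[OF k2 T.continuous_gu[OF *(3) order_refl]]) (use * un T.radii_le in auto)
  then show "\<exists>r\<in>radii R. 0 < r \<and> 0 \<le> vel k (\<lambda>t. g (u t)) r"
    using * un(1) by auto
qed (use assms in \<open>auto simp: turns_def\<close>)

lemma falls_iff:
  assumes "max_solution k g R u"
  shows "falls (u 0) \<longleftrightarrow> (\<exists>r\<in>radii R. u r < - \<alpha>)"
proof
  assume "falls (u 0)"
  then obtain R' u' r where *: "max_solution k g R' u'" "u' 0 = u 0" "r \<in> radii R'" "u' r < - \<alpha>"
    unfolding falls_def by blast
  show "\<exists>r\<in>radii R. u r < - \<alpha>"
    using max_solution_unique[OF *(1) assms *(2)] * by auto
qed (use assms in \<open>auto simp: falls_def\<close>)

text \<open>\<open>0 \<le> v\<close> is not an open condition, but after the turning point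
  \<open>v\<close> is strictly positive, and that survives a small change of the starting
  value.\<close>

lemma open_turns:
  assumes \<xi>: "0 < \<xi>" "\<xi> < \<alpha>" "turns \<xi>"
  shows "\<exists>\<delta>>0. \<forall>\<zeta>. \<bar>\<zeta> - \<xi>\<bar> < \<delta> \<longrightarrow> turns \<zeta>"
proof -
  obtain R u r where u: "max_solution k g R u" "u 0 = \<xi>" "r \<in> radii R" "0 < r"
    "0 \<le> vel k (\<lambda>t. g (u t)) r" using \<xi>(3) unfolding turns_def by blast
  interpret positive_trajectory k \<alpha> \<beta> g R u by (rule positive_trajectory_of) (use u \<xi> in auto)
  note t = turning[OF u(3-5)]
  obtain b where b: "0 < b" "\<And>r. b < r \<Longrightarrow> 0 < v r" using t(2) by blast
  define T where "T = b + 1"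
  have T: "0 < T" "0 < v T" "ereal T < R" using b t(1) by (auto simp: T_def)
  obtain \<delta> where \<delta>: "0 < \<delta>" "\<And>R' w. max_solution k g R' w \<and> \<bar>w 0 - u 0\<bar> < \<delta> \<Longrightarrow> ereal T < R' \<and>
    (\<forall>r\<in>{0..T}. \<bar>w r - u r\<bar> < v T \<and> \<bar>vel k (\<lambda>t. g (w t)) r - v r\<bar> < v T)"
    using max_solution_dependence[OF u(1) T(1,3,2)] by blast
  have "turns \<zeta>" if \<zeta>: "\<bar>\<zeta> - \<xi>\<bar> < \<delta>" for \<zeta>
  proof -
    obtain R' w where w: "max_solution k g R' w" "w 0 = \<zeta>" using max_solution_exists by blast
    have "ereal T < R'" "\<bar>vel k (\<lambda>t. g (w t)) T - v T\<bar> < v T"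
      using \<delta>(2)[of R' w] w u(2) \<zeta> T(1) by auto
    then have "T \<in> radii R'" "0 \<le> vel k (\<lambda>t. g (w t)) T" using T(1) by (auto simp: radii_def)
    then show ?thesis using w T(1) unfolding turns_def by blast
  qed
  then show ?thesis using \<delta>(1) by blast
qed

lemma open_falls:
  assumes \<xi>: "0 < \<xi>" "falls \<xi>"
  shows "\<exists>\<delta>>0. \<forall>\<zeta>. \<bar>\<zeta> - \<xi>\<bar> < \<delta> \<longrightarrow> falls \<zeta>"
proof -
  obtain R u r where u: "max_solution k g R u" "u 0 = \<xi>" "r \<in> radii R" "u r < - \<alpha>"
    using \<xi>(2) unfolding falls_def by blast
  have r: "0 < r" "ereal r < R" using u \<xi> \<alpha>_pos by (cases "r = 0"; auto simp: radii_def)+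
  obtain \<delta> where \<delta>: "0 < \<delta>" "\<And>R' w. max_solution k g R' w \<and> \<bar>w 0 - u 0\<bar> < \<delta> \<Longrightarrow> ereal r < R' \<and>
    (\<forall>s\<in>{0..r}. \<bar>w s - u s\<bar> < - \<alpha> - u r \<and>
      \<bar>vel k (\<lambda>t. g (w t)) s - vel k (\<lambda>t. g (u t)) s\<bar> < - \<alpha> - u r)"
    using max_solution_dependence[OF u(1) r, of "- \<alpha> - u r"] u(4) by auto
  have "falls \<zeta>" if \<zeta>: "\<bar>\<zeta> - \<xi>\<bar> < \<delta>" for \<zeta>
  proof -
    obtain R' w where w: "max_solution k g R' w" "w 0 = \<zeta>" using max_solution_exists by blast
    have "ereal r < R'" "\<bar>w r - u r\<bar> < - \<alpha> - u r"
      using \<delta>(2)[of R' w] w u(2) \<zeta> r(1) by auto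
    then have "r \<in> radii R'" "w r < - \<alpha>" using r(1) by (auto simp: radii_def)
    then show ?thesis using w unfolding falls_def by blast
  qed
  then show ?thesis using \<delta>(1) by blast
qed

lemma falls_imp_not_turns: "0 < \<xi> \<Longrightarrow> \<xi> < \<alpha> \<Longrightarrow> falls \<xi> \<Longrightarrow> \<not> turns \<xi>"
proof
  assume \<xi>: "0 < \<xi>" "\<xi> < \<alpha>" "falls \<xi>" "turns \<xi>"
  obtain R u where u: "max_solution k g R u" "u 0 = \<xi>" using max_solution_exists by blast
  interpret positive_trajectory k \<alpha> \<beta> g R u by (rule positive_trajectory_of) (use u \<xi> in auto)
  obtain r where "r \<in> radii R" "0 < r" "0 \<le> v r" using turns_iff[OF u(1)] u(2) \<xi> by auto
  from turning(4)[OF this] show False using falls_iff[OF u(1)] u(2) \<xi> by force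
qed

lemma turns_small: "0 < \<xi> \<Longrightarrow> \<xi> \<le> \<beta> \<Longrightarrow> turns \<xi>"
proof -
  assume \<xi>: "0 < \<xi>" "\<xi> \<le> \<beta>"
  obtain R u where u: "max_solution k g R u" "u 0 = \<xi>" using max_solution_exists by blast
  interpret positive_trajectory k \<alpha> \<beta> g R u by (rule positive_trajectory_of) (use u \<xi> \<beta>_less in auto)
  show ?thesis using turning_of_small_start turns_iff[OF u(1)] u(2) \<xi> by auto
qed

text \<open>Continuous dependence at the constant solution \<alpha> keeps \<open>u\<close> above
  \<beta> up to any prescribed radius. \<open>T\<close> is the radius from which
  \<open>late_crossing\<close> applies.\<close>

lemma falls_near_\<alpha>: "\<exists>\<eta>>0. \<forall>\<xi>. 0 < \<xi> \<and> \<alpha> - \<eta> < \<xi> \<and> \<xi> < \<alpha> \<longrightarrow> falls \<xi>"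
proof -
  define c where "c = root k (3 / 2)"
  have c: "1 < c" "c ^ k = 3 / 2" using k2 by (auto simp: c_def)
  define T where "T = max 1 (6 * k * \<alpha> / (g \<beta> * (c - 1)))"
  have T: "0 < T" "1 \<le> T" "6 * k * \<alpha> / (g \<beta> * (c - 1)) \<le> T" by (auto simp: T_def)
  have "ereal T < \<infinity>" "0 < \<alpha> - \<beta>" using \<beta>_less by auto
  from max_solution_dependence[OF constant_max_solution[OF g_\<alpha>] T(1) this]
  obtain \<delta> where \<delta>: "0 < \<delta>" "\<And>R' w. max_solution k g R' w \<Longrightarrow> \<bar>w 0 - \<alpha>\<bar> < \<delta> \<Longrightarrow> ereal T < R' \<and>
    (\<forall>r\<in>{0..T}. \<bar>w r - \<alpha>\<bar> < \<alpha> - \<beta>)"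
    by blast
  have "falls \<xi>" if \<xi>: "0 < \<xi>" "\<alpha> - \<delta> < \<xi>" "\<xi> < \<alpha>" for \<xi>
  proof -
    obtain R u where u: "max_solution k g R u" "u 0 = \<xi>" using max_solution_exists by blast
    interpret positive_trajectory k \<alpha> \<beta> g R u by (rule positive_trajectory_of) (use u \<xi> in auto)
    have near: "\<beta> < u r" if "0 \<le> r" "r \<le> T" for r
    proof -
      have "\<bar>u r - \<alpha>\<bar> < \<alpha> - \<beta>" using \<delta>(2)[OF u(1)] u(2) \<xi> that by auto
      then show ?thesis by linarith
    qed
    obtain z where z: "z \<in> radii R" "u z < 0" using becomes_negative by blast
    have Tz: "T < z"
    proof (rule ccontr)
      assume "\<not> T < z"
      then have "\<beta> < u z" using z(1) by (intro near) (auto simp: radii_def)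
      then show False using z(2) \<beta>_pos by simp
    qed
    have "continuous_on {T..z} (\<lambda>t. - u t)" using T by (intro continuous_on_minus continuous_u' z) auto
    from first_hit[OF this, of "- \<beta>"] Tz near[of T] T z \<beta>_pos
    obtain a where a: "T < a" "a \<le> z" "- u a = - \<beta>" by auto
    have "\<exists>r\<in>radii R. u r < - \<alpha>"
      by (rule late_crossing[OF c, of a]) (use a T z in \<open>auto intro: radii_le\<close>)
    then show ?thesis using u unfolding falls_def by blast
  qed
  then show ?thesis using \<delta>(1) by blast
qed

lemma exists_critical:
  "\<exists>\<xi>. 0 < \<xi> \<and> \<xi> < \<alpha> \<and> \<not> turns \<xi> \<and> \<not> falls \<xi>"
proof (rule ccontr)
  assume none: "\<not> ?thesis"
  let ?I = "{0<..<\<alpha>}"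
  have open_locally: "open {\<xi> \<in> ?I. P \<xi>}"
    if P: "\<And>\<xi>. \<xi> \<in> ?I \<Longrightarrow> P \<xi> \<Longrightarrow> \<exists>\<delta>>0. \<forall>\<zeta>. \<bar>\<zeta> - \<xi>\<bar> < \<delta> \<longrightarrow> P \<zeta>" for P
    unfolding open_dist
  proof
    fix \<xi> assume "\<xi> \<in> {\<xi> \<in> ?I. P \<xi>}"
    then have \<xi>: "0 < \<xi>" "\<xi> < \<alpha>" "P \<xi>" by auto
    then obtain \<delta> where "0 < \<delta>" "\<And>\<zeta>. \<bar>\<zeta> - \<xi>\<bar> < \<delta> \<Longrightarrow> P \<zeta>" using P[of \<xi>] by auto
    then show "\<exists>e>0. \<forall>y. dist y \<xi> < e \<longrightarrow> y \<in> {\<xi> \<in> ?I. P \<xi>}"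
      using \<xi> by (intro exI[of _ "Min {\<delta>, \<xi>, \<alpha> - \<xi>}"]) (auto simp: dist_real_def)
  qed
  have 1: "open {\<xi> \<in> ?I. turns \<xi>}" by (rule open_locally) (use open_turns in auto)
  have 2: "open {\<xi> \<in> ?I. falls \<xi>}" by (rule open_locally) (use open_falls in auto)
  have "{\<xi> \<in> ?I. turns \<xi>} \<inter> ?I = {} \<or> {\<xi> \<in> ?I. falls \<xi>} \<inter> ?I = {}"
    by (rule connectedD[OF connected_Ioo 1 2]) (use none falls_imp_not_turns in auto)
  moreover have "\<beta> \<in> {\<xi> \<in> ?I. turns \<xi>} \<inter> ?I" using turns_small[of \<beta>] \<beta>_pos \<beta>_less by auto
  moreover obtain \<eta> where \<eta>: "0 < \<eta>" "\<And>\<xi>. 0 < \<xi> \<Longrightarrow> \<alpha> - \<eta> < \<xi> \<Longrightarrow> \<xi> < \<alpha> \<Longrightarrow> falls \<xi>"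
    using falls_near_\<alpha> by blast
  have "max (\<alpha> / 2) (\<alpha> - \<eta> / 2) \<in> {\<xi> \<in> ?I. falls \<xi>} \<inter> ?I"
    using \<eta> \<alpha>_pos by (auto simp: max_def)
  ultimately show False by blast
qed

text \<open>Openness of \<open>turns\<close> at \<beta> itself puts \<open>lo\<close> strictly above
  \<beta>. The critical value, being of neither kind, lies outside both outer ranges.\<close>

lemma thresholds:
  obtains lo ss hi where "\<beta> < lo" "lo \<le> ss" "ss \<le> hi" "hi < \<alpha>" "0 < ss"
    "\<And>\<xi>. 0 < \<xi> \<Longrightarrow> \<xi> < lo \<Longrightarrow> turns \<xi>" "\<not> turns ss" "\<not> falls ss"
    "\<And>\<xi>. hi < \<xi> \<Longrightarrow> \<xi> < \<alpha> \<Longrightarrow> falls \<xi>"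
proof -
  obtain ss where ss: "0 < ss" "ss < \<alpha>" "\<not> turns ss" "\<not> falls ss" using exists_critical by blast
  obtain \<delta> where \<delta>: "0 < \<delta>" "\<And>\<zeta>. \<bar>\<zeta> - \<beta>\<bar> < \<delta> \<Longrightarrow> turns \<zeta>"
    using open_turns[OF \<beta>_pos \<beta>_less turns_small[OF \<beta>_pos order_refl]] by blast
  obtain \<eta> where \<eta>: "0 < \<eta>" "\<And>\<xi>. 0 < \<xi> \<Longrightarrow> \<alpha> - \<eta> < \<xi> \<Longrightarrow> \<xi> < \<alpha> \<Longrightarrow> falls \<xi>"
    using falls_near_\<alpha> by blast
  have lo: "turns \<xi>" if "0 < \<xi>" "\<xi> < \<beta> + \<delta>" for \<xi>
    using turns_small[OF that(1)] \<delta>(2)[of \<xi>] that by (cases "\<xi> \<le> \<beta>") auto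
  define hi where "hi = max 0 (\<alpha> - \<eta>)"
  have hi: "falls \<xi>" if "hi < \<xi>" "\<xi> < \<alpha>" for \<xi> using \<eta>(2)[of \<xi>] that by (auto simp: hi_def)
  show ?thesis
  proof (rule that[of "\<beta> + \<delta>" ss hi])
    show "\<beta> + \<delta> \<le> ss" using lo[of ss] ss by force
    show "ss \<le> hi" using hi[of ss] ss by force
    show "hi < \<alpha>" using \<eta> \<alpha>_pos by (auto simp: hi_def)
  qed (use \<delta> ss lo hi in auto)
qed

end

theorem theorem2p6:
  fixes k :: nat and g :: "real \<Rightarrow> real" and \<alpha> \<beta> :: real
  assumes "2 \<le> k" and "k < CARD('n::finite)"
    and "bistable \<alpha> \<beta> g"
  shows "(\<forall>\<xi>. \<exists>R u. radial_solution TYPE('n) k g R u \<and> u 0 = \<xi> \<and>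
            (\<forall>R' v. radial_solution TYPE('n) k g R' v \<and> v 0 = \<xi> \<longrightarrow>
               R' = R \<and> (\<forall>r\<in>radii R. v r = u r))) \<and>
         (\<exists>\<xi>lo \<xi>ss \<xi>hi. \<beta> < \<xi>lo \<and> \<xi>lo \<le> \<xi>ss \<and> \<xi>ss \<le> \<xi>hi \<and> \<xi>hi < \<alpha> \<and>
            (\<forall>\<xi> R u. radial_solution TYPE('n) k g R u \<and> u 0 = \<xi> \<longrightarrow>
               (\<xi> \<in> {-\<alpha>, 0, \<alpha>} \<longrightarrow> R = \<infinity> \<and> (\<forall>r\<ge>0. u r = \<xi>)) \<and>
               (\<xi> < -\<alpha> \<longrightarrow>
                  (\<forall>r. 0 < r \<and> ereal r < R \<longrightarrow> deriv u r < 0) \<and>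
                  filterlim (u \<circ> real_of_ereal) at_bot (at_left R)) \<and>
               (\<alpha> < \<xi> \<longrightarrow>
                  (\<forall>r. 0 < r \<and> ereal r < R \<longrightarrow> 0 < deriv u r) \<and>
                  filterlim (u \<circ> real_of_ereal) at_top (at_left R)) \<and>
               (-\<alpha> < \<xi> \<and> \<xi> < 0 \<longrightarrow>
                  R = \<infinity> \<and> (\<forall>r>0. 0 < deriv u r) \<and> (u \<longlongrightarrow> 0) at_top) \<and>
               (\<xi>hi < \<xi> \<and> \<xi> < \<alpha> \<longrightarrow>
                  (\<forall>r. 0 < r \<and> ereal r < R \<longrightarrow> deriv u r < 0) \<and>
                  filterlim (u \<circ> real_of_ereal) at_bot (at_left R)) \<and>
               (\<xi> = \<xi>ss \<longrightarrow>
                  R = \<infinity> \<and> (\<forall>r>0. deriv u r < 0) \<and> (u \<longlongrightarrow> -\<alpha>) at_top) \<and>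
               (0 < \<xi> \<and> \<xi> < \<xi>lo \<longrightarrow>
                  R = \<infinity> \<and>
                  (\<exists>b>0. (\<forall>r. 0 < r \<and> r < b \<longrightarrow> deriv u r < 0) \<and> u b < 0 \<and>
                     (\<forall>r>b. 0 < deriv u r) \<and> (u \<longlongrightarrow> 0) at_top))))"
proof -
  interpret bistable_reaction k \<alpha> \<beta> g by unfold_locales (use assms in auto)
  note to_max = radial_solution_max_solution[OF assms(2)]
  have unique: "\<exists>R u. radial_solution TYPE('n) k g R u \<and> u 0 = \<xi> \<and>
            (\<forall>R' v. radial_solution TYPE('n) k g R' v \<and> v 0 = \<xi> \<longrightarrow>
               R' = R \<and> (\<forall>r\<in>radii R. v r = u r))" for \<xi>
  proof -
    obtain R u where u: "max_solution k g R u" "u 0 = \<xi>" using max_solution_exists by blast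
    have "R' = R \<and> (\<forall>r\<in>radii R. v r = u r)"
      if "radial_solution TYPE('n) k g R' v" "v 0 = \<xi>" for R' v
      using max_solution_unique[OF u(1) to_max[OF that(1)]] u(2) that(2) by auto
    then show ?thesis using max_solution_radial[OF assms(2) u(1)] u(2) by blast
  qed
  obtain lo ss hi where th: "\<beta> < lo" "lo \<le> ss" "ss \<le> hi" "hi < \<alpha>" "0 < ss"
    "\<And>\<xi>. 0 < \<xi> \<Longrightarrow> \<xi> < lo \<Longrightarrow> turns \<xi>" "\<not> turns ss" "\<not> falls ss"
    "\<And>\<xi>. hi < \<xi> \<Longrightarrow> \<xi> < \<alpha> \<Longrightarrow> falls \<xi>"
    using thresholds by metis
  have profile: "(\<xi> \<in> {-\<alpha>, 0, \<alpha>} \<longrightarrow> R = \<infinity> \<and> (\<forall>r\<ge>0. u r = \<xi>)) \<and>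
             (\<xi> < -\<alpha> \<longrightarrow>
                (\<forall>r. 0 < r \<and> ereal r < R \<longrightarrow> deriv u r < 0) \<and>
                filterlim (u \<circ> real_of_ereal) at_bot (at_left R)) \<and>
             (\<alpha> < \<xi> \<longrightarrow>
                (\<forall>r. 0 < r \<and> ereal r < R \<longrightarrow> 0 < deriv u r) \<and>
                filterlim (u \<circ> real_of_ereal) at_top (at_left R)) \<and>
             (-\<alpha> < \<xi> \<and> \<xi> < 0 \<longrightarrow>
                R = \<infinity> \<and> (\<forall>r>0. 0 < deriv u r) \<and> (u \<longlongrightarrow> 0) at_top) \<and>
             (hi < \<xi> \<and> \<xi> < \<alpha> \<longrightarrow>
                (\<forall>r. 0 < r \<and> ereal r < R \<longrightarrow> deriv u r < 0) \<and>
                filterlim (u \<circ> real_of_ereal) at_bot (at_left R)) \<and>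
             (\<xi> = ss \<longrightarrow>
                R = \<infinity> \<and> (\<forall>r>0. deriv u r < 0) \<and> (u \<longlongrightarrow> -\<alpha>) at_top) \<and>
             (0 < \<xi> \<and> \<xi> < lo \<longrightarrow>
                R = \<infinity> \<and>
                (\<exists>b>0. (\<forall>r. 0 < r \<and> r < b \<longrightarrow> deriv u r < 0) \<and> u b < 0 \<and>
                   (\<forall>r>b. 0 < deriv u r) \<and> (u \<longlongrightarrow> 0) at_top))"
    if rs: "radial_solution TYPE('n) k g R u \<and> u 0 = \<xi>" for \<xi> R u
  proof -
    have \<xi>: "u 0 = \<xi>" using rs by simp
    have ms: "max_solution k g R u" using to_max rs by blast
    interpret bistable_trajectory k \<alpha> \<beta> g R u by (rule trajectory_of[OF ms])
    have deriv: "deriv u r = v r" "r \<in> radii R" if "0 < r" "ereal r < R" for r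
      using that deriv_u[of r] by (auto simp: radii_def)
    have "R = \<infinity> \<and> (\<forall>r\<ge>0. u r = \<xi>)" if "\<xi> \<in> {-\<alpha>, 0, \<alpha>}"
    proof -
      have "g \<xi> = 0" using that by auto
      then have "g (u 0) = 0" using \<xi> by simp
      from stationary[OF ms this] \<xi> show ?thesis by metis
    qed
    moreover have "(\<forall>r. 0 < r \<and> ereal r < R \<longrightarrow> deriv u r < 0) \<and>
        filterlim (u \<circ> real_of_ereal) at_bot (at_left R)" if "\<xi> < - \<alpha>"
      using below_minus_\<alpha> that \<xi> deriv by auto
    moreover have "(\<forall>r. 0 < r \<and> ereal r < R \<longrightarrow> 0 < deriv u r) \<and>
        filterlim (u \<circ> real_of_ereal) at_top (at_left R)" if "\<alpha> < \<xi>"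
      using above_\<alpha> that \<xi> deriv by auto
    moreover have "R = \<infinity> \<and> (\<forall>r>0. 0 < deriv u r) \<and> (u \<longlongrightarrow> 0) at_top" if "-\<alpha> < \<xi> \<and> \<xi> < 0"
    proof -
      have "- \<alpha> < u 0" "u 0 < 0" "0 \<le> v 0" using \<xi> that by (auto simp: vel_0[OF k2])
      note rec = recovery[OF zero_radii this]
      show ?thesis using rec(1,3,4) deriv by auto
    qed
    moreover have "(\<forall>r. 0 < r \<and> ereal r < R \<longrightarrow> deriv u r < 0) \<and>
        filterlim (u \<circ> real_of_ereal) at_bot (at_left R)" if *: "hi < \<xi> \<and> \<xi> < \<alpha>"
    proof -
      have f: "falls \<xi>" and "0 < \<xi>" using th * by auto
      then have "\<not> turns \<xi>" using falls_imp_not_turns * by blast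
      then have "v r < 0" if "r \<in> radii R" "0 < r" for r
        using turns_iff[OF ms] \<xi> that by force
      moreover have "filterlim (u \<circ> real_of_ereal) at_bot (at_left R)"
        using f falls_iff[OF ms] \<xi> descent(3) by auto
      ultimately show ?thesis using deriv by auto
    qed
    moreover have "R = \<infinity> \<and> (\<forall>r>0. deriv u r < 0) \<and> (u \<longlongrightarrow> -\<alpha>) at_top" if *: "\<xi> = ss"
    proof -
      have "0 < u 0" "u 0 < \<alpha>" using th * \<xi> by auto
      interpret positive_trajectory k \<alpha> \<beta> g R u by (rule positive_trajectory_of) fact+
      have neg: "v r < 0" if "r \<in> radii R" "0 < r" for r
        using turns_iff[OF ms] \<xi> * th(7) that by force
      have "- \<alpha> \<le> u r" if "r \<in> radii R" for r
        using falls_iff[OF ms] \<xi> * th(8) that by force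
      then have "R = \<infinity> \<and> (u \<longlongrightarrow> - \<alpha>) at_top" using monotone_case(2)[OF neg] by blast
      then show ?thesis using neg deriv by auto
    qed
    moreover have "R = \<infinity> \<and>
                (\<exists>b>0. (\<forall>r. 0 < r \<and> r < b \<longrightarrow> deriv u r < 0) \<and> u b < 0 \<and>
                   (\<forall>r>b. 0 < deriv u r) \<and> (u \<longlongrightarrow> 0) at_top)" if *: "0 < \<xi> \<and> \<xi> < lo"
    proof -
      have "0 < u 0" "u 0 < \<alpha>" using th * \<xi> by auto
      interpret positive_trajectory k \<alpha> \<beta> g R u by (rule positive_trajectory_of) fact+
      obtain r where "r \<in> radii R" "0 < r" "0 \<le> v r"
        using turns_iff[OF ms] \<xi> th(6)[of \<xi>] * by auto
      note t = turning[OF this]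
      obtain b where "0 < b" "\<And>r. 0 < r \<Longrightarrow> r < b \<Longrightarrow> v r < 0" "u b < 0" "\<And>r. b < r \<Longrightarrow> 0 < v r"
        using t(2) by blast
      then show ?thesis using t(1,3) deriv by (intro conjI exI[of _ b]) auto
    qed
    ultimately show ?thesis by blast
  qed
  show ?thesis
    by (intro conjI[OF allI[OF unique]] exI[of _ lo] exI[of _ ss] exI[of _ hi] allI impI profile
        conjI[OF th(1) conjI[OF th(2) conjI[OF th(3) conjI[OF th(4)]]]])
qed

end
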